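(* Fix $\varepsilon>0$ and let $q>\bar q$. Set $K''=C_L+C_L^{-1}+2K_f$ and $\hat\alpha=\left(\frac{C_q}{C_L}K''+1\right)^q$, and suppose $C_f<\frac{qC_L}{C_q(\hat\alpha+1)}$. Then there exists $(m_\varepsilon,w_\varepsilon)\in\mathcal{K}\cap B_{\hat\alpha}$ which is a local minimum of $\mathcal{E}_\varepsilon$; moreover there is $\bar\delta>0$ such that $\mathcal{E}_\varepsilon(m_\varepsilon,w_\varepsilon)=c_{\hat\alpha-\delta}=c_{\hat\alpha}$ for all $0<\delta<\bar\delta$, where $c_\alpha=\inf_{\mathcal{K}\cap B_\alpha}\mathcal{E}_\varepsilon$.
   Context: $\Omega\subset\mathbb{R}^N$ ($N\ge1$) is a bounded domain with $C^3$ boundary and $|\Omega|=1$. $H:\mathbb{R}^N\to\mathbb{R}$ is differentiable with, for some $C_H>1,K_H>0,\gamma>1$ and all $p$: $C_H^{-1}|p|^\gamma-K_H\le H(p)\le C_H|p|^\gamma+K_H$, $\nabla H(p)\cdot p-H(p)\ge C_H^{-1}|p|^\gamma-C_H$, $|\nabla H(p)|\le C_H|p|^{\gamma-1}+K_H$. $\gamma'=\gamma/(\gamma-1)$, $\bar q=1+\gamma'/N$. $f:\mathbb{R}^N\times[0,\infty)\to\mathbb{R}$ is locally Lipschitz with $-C_fm^{q-1}-K_f\le f(x,m)\le C_fm^{q-1}+K_f$, $C_f,K_f>0$, $q>1$; $F(x,m)=\int_0^mf(x,n)dn$ for $m\ge0$, $+\infty$ for $m<0$. $L(v)=\sup_p[p\cdot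 v-H(p)]$; $mL(-w/m)$ means $mL(-w/m)$ if $m>0$, $0$ if $m=0,w=0$, $+\infty$ otherwise. $\frac1r=\frac1{\gamma'}+\frac1{\gamma q}$. $\mathcal{K}$ is the set of $(m,w)$ with $m\in L^1\cap W^{1,r}(\Omega)$, $w\in L^{\gamma'q/(\gamma'+q-1)}(\Omega;\mathbb{R}^N)$, $\int_\Omega\nabla m\cdot\nabla\phi=\int_\Omega w\cdot\nabla\phi$ for all $\phi\in C^\infty(\overline\Omega)$, $\int_\Omega m=1$, $m\ge0$ a.e. $\chi_\varepsilon$ is a standard symmetric mollifier; $m$ and $f$ are extended by $0$ outside $\Omega$; $F_\varepsilon[m]=\int_\Omega F(x,(m*\chi_\varepsilon)(x))dx$; $\mathcal{E}_\varepsilon(m,w)=\int_\Omega mL(-w/m)dx+F_\varepsilon[m]$ on $\mathcal{K}$, $+\infty$ otherwise. $B_\alpha=\{(m,w)\in\mathcal{K}:\|m\|_{L^q}^q\le\alpha\}$. $C_L>0$ is a fixed constant with $C_L|v|^{\gamma'}\le L(v)\le C_L^{-1}(|v|^{\gamma'}+1)$ for all $v$. $C_q>0$ is a fixed constant such that every $(m,w)$ as in $\mathcal{K}$ with $E:=\int_\Omega|w|^{\gamma'}m^{1-\gamma'}dx<\infty$ satisfies $\|m\|_{W^{1,r}}\le C_q(E+1)$ and $\|m\|_{L^q}\le C_q(E+1)$. *)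

theory Defs
  imports "HOL-Analysis.Analysis"
begin

fun Ck :: "nat \<Rightarrow> ('a::euclidean_space \<Rightarrow> real) \<Rightarrow> bool" where
  "Ck 0 f = continuous_on UNIV f"
| "Ck (Suc k) f = (continuous_on UNIV f \<and>
     (\<forall>b\<in>Basis. \<exists>g. (\<forall>x. ((\<lambda>t. f (x + t *\<^sub>R b)) has_real_derivative g x) (at 0)) \<and> Ck k g))"

definition smooth :: "('a::euclidean_space \<Rightarrow> real) \<Rightarrow> bool" where
  "smooth f \<longleftrightarrow> (\<forall>k. Ck k f)"

definition is_gradient :: "('a::euclidean_space \<Rightarrow> real) \<Rightarrow> ('a \<Rightarrow> 'a) \<Rightarrow> bool" where
  "is_gradient phi Dphi \<longleftrightarrow> (\<forall>x. (phi has_derivative (\<lambda>h. Dphi x \<bullet> h)) (at x))"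

definition C3_boundary :: "'a::euclidean_space set \<Rightarrow> bool" where
  "C3_boundary \<Omega> \<longleftrightarrow> (\<forall>x0\<in>frontier \<Omega>. \<exists>U \<rho> D\<rho>. open U \<and> x0 \<in> U \<and> Ck 3 \<rho> \<and>
      is_gradient \<rho> D\<rho> \<and> (\<forall>x\<in>U. D\<rho> x \<noteq> 0) \<and> \<Omega> \<inter> U = {x\<in>U. \<rho> x < 0})"

definition bounded_C3_domain :: "'a::euclidean_space set \<Rightarrow> bool" where
  "bounded_C3_domain \<Omega> \<longleftrightarrow> open \<Omega> \<and> connected \<Omega> \<and> \<Omega> \<noteq> {} \<and> bounded \<Omega> \<and> C3_boundary \<Omega>"

definition lp_pow :: "'a::euclidean_space set \<Rightarrow> real \<Rightarrow> ('a \<Rightarrow> 'b::real_normed_vector) \<Rightarrow> ennreal" where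
  "lp_pow S p f = (\<integral>\<^sup>+ x. indicator S x * ennreal (norm (f x) powr p) \<partial>lebesgue)"

definition memLp :: "'a::euclidean_space set \<Rightarrow> real \<Rightarrow> ('a \<Rightarrow> 'b::{real_normed_vector, second_countable_topology}) \<Rightarrow> bool" where
  "memLp S p f \<longleftrightarrow> f \<in> borel_measurable (lebesgue_on S) \<and> lp_pow S p f < \<infinity>"

(* the L^p norm (meaningful for f in L^p) *)
definition Lp_norm :: "'a::euclidean_space set \<Rightarrow> real \<Rightarrow> ('a \<Rightarrow> 'b::real_normed_vector) \<Rightarrow> real" where
  "Lp_norm S p f = enn2real (lp_pow S p f) powr (1 / p)"

definition weak_grad :: "'a::euclidean_space set \<Rightarrow> ('a \<Rightarrow> real) \<Rightarrow> ('a \<Rightarrow> 'a) \<Rightarrow> bool" where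
  "weak_grad \<Omega> m G \<longleftrightarrow> (\<forall>phi Dphi. smooth phi \<and> is_gradient phi Dphi \<and>
      compact (closure {x. phi x \<noteq> 0}) \<and> closure {x. phi x \<noteq> 0} \<subseteq> \<Omega> \<longrightarrow>
      (LINT x:\<Omega>|lebesgue. m x *\<^sub>R Dphi x) = - (LINT x:\<Omega>|lebesgue. phi x *\<^sub>R G x))"

definition sobolev1 :: "'a::euclidean_space set \<Rightarrow> real \<Rightarrow> ('a \<Rightarrow> real) \<Rightarrow> bool" where
  "sobolev1 \<Omega> r m \<longleftrightarrow> memLp \<Omega> r m \<and> (\<exists>G. weak_grad \<Omega> m G \<and> memLp \<Omega> r G)"

(* the constraint set K, with r and s = gamma' q/(gamma'+q-1) as parameters *)
definition Kset :: "'a::euclidean_space set \<Rightarrow> real \<Rightarrow> real \<Rightarrow> (('a \<Rightarrow> real) \<times> ('a \<Rightarrow> 'a)) set" where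
  "Kset \<Omega> r s = {(m, w). memLp \<Omega> 1 m \<and> sobolev1 \<Omega> r m \<and> memLp \<Omega> s w \<and>
      (\<forall>G. weak_grad \<Omega> m G \<and> memLp \<Omega> r G \<longrightarrow>
         (\<forall>phi Dphi. smooth phi \<and> is_gradient phi Dphi \<longrightarrow>
            (LINT x:\<Omega>|lebesgue. G x \<bullet> Dphi x) = (LINT x:\<Omega>|lebesgue. w x \<bullet> Dphi x))) \<and>
      (LINT x:\<Omega>|lebesgue. m x) = 1 \<and> (AE x in lebesgue. x \<in> \<Omega> \<longrightarrow> m x \<ge> 0)}"

definition Lag :: "('a::euclidean_space \<Rightarrow> real) \<Rightarrow> 'a \<Rightarrow> real" where
  "Lag H v = (SUP p. p \<bullet> v - H p)"

definition mL :: "('a::euclidean_space \<Rightarrow> real) \<Rightarrow> real \<Rightarrow> 'a \<Rightarrow> ennreal" where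
  "mL H m w = (if m > 0 then ennreal (m * Lag H (- ((1 / m) *\<^sub>R w)))
               else if m = 0 \<and> w = 0 then 0 else \<infinity>)"

definition wm_density :: "real \<Rightarrow> real \<Rightarrow> 'a::euclidean_space \<Rightarrow> ennreal" where
  "wm_density g' m w = (if m > 0 then ennreal (norm w powr g' * m powr (1 - g'))
               else if m = 0 \<and> w = 0 then 0 else \<infinity>)"

definition Ekin :: "'a::euclidean_space set \<Rightarrow> real \<Rightarrow> ('a \<Rightarrow> real) \<Rightarrow> ('a \<Rightarrow> 'a) \<Rightarrow> ennreal" where
  "Ekin \<Omega> g' m w = (\<integral>\<^sup>+ x. indicator \<Omega> x * wm_density g' (m x) (w x) \<partial>lebesgue)"

(* the standard mollifier (Evans): C exp(1/(|x|^2-1)) on the unit ball, normalised *)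
definition chi0 :: "'a::euclidean_space \<Rightarrow> real" where
  "chi0 x = (if norm x < 1 then exp (1 / ((norm x)\<^sup>2 - 1)) else 0)"

definition chi :: "'a::euclidean_space \<Rightarrow> real" where
  "chi x = chi0 x / (LINT y|lebesgue. chi0 (y::'a))"

definition chi_eps :: "real \<Rightarrow> 'a::euclidean_space \<Rightarrow> real" where
  "chi_eps \<epsilon> x = (1 / \<epsilon> ^ DIM('a)) * chi ((1 / \<epsilon>) *\<^sub>R x)"

definition moll :: "'a::euclidean_space set \<Rightarrow> real \<Rightarrow> ('a \<Rightarrow> real) \<Rightarrow> 'a \<Rightarrow> real" where
  "moll \<Omega> \<epsilon> m x = (LINT y:\<Omega>|lebesgue. m y * chi_eps \<epsilon> (x - y))"

(* F(x,m) = int_0^m f(x,n) dn for m >= 0; the value +infinity for m < 0 is never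
   reached below, since mollifications of a.e. nonnegative m are nonnegative *)
definition Fpot :: "('a \<Rightarrow> real \<Rightarrow> real) \<Rightarrow> 'a \<Rightarrow> real \<Rightarrow> real" where
  "Fpot f x m = integral {0..m} (\<lambda>n. f x n)"

definition Feps :: "('a::euclidean_space \<Rightarrow> real \<Rightarrow> real) \<Rightarrow> 'a set \<Rightarrow> real \<Rightarrow> ('a \<Rightarrow> real) \<Rightarrow> real" where
  "Feps f \<Omega> \<epsilon> m = (LINT x:\<Omega>|lebesgue. Fpot f x (moll \<Omega> \<epsilon> m x))"

definition Eeps :: "('a::euclidean_space \<Rightarrow> real) \<Rightarrow> ('a \<Rightarrow> real \<Rightarrow> real) \<Rightarrow> 'a set \<Rightarrow> real \<Rightarrow> real \<Rightarrow> real
                    \<Rightarrow> ('a \<Rightarrow> real) \<Rightarrow> ('a \<Rightarrow> 'a) \<Rightarrow> ereal" where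
  "Eeps H f \<Omega> r s \<epsilon> m w =
     (if (m, w) \<in> Kset \<Omega> r s
      then enn2ereal (\<integral>\<^sup>+ x. indicator \<Omega> x * mL H (m x) (w x) \<partial>lebesgue) + ereal (Feps f \<Omega> \<epsilon> m)
      else \<infinity>)"

definition Bset :: "'a::euclidean_space set \<Rightarrow> real \<Rightarrow> real \<Rightarrow> real \<Rightarrow> real \<Rightarrow> (('a \<Rightarrow> real) \<times> ('a \<Rightarrow> 'a)) set" where
  "Bset \<Omega> r s q \<alpha> = {(m, w) \<in> Kset \<Omega> r s. lp_pow \<Omega> q m \<le> ennreal \<alpha>}"

definition locally_Lipschitz_f :: "('a::euclidean_space \<Rightarrow> real \<Rightarrow> real) \<Rightarrow> bool" where
  "locally_Lipschitz_f f \<longleftrightarrow> (\<forall>z \<in> UNIV \<times> {0..}. \<exists>\<rho>>0. \<exists>C.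
     C-lipschitz_on (ball z \<rho> \<inter> (UNIV \<times> {0..})) (\<lambda>(x, m). f x m))"

end

(* The kinetic energy is convex and lower semicontinuous in (m, w), since m L(-w/m) is the supremum over p
   of the affine functions -p.w - m H(p). The potential energy is not convex, but it is continuous under uniform
   convergence of the mollified densities, which are equicontinuous. Along a minimising sequence in B_alpha these
   converge uniformly to some h by Arzela-Ascoli; the admissible (m, w, grad m) with kinetic energy close to
   the limiting value and mollification close to h form decreasing convex sets, bounded in L^s with s > 1. From
   such sets one can select elements that converge almost everywhere and in L^1, and Fatou's lemma shows that
   the limit is a minimiser on B_alpha.
   Comparing it with (1, 0) bounds its kinetic energy, and the smallness of C_f together with the a priori estimate
   gives the strict inequality int m^q < alpha. Hence the minimiser lies in the interior of the constraint, which
   yields both the local minimality and the equality of the infima. *)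

theory Submission
  imports Defs "HOL-Complex_Analysis.Great_Picard"
begin

section \<open>Test functions\<close>

text \<open>Two properties of test functions carry the linear constraints. Weak gradients must be
  unique, because \<open>Kset\<close> poses its equation for every weak gradient of m; this takes
  enough explicit smooth functions with compact support, and a class of functions closed under
  differentiation is built for that. Gradients of test functions must integrate to 0, so that the
  constant density is admissible. Fixing h freezes the potential energy at one number, up to a small
  error, and this leaves only a sublevel set of the kinetic energy to deal with. That the selected
  limit really mollifies to h is recovered at the end from the convergence in L^1. Mollification
  increases neither the L^q norm nor the mass of a density. Hence the bounds on the potential energy
  contain no \<epsilon>, and the same \<alpha> and the same bound on C_f serve every
  \<epsilon>.\<close>

definition flat :: "nat \<Rightarrow> real \<Rightarrow> real" where
  "flat j t = (if t > 0 then exp (- (1 / t)) / t ^ j else 0)"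

lemma power_div_fact_le_exp:
  assumes "0 \<le> (x::real)" shows "x ^ n / fact n \<le> exp x"
proof -
  have "(\<Sum>k\<in>{n}. x ^ k /\<^sub>R fact k) \<le> (\<Sum>k. x ^ k /\<^sub>R fact k)"
    using assms exp_converges[of x] by (intro sum_le_suminf) (auto simp: sums_iff)
  also have "\<dots> = exp x"
    using exp_converges[of x] by (simp add: sums_iff)
  finally show ?thesis by (simp add: divide_inverse mult.commute)
qed

text \<open>Comparing \<open>exp (1 / t)\<close> with the single term of order j + 2 of its series
  gains two powers of t. This quadratic bound is what makes every \<open>flat j\<close>
  differentiable at 0, with derivative 0.\<close>

lemma abs_flat_le: "\<bar>flat j t\<bar> \<le> fact (j + 2) * t\<^sup>2"
proof (cases "t > 0")
  case True
  have "(1 / t) ^ (j + 2) / fact (j + 2) \<le> exp (1 / t)"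
    using True by (intro power_div_fact_le_exp) auto
  then have "exp (- (1 / t)) \<le> fact (j + 2) * t ^ (j + 2)"
    using True by (simp add: exp_minus field_simps del: fact_Suc)
  then have "exp (- (1 / t)) / t ^ j \<le> fact (j + 2) * t ^ (j + 2) / t ^ j"
    using True by (intro divide_right_mono) auto
  also have "\<dots> = fact (j + 2) * t\<^sup>2"
    using True by (simp add: power_add power2_eq_square del: fact_Suc)
  finally show ?thesis using True by (simp add: flat_def)
qed (simp add: flat_def)

lemma flat_nonneg: "0 \<le> flat j t"
  by (simp add: flat_def)

lemma flat_le_1: "flat 0 t \<le> 1"
  by (simp add: flat_def)

lemma DERIV_zero_of_quadratic_bound:
  fixes g :: "real \<Rightarrow> real"
  assumes "\<And>t. \<bar>g t\<bar> \<le> C * t\<^sup>2"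
  shows "(g has_real_derivative 0) (at 0)"
proof -
  have g0: "g 0 = 0" using assms[of 0] by simp
  have "((\<lambda>h. g h / h) \<longlongrightarrow> 0) (at 0)"
  proof (rule Lim_null_comparison)
    show "\<forall>\<^sub>F h in at 0. norm (g h / h) \<le> C * \<bar>h\<bar>"
      using assms by (auto simp: eventually_at_filter field_simps power2_eq_square abs_mult_self_eq intro!: always_eventually)
    show "((\<lambda>h. C * \<bar>h\<bar>) \<longlongrightarrow> 0) (at (0::real))"
      by (rule tendsto_eq_intros | simp)+
  qed
  then show ?thesis by (simp add: DERIV_def g0)
qed

text \<open>The family is closed under differentiation: for t > 0 the derivative of exp(-1/t) t^(-j)
  brings in a factor 1/t^2 or -j/t. This is the reason for carrying the index j.\<close>

lemma flat_deriv:
  "(flat j has_real_derivative (flat (j + 2) t - real j * flat (j + 1) t)) (at t)"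
proof -
  consider "t > 0" | "t < 0" | "t = 0" by linarith
  then show ?thesis
  proof cases
    case 1
    have "((\<lambda>t. exp (- (1 / t)) / t ^ j) has_real_derivative
        (exp (- (1 / t)) * (1 / t\<^sup>2) * t ^ j - exp (- (1 / t)) * (real j * t ^ (j - Suc 0))) / (t ^ j * t ^ j)) (at t)"
    proof -
      have "((\<lambda>t. - (1 / t)) has_real_derivative 1 / t\<^sup>2) (at t)"
        using 1 by (auto intro!: derivative_eq_intros simp: power2_eq_square)
      from DERIV_fun_exp[OF this] show ?thesis
        using 1 by (intro DERIV_divide DERIV_pow) simp_all
    qed
    moreover have "(E * (1 / t\<^sup>2) * t ^ j - E * (real j * t ^ (j - Suc 0))) / (t ^ j * t ^ j)
        = E / t ^ (j + 2) - real j * (E / t ^ (j + 1))" for E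
    proof (cases j)
      case (Suc n)
      have "(E * (1 / t\<^sup>2) * (t * u) - E * (real j * u)) / ((t * u) * (t * u))
          = E / (t * t * t * u) - real j * (E / (t * t * u))" if "u \<noteq> 0" for u
        using that 1 by (simp add: field_simps power2_eq_square)
      from this[of "t ^ n"] show ?thesis using 1 Suc by (simp add: mult.assoc)
    qed (simp add: power2_eq_square)
    ultimately have "((\<lambda>t. exp (- (1 / t)) / t ^ j) has_real_derivative (flat (j + 2) t - real j * flat (j + 1) t)) (at t)"
      using 1 by (simp only: flat_def if_True)
    then show ?thesis
      by (rule has_field_derivative_transform_within_open[where S="{0<..}"]) (use 1 in \<open>auto simp: flat_def\<close>)
  next
    case 2
    have "((\<lambda>t. 0) has_real_derivative 0) (at t)" by simp
    then show ?thesis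
      by (rule has_field_derivative_transform_within_open[where S="{..<0}", THEN DERIV_cong]) (use 2 in \<open>auto simp: flat_def\<close>)
  next
    case 3
    then have "flat (j + 2) t - real j * flat (j + 1) t = 0" by (simp add: flat_def)
    then show ?thesis using DERIV_zero_of_quadratic_bound[OF abs_flat_le, of j] 3 by simp
  qed
qed

lemma continuous_on_flat: "continuous_on A (flat j)"
  by (metis DERIV_isCont continuous_at_imp_continuous_on flat_deriv)

text \<open>An algebra that contains the partial derivatives of its members, by
  \<open>flat_alg_partial\<close>. The recursion in \<open>Ck\<close> then closes by induction on
  the order, without any formula for higher derivatives.\<close>

inductive flat_alg :: "('a::euclidean_space \<Rightarrow> real) \<Rightarrow> bool" where
  const: "flat_alg (\<lambda>x. c)"
| gen: "flat_alg (\<lambda>x. flat j (a \<bullet> x + d))"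
| add: "flat_alg u \<Longrightarrow> flat_alg v \<Longrightarrow> flat_alg (\<lambda>x. u x + v x)"
| mult: "flat_alg u \<Longrightarrow> flat_alg v \<Longrightarrow> flat_alg (\<lambda>x. u x * v x)"

lemma flat_alg_continuous: "flat_alg u \<Longrightarrow> continuous_on UNIV u"
  by (induction rule: flat_alg.induct)
     (auto intro!: continuous_intros continuous_on_compose2[OF continuous_on_flat[of UNIV]])

lemma flat_alg_partial:
  "flat_alg u \<Longrightarrow> \<exists>g. (\<forall>x. ((\<lambda>t. u (x + t *\<^sub>R b)) has_real_derivative g x) (at 0)) \<and> flat_alg g"
proof (induction rule: flat_alg.induct)
  case (const c)
  show ?case by (intro exI[of _ "\<lambda>x. 0"] conjI flat_alg.const) simp
next
  case (gen j a d)
  let ?g = "\<lambda>x. (a \<bullet> b) * (flat (j + 2) (a \<bullet> x + d) + (- real j) * flat (j + 1) (a \<bullet> x + d))"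
  have "((\<lambda>t. flat j (a \<bullet> (x + t *\<^sub>R b) + d)) has_real_derivative ?g x) (at 0)" for x
  proof -
    have *: "((\<lambda>t. a \<bullet> (x + t *\<^sub>R b) + d) has_real_derivative (a \<bullet> b)) (at 0)"
      by (auto intro!: derivative_eq_intros simp: inner_add_right)
    show ?thesis
      using DERIV_chain2[OF flat_deriv *, of j] by (simp add: algebra_simps)
  qed
  moreover have "flat_alg ?g" by (intro flat_alg.intros)
  ultimately show ?case by (intro exI[of _ ?g] conjI allI) assumption+
next
  case (add u v)
  then obtain g h where "\<forall>x. ((\<lambda>t. u (x + t *\<^sub>R b)) has_real_derivative g x) (at 0)" "flat_alg g"
    "\<forall>x. ((\<lambda>t. v (x + t *\<^sub>R b)) has_real_derivative h x) (at 0)" "flat_alg h" by blast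
  then show ?case
    by (intro exI[of _ "\<lambda>x. g x + h x"] conjI flat_alg.add allI DERIV_add) simp_all
next
  case (mult u v)
  then obtain g h where gh: "\<forall>x. ((\<lambda>t. u (x + t *\<^sub>R b)) has_real_derivative g x) (at 0)" "flat_alg g"
    "\<forall>x. ((\<lambda>t. v (x + t *\<^sub>R b)) has_real_derivative h x) (at 0)" "flat_alg h" by blast
  have "((\<lambda>t. u (x + t *\<^sub>R b) * v (x + t *\<^sub>R b)) has_real_derivative g x * v x + h x * u x) (at 0)" for x
    using DERIV_mult[OF gh(1)[rule_format, of x] gh(3)[rule_format, of x]] by simp
  then show ?case using mult.hyps gh
    by (intro exI[of _ "\<lambda>x. g x * v x + h x * u x"] conjI flat_alg.add flat_alg.mult allI) assumption+
qed

lemma flat_alg_smooth: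
  assumes "flat_alg u" shows "smooth u"
proof -
  have "Ck k u" for k
    using assms
  proof (induction k arbitrary: u)
    case 0
    then show ?case by (simp add: flat_alg_continuous)
  next
    case (Suc k)
    then show ?case using flat_alg_continuous[OF Suc.prems] flat_alg_partial[OF Suc.prems] by (metis Ck.simps(2))
  qed
  then show ?thesis by (simp add: smooth_def)
qed

lemma is_gradient_of_differentiable:
  assumes "\<And>x. (u::'a::euclidean_space \<Rightarrow> real) differentiable (at x)"
  obtains D where "is_gradient u D"
proof -
  obtain u' where u': "\<And>x. (u has_derivative u' x) (at x)"
    using assms unfolding differentiable_def by metis
  have "u' x = (\<lambda>h. (\<Sum>b\<in>Basis. u' x b *\<^sub>R b) \<bullet> h)" for x
  proof
    fix h
    interpret linear "u' x" using u' has_derivative_linear by blast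
    have "u' x h = u' x (\<Sum>b\<in>Basis. (h \<bullet> b) *\<^sub>R b)" by (simp add: euclidean_representation)
    also have "\<dots> = (\<Sum>b\<in>Basis. (h \<bullet> b) * u' x b)" by (simp add: sum scaleR)
    also have "\<dots> = (\<Sum>b\<in>Basis. (u' x b *\<^sub>R b) \<bullet> h)"
      by (intro sum.cong) (simp_all add: inner_commute[of h] mult.commute)
    finally show "u' x h = (\<Sum>b\<in>Basis. u' x b *\<^sub>R b) \<bullet> h"
      by (simp only: inner_sum_left)
  qed
  then show ?thesis using that[of "\<lambda>x. \<Sum>b\<in>Basis. u' x b *\<^sub>R b"] u' by (simp add: is_gradient_def)
qed

text \<open>\<open>is_gradient\<close> asks for a total derivative, while \<open>Ck\<close> speaks
  of partial ones only; the total derivative is obtained along the generation of the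
  algebra.\<close>

lemma flat_alg_gradient:
  assumes "flat_alg u" obtains D where "is_gradient u D"
proof (rule is_gradient_of_differentiable)
  fix x show "u differentiable (at x)"
    using assms
  proof (induction rule: flat_alg.induct)
    case (gen j a d)
    have "flat j differentiable at (a \<bullet> x + d)"
      using flat_deriv real_differentiable_def by blast
    then have "(flat j \<circ> (\<lambda>x. a \<bullet> x + d)) differentiable at x"
      by (intro differentiable_chain_at differentiable_add differentiable_inner) auto
    then show ?case by (simp add: comp_def)
  qed (auto intro: differentiable_add differentiable_mult)
qed (use that in auto)

section \<open>Bumps that approximate the indicators of boxes\<close>

lemma flat_alg_prod:
  "finite A \<Longrightarrow> (\<And>i. i \<in> A \<Longrightarrow> flat_alg (u i)) \<Longrightarrow> flat_alg (\<lambda>x. \<Prod>i\<in>A. u i x)"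
  by (induction rule: finite_induct) (simp_all add: flat_alg.const flat_alg.mult)

text \<open>For k > 0 the factor of the coordinate i is positive exactly where x lies strictly
  between a and b in that coordinate. Since \<open>flat 0 (k * t)\<close> tends to 1 for t > 0,
  large k sharpens the bump to the indicator of the open box.\<close>

definition box_bump :: "real \<Rightarrow> 'a \<Rightarrow> 'a \<Rightarrow> 'a::euclidean_space \<Rightarrow> real" where
  "box_bump k a b x = (\<Prod>i\<in>Basis. flat 0 (k * ((x - a) \<bullet> i)) * flat 0 (k * ((b - x) \<bullet> i)))"

lemma flat_alg_box_bump: "flat_alg (box_bump k a b)"
proof -
  have "flat_alg (\<lambda>x. flat 0 ((k *\<^sub>R i) \<bullet> x + (- k * (a \<bullet> i))) * flat 0 ((- k *\<^sub>R i) \<bullet> x + k * (b \<bullet> i)))" for i :: 'a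
    by (intro flat_alg.intros)
  then have "flat_alg (\<lambda>x::'a. \<Prod>i\<in>Basis. flat 0 ((k *\<^sub>R i) \<bullet> x + (- k * (a \<bullet> i))) * flat 0 ((- k *\<^sub>R i) \<bullet> x + k * (b \<bullet> i)))"
    by (intro flat_alg_prod) auto
  moreover have "(\<lambda>x::'a. \<Prod>i\<in>Basis. flat 0 ((k *\<^sub>R i) \<bullet> x + (- k * (a \<bullet> i))) * flat 0 ((- k *\<^sub>R i) \<bullet> x + k * (b \<bullet> i)))
      = box_bump k a b"
    unfolding box_bump_def
    by (intro ext prod.cong) (auto simp: algebra_simps inner_commute)
  ultimately show ?thesis by simp
qed

lemma box_bump_bounds: "0 \<le> box_bump k a b x" "box_bump k a b x \<le> 1"
  unfolding box_bump_def
  by (auto intro!: prod_nonneg prod_le_1 mult_le_one simp: flat_nonneg flat_le_1)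

lemma box_bump_eq_0:
  assumes "0 < k" "x \<notin> box a b" shows "box_bump k a b x = 0"
proof -
  obtain i where "i \<in> Basis" "\<not> (a \<bullet> i < x \<bullet> i \<and> x \<bullet> i < b \<bullet> i)"
    using assms(2) by (auto simp: mem_box)
  then have "flat 0 (k * ((x - a) \<bullet> i)) * flat 0 (k * ((b - x) \<bullet> i)) = 0"
    using assms(1) by (auto simp: flat_def inner_diff_left zero_less_mult_iff)
  then show ?thesis
    unfolding box_bump_def using \<open>i \<in> Basis\<close> by (intro prod_zero) auto
qed

lemma box_bump_tendsto: "(\<lambda>k. box_bump (real (Suc k)) a b x) \<longlonglongrightarrow> indicator (box a b) x"
proof (cases "x \<in> box a b")
  case True
  have lim: "(\<lambda>k. flat 0 (real (Suc k) * t)) \<longlonglongrightarrow> 1" if "t > 0" for t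
  proof -
    have "(\<lambda>k. exp (- (inverse (real (Suc k)) * inverse t))) \<longlonglongrightarrow> exp (- (0 * inverse t))"
      by (intro tendsto_intros LIMSEQ_inverse_real_of_nat)
    then show ?thesis using that by (simp add: flat_def divide_inverse)
  qed
  have "(\<lambda>k. box_bump (real (Suc k)) a b x) \<longlonglongrightarrow> (\<Prod>i\<in>(Basis::'a set). 1 * 1)"
    unfolding box_bump_def using True
    by (intro tendsto_prod tendsto_mult lim) (auto simp: mem_box inner_diff_left)
  then show ?thesis using True by simp
next
  case False
  then show ?thesis using box_bump_eq_0[OF _ False] by (simp del: of_nat_Suc)
qed

lemma box_bump_support:
  assumes "0 < k" "cbox a b \<subseteq> S"
  shows "compact (closure {x. box_bump k a b x \<noteq> 0})" "closure {x. box_bump k a b x \<noteq> 0} \<subseteq> S"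
proof -
  have "{x. box_bump k a b x \<noteq> 0} \<subseteq> cbox a b"
    using box_bump_eq_0[OF assms(1)] box_subset_cbox by blast
  then have *: "closure {x. box_bump k a b x \<noteq> 0} \<subseteq> cbox a b"
    by (meson closed_cbox closure_minimal)
  then show "compact (closure {x. box_bump k a b x \<noteq> 0})" "closure {x. box_bump k a b x \<noteq> 0} \<subseteq> S"
    using assms(2) compact_cbox bounded_subset by (auto simp: compact_eq_bounded_closed intro: bounded_subset[OF bounded_cbox])
qed

section \<open>Uniqueness of weak gradients\<close>

lemma set_lebesgue_integral_eq_lebesgue_on:
  fixes u :: "'a::euclidean_space \<Rightarrow> 'b::{banach, second_countable_topology}"
  assumes "S \<in> sets lebesgue"
  shows "(LINT x:S|lebesgue. u x) = integral\<^sup>L (lebesgue_on S) u"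
  using assms by (simp add: set_lebesgue_integral_def integral_restrict_space)

text \<open>The positive and the negative part of h are densities of two finite measures that agree
  on open boxes. Boxes form an intersection-stable generator of the Borel sets, so the measures and
  hence the densities coincide, and a number with equal positive and negative part is 0.\<close>

lemma AE_eq_0_of_box_integrals:
  fixes h :: "'a::euclidean_space \<Rightarrow> real"
  assumes h: "integrable lebesgue h"
    and box: "\<And>a b. (\<integral>x. indicator (box a b) x * h x \<partial>lebesgue) = 0"
  shows "AE x in lebesgue. h x = 0"
proof -
  \<comment> \<open>The generator argument is about Borel measures, so h is first replaced by a
    Borel function that agrees with it almost everywhere.\<close>
  obtain g where g[measurable]: "g \<in> borel_measurable lborel" and hg: "AE x in lborel. h x = g x"
    using completion_ex_borel_measurable_real[OF borel_measurable_integrable[OF h]] by blast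
  have hg': "AE x in lebesgue. h x = g x" using hg by (simp add: AE_completion)
  have gi: "integrable lborel g"
    using integrable_cong_AE_imp[OF h, of g] hg' by (simp add: integrable_completion measurable_completion)
  define p n where "p = (\<lambda>x. ennreal (g x))" and "n = (\<lambda>x. ennreal (- g x))"
  have pm[measurable]: "p \<in> borel_measurable lborel" "n \<in> borel_measurable lborel"
    unfolding p_def n_def by measurable
  have fin: "integral\<^sup>N lborel p \<noteq> \<infinity>" "integral\<^sup>N lborel n \<noteq> \<infinity>"
    using gi by (auto simp: real_integrable_def p_def n_def)
  have inj: "u = v" if "enn2real u = enn2real v" "u \<noteq> \<infinity>" "v \<noteq> \<infinity>" for u v
    using that by (metis ennreal_enn2real infinity_ennreal_def top.not_eq_extremum)
  have eq: "(\<integral>\<^sup>+x. p x * indicator (box a b) x \<partial>lborel) = (\<integral>\<^sup>+x. n x * indicator (box a b) x \<partial>lborel)" for a b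
  proof -
    let ?G = "\<lambda>x. indicator (box a b) x * g x"
    have Gi: "integrable lborel ?G"
      using integrable_mult_indicator[OF _ gi, of "box a b"] by simp
    have "(\<integral>x. ?G x \<partial>lborel) = (\<integral>x. ?G x \<partial>lebesgue)"
      by (rule integral_completion[symmetric]) simp
    also have "\<dots> = (\<integral>x. indicator (box a b) x * h x \<partial>lebesgue)"
    proof (rule integral_cong_AE)
      show "?G \<in> borel_measurable lebesgue" by (rule measurable_completion) measurable
      show "(\<lambda>x. indicator (box a b) x * h x) \<in> borel_measurable lebesgue"
        using borel_measurable_integrable[OF integrable_mult_indicator[OF lmeasurable_box[THEN fmeasurableD] h]]
        by (simp only: real_scaleR_def)
      show "AE x in lebesgue. ?G x = indicator (box a b) x * h x" using hg' by eventually_elim simp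
    qed
    finally have "(\<integral>x. ?G x \<partial>lborel) = 0" using box by simp
    then have "enn2real (\<integral>\<^sup>+x. ennreal (?G x) \<partial>lborel) = enn2real (\<integral>\<^sup>+x. ennreal (- ?G x) \<partial>lborel)"
      using real_lebesgue_integral_def[OF Gi] by simp
    moreover have "(\<integral>\<^sup>+x. ennreal (?G x) \<partial>lborel) \<noteq> \<infinity>" "(\<integral>\<^sup>+x. ennreal (- ?G x) \<partial>lborel) \<noteq> \<infinity>"
      using Gi by (auto simp: real_integrable_def)
    ultimately have "(\<integral>\<^sup>+x. ennreal (?G x) \<partial>lborel) = (\<integral>\<^sup>+x. ennreal (- ?G x) \<partial>lborel)"
      by (rule inj)
    moreover have "ennreal (?G x) = p x * indicator (box a b) x" "ennreal (- ?G x) = n x * indicator (box a b) x" for x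
      by (auto simp: p_def n_def indicator_def)
    ultimately show ?thesis by simp
  qed
  have "density lborel p = density lborel n"
  proof (rule measure_eqI_generator_eq[where E="range (\<lambda>(a, b). box a b)" and \<Omega>=UNIV and A="\<lambda>n. box (- real n *\<^sub>R One) (real n *\<^sub>R One)"])
    show "Int_stable (range (\<lambda>(a, b). box a b))"
      by (force simp: Int_stable_def box_Int_box)
    show "emeasure (density lborel p) X = emeasure (density lborel n) X" if "X \<in> range (\<lambda>(a, b). box a b)" for X
      using that eq by (auto simp: emeasure_density)
    show "sets (density lborel p) = sigma_sets UNIV (range (\<lambda>(a, b). box a b))"
      "sets (density lborel n) = sigma_sets UNIV (range (\<lambda>(a, b). box a b))"
      by (simp_all add: borel_eq_box)
    show "(\<Union>i. box (- real i *\<^sub>R One) (real i *\<^sub>R One)) = UNIV"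
      using UN_box_eq_UNIV by simp
    fix i
    have "emeasure (density lborel p) (box (- real i *\<^sub>R One) (real i *\<^sub>R One)) \<le> emeasure (density lborel p) UNIV"
      by (rule emeasure_mono) auto
    also have "\<dots> < \<infinity>" using fin by (simp add: emeasure_density top.not_eq_extremum)
    finally show "emeasure (density lborel p) (box (- real i *\<^sub>R One) (real i *\<^sub>R One)) \<noteq> \<infinity>" by simp
  qed auto
  then have "AE x in lborel. p x = n x"
    using finite_density_unique[OF pm _ _ fin(1)] by simp
  then have "AE x in lborel. g x = 0"
  proof eventually_elim
    case (elim x)
    then have "g x \<le> 0 \<and> - g x \<le> 0"
      unfolding p_def n_def by (cases "g x \<le> 0") (auto simp: ennreal_neg ennreal_eq_0_iff)
    then show ?case by simp
  qed
  then have "AE x in lebesgue. g x = 0" by (simp add: AE_completion)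
  with hg' show ?thesis by eventually_elim simp
qed

text \<open>Dominated convergence passes from bumps to indicators, but only for boxes whose closure
  lies inside S. The function is therefore shown to vanish on each such closed box, and countably
  many of them cover S.\<close>

lemma AE_eq_0_of_test_integrals:
  fixes h :: "'a::euclidean_space \<Rightarrow> real"
  assumes S: "open S" and h: "integrable (lebesgue_on S) h"
    and test: "\<And>a b k. cbox a b \<subseteq> S \<Longrightarrow> 0 < k \<Longrightarrow> (\<integral>x. box_bump k a b x * h x \<partial>lebesgue_on S) = 0"
  shows "AE x in lebesgue_on S. h x = 0"
proof -
  have Sm[measurable]: "S \<in> sets lebesgue" using S by auto
  define h0 where "h0 x = indicator S x * h x" for x
  have h0: "integrable lebesgue h0"
    using h by (simp add: integrable_restrict_space h0_def[abs_def])
  have box: "(\<integral>x. indicator (box a b) x * h0 x \<partial>lebesgue) = 0" if ab: "cbox a b \<subseteq> S" for a b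
  proof -
    have "(\<lambda>k. \<integral>x. box_bump (real (Suc k)) a b x * h0 x \<partial>lebesgue) \<longlonglongrightarrow> (\<integral>x. indicator (box a b) x * h0 x \<partial>lebesgue)"
    proof (rule integral_dominated_convergence[where w="\<lambda>x. \<bar>h0 x\<bar>"])
      show "(\<lambda>x. box_bump (real (Suc k)) a b x * h0 x) \<in> borel_measurable lebesgue" for k
        using borel_measurable_continuous_onI[OF flat_alg_continuous[OF flat_alg_box_bump]]
        by (intro borel_measurable_times borel_measurable_integrable[OF h0] measurable_completion) auto
      show "AE x in lebesgue. norm (box_bump (real (Suc k)) a b x * h0 x) \<le> \<bar>h0 x\<bar>" for k
        using box_bump_bounds[of "real (Suc k)" a b] by (intro AE_I2) (simp only: real_norm_def abs_mult abs_of_nonneg mult_left_le_one_le abs_ge_zero)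
      show "AE x in lebesgue. (\<lambda>k. box_bump (real (Suc k)) a b x * h0 x) \<longlonglongrightarrow> indicator (box a b) x * h0 x"
        by (intro always_eventually allI tendsto_mult tendsto_const box_bump_tendsto)
      show "(\<lambda>x. indicator (box a b) x * h0 x) \<in> borel_measurable lebesgue"
        using borel_measurable_integrable[OF integrable_mult_indicator[OF _ h0, of "box a b"]] by simp
    qed (use h0 in simp)
    moreover have "(\<integral>x. box_bump (real (Suc k)) a b x * h0 x \<partial>lebesgue) = 0" for k
    proof -
      have "(\<integral>x. box_bump (real (Suc k)) a b x * h0 x \<partial>lebesgue) = (\<integral>x. box_bump (real (Suc k)) a b x * h x \<partial>lebesgue_on S)"
        by (subst integral_restrict_space) (auto simp: h0_def ac_simps)
      then show ?thesis using test[OF ab, of "real (Suc k)"] by simp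
    qed
    ultimately show ?thesis by (simp add: LIMSEQ_const_iff)
  qed
  have *: "AE x in lebesgue. x \<in> cbox c d \<longrightarrow> h0 x = 0" if cd: "cbox c d \<subseteq> S" for c d
  proof -
    have "AE x in lebesgue. indicator (box c d) x * h0 x = 0"
    proof (rule AE_eq_0_of_box_integrals)
      show "integrable lebesgue (\<lambda>x. indicator (box c d) x * h0 x)"
        using integrable_mult_indicator[OF _ h0, of "box c d"] by simp
      fix a b
      \<comment> \<open>The corners of the intersection of the two boxes, again a box with closure
        inside S; this localises the box criterion to \<open>box c d\<close>.\<close>
      define a' b' where "a' = (\<Sum>i\<in>Basis. max (a \<bullet> i) (c \<bullet> i) *\<^sub>R i)"
        and "b' = (\<Sum>i\<in>Basis. min (b \<bullet> i) (d \<bullet> i) *\<^sub>R i)"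
      have *: "box a b \<inter> box c d = box a' b'" "cbox a' b' \<subseteq> S"
        using cd Int_interval[of a b c d] by (auto simp: a'_def b'_def box_Int_box)
      have "(\<integral>x. indicator (box a b) x * (indicator (box c d) x * h0 x) \<partial>lebesgue)
          = (\<integral>x. indicator (box a' b') x * h0 x \<partial>lebesgue)"
        by (intro Bochner_Integration.integral_cong) (auto simp: *(1)[symmetric] indicator_def)
      then show "(\<integral>x. indicator (box a b) x * (indicator (box c d) x * h0 x) \<partial>lebesgue) = 0"
        using box[OF *(2)] by simp
    qed
    \<comment> \<open>The faces of a box form a null set, so the step from the open box to the
      closed one costs nothing.\<close>
    moreover have "AE x in lebesgue. x \<notin> cbox c d - box c d"
      by (rule AE_not_in) (simp add: negligible_iff_null_sets[symmetric] negligible_frontier_interval)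
    ultimately show ?thesis by eventually_elim (auto simp: indicator_def split: if_splits)
  qed
  have "\<exists>\<D>. countable \<D> \<and> \<D> \<subseteq> Pow S \<and> (\<forall>X\<in>\<D>. \<exists>a b. X = cbox a b) \<and> \<Union>\<D> = S"
    by (rule open_countable_Union_open_cbox[OF S], rule exI, intro conjI ballI) assumption+
  then obtain \<D> where D: "countable \<D>" "\<D> \<subseteq> Pow S" "\<forall>X\<in>\<D>. \<exists>a b. X = cbox a b" "\<Union>\<D> = S"
    by (elim exE conjE)
  have "AE x in lebesgue. \<forall>X\<in>\<D>. x \<in> X \<longrightarrow> h0 x = 0"
  proof (subst AE_ball_countable[OF D(1)], rule ballI)
    fix X assume X: "X \<in> \<D>"
    obtain a b where ab: "X = cbox a b" using bspec[OF D(3) X] by (elim exE)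
    have "X \<subseteq> S" using D(4) X by (auto simp only:)
    with ab have "X = cbox a b" "cbox a b \<subseteq> S" by simp_all
    then show "AE x in lebesgue. x \<in> X \<longrightarrow> h0 x = 0" using *[of a b] by simp
  qed
  then have "AE x in lebesgue. x \<in> S \<longrightarrow> h x = 0"
  proof eventually_elim
    case (elim x)
    show ?case
    proof
      assume x: "x \<in> S"
      then obtain X where "X \<in> \<D>" "x \<in> X" unfolding D(4)[symmetric] by (elim UnionE)
      then have "h0 x = 0" using bspec[OF elim] by simp
      then show "h x = 0" using x by (simp add: h0_def)
    qed
  qed
  then show ?thesis by (simp add: AE_restrict_space_iff)
qed

text \<open>Both candidates have the same integrals against every test function, so each component
  of G1 - G2 is annihilated by all bumps supported in S.\<close>

lemma weak_grad_unique:
  fixes S :: "'a::euclidean_space set"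
  assumes S: "open S" and G: "weak_grad S m G1" "weak_grad S m G2"
    and int: "integrable (lebesgue_on S) G1" "integrable (lebesgue_on S) G2"
  shows "AE x in lebesgue_on S. G1 x = G2 x"
proof -
  have Sm[measurable]: "S \<in> sets lebesgue" using S by auto
  have "AE x in lebesgue_on S. (G1 x - G2 x) \<bullet> i = 0" if i: "i \<in> Basis" for i
  proof (rule AE_eq_0_of_test_integrals[OF S])
    show "integrable (lebesgue_on S) (\<lambda>x. (G1 x - G2 x) \<bullet> i)"
      using int by (intro integrable_inner_left Bochner_Integration.integrable_diff)
    fix a b :: 'a and k :: real assume ab: "cbox a b \<subseteq> S" "0 < k"
    let ?\<phi> = "box_bump k a b"
    obtain D where D: "is_gradient ?\<phi> D" using flat_alg_gradient[OF flat_alg_box_bump] .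
    have wg: "(LINT x|lebesgue_on S. m x *\<^sub>R D x) = - (LINT x|lebesgue_on S. ?\<phi> x *\<^sub>R G x)"
      if "weak_grad S m G" for G
      using that[unfolded weak_grad_def, rule_format, OF conjI, OF flat_alg_smooth[OF flat_alg_box_bump] conjI,
          OF D conjI, OF box_bump_support[OF ab(2,1)]]
      by (simp only: set_lebesgue_integral_eq_lebesgue_on[OF Sm])
    have ii: "integrable (lebesgue_on S) (\<lambda>x. ?\<phi> x *\<^sub>R G x)" if "integrable (lebesgue_on S) G" for G :: "'a \<Rightarrow> 'a"
    proof (rule Bochner_Integration.integrable_bound[OF that])
      have "?\<phi> \<in> borel_measurable borel"
        by (rule borel_measurable_continuous_onI[OF flat_alg_continuous[OF flat_alg_box_bump]])
      then have "?\<phi> \<in> borel_measurable (lebesgue_on S)"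
        by (intro measurable_restrict_space1 measurable_completion) simp
      then show "(\<lambda>x. ?\<phi> x *\<^sub>R G x) \<in> borel_measurable (lebesgue_on S)"
        using that by (intro borel_measurable_scaleR) auto
      show "AE x in lebesgue_on S. norm (?\<phi> x *\<^sub>R G x) \<le> norm (G x)"
        using box_bump_bounds[of k a b] by (auto intro!: mult_left_le_one_le)
    qed
    have "(LINT x|lebesgue_on S. ?\<phi> x * ((G1 x - G2 x) \<bullet> i)) = (LINT x|lebesgue_on S. (?\<phi> x *\<^sub>R G1 x - ?\<phi> x *\<^sub>R G2 x) \<bullet> i)"
      by (simp add: algebra_simps inner_simps)
    also have "\<dots> = (LINT x|lebesgue_on S. ?\<phi> x *\<^sub>R G1 x - ?\<phi> x *\<^sub>R G2 x) \<bullet> i"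
      using ii[OF int(1)] ii[OF int(2)] by (intro integral_inner_left) auto
    also have "\<dots> = 0"
      using ii[OF int(1)] ii[OF int(2)] wg[OF G(1)] wg[OF G(2)]
      by (subst Bochner_Integration.integral_diff) auto
    finally show "(LINT x|lebesgue_on S. ?\<phi> x * ((G1 x - G2 x) \<bullet> i)) = 0" .
  qed
  then have "AE x in lebesgue_on S. \<forall>i\<in>Basis. (G1 x - G2 x) \<bullet> i = 0"
    by (intro AE_finite_allI) auto
  then show ?thesis
    by eventually_elim (metis euclidean_eqI inner_zero_left right_minus_eq)
qed

section \<open>Almost everywhere convergent selections from convex sets\<close>

abbreviation powr_integral :: "'a measure \<Rightarrow> real \<Rightarrow> ('a \<Rightarrow> 'b::real_normed_vector) \<Rightarrow> ennreal" where
  "powr_integral M p u \<equiv> (\<integral>\<^sup>+x. ennreal (norm (u x) powr p) \<partial>M)"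

text \<open>The Euclidean norm of (1, a). Unlike the norm itself, which is affine along rays, it is
  strictly convex, and it still grows only linearly.\<close>

definition jnorm :: "'b::real_inner \<Rightarrow> real" where
  "jnorm a = sqrt (1 + (norm a)\<^sup>2)"

lemma jnorm_ge_1: "1 \<le> jnorm a"
  by (simp add: jnorm_def)

lemma norm_le_jnorm: "norm a \<le> jnorm a"
  by (simp add: jnorm_def real_le_rsqrt)

lemma jnorm_le: "jnorm a \<le> 1 + norm a"
  unfolding jnorm_def by (rule real_le_lsqrt) (auto simp: power2_eq_square algebra_simps)

text \<open>With A, B the lengths of (1, a) and (1, b), z their inner product and M the length of
  their midpoint, A^2 B^2 - z^2 is the squared area they span. It factors as (AB - z)(AB + z), and
  the first factor measures the convexity gap, since 2 (AB - z) = (A + B)^2 - 4 M^2.\<close>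

lemma midpoint_gap_aux:
  fixes A B M z d :: real
  assumes A: "1 \<le> A" and B: "1 \<le> B" and M: "0 \<le> M" and d: "0 \<le> d"
    and wedge: "d \<le> A\<^sup>2 * B\<^sup>2 - z\<^sup>2" and M2: "4 * M\<^sup>2 = A\<^sup>2 + B\<^sup>2 + 2 * z"
  shows "d \<le> 4 * (A * B) * (A + B) * ((A + B) / 2 - M)"
proof -
  define P where "P = A * B"
  have P: "0 \<le> P" using A B by (simp add: P_def)
  have "z\<^sup>2 \<le> P\<^sup>2" using wedge d by (simp add: P_def power_mult_distrib)
  then have "\<bar>z\<bar> \<le> P" using P by (simp add: abs_le_square_iff[symmetric])
  then have z: "0 \<le> P - z" "P + z \<le> 2 * P" by simp_all
  have "d \<le> (P - z) * (P + z)"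
    using wedge by (simp add: P_def power2_eq_square algebra_simps)
  also have "\<dots> \<le> (P - z) * (2 * P)" by (rule mult_left_mono[OF z(2,1)])
  finally have 1: "d \<le> P * (2 * (P - z))" by (simp add: ac_simps)
  define K where "K = (A + B) / 2"
  have 2: "2 * (P - z) = 4 * (K\<^sup>2 - M\<^sup>2)"
  proof -
    have "4 * K\<^sup>2 = A\<^sup>2 + B\<^sup>2 + 2 * P" by (simp add: K_def P_def power2_eq_square field_simps)
    then show ?thesis using M2 by simp
  qed
  have K: "0 \<le> K" using A B by (simp add: K_def)
  have "M\<^sup>2 \<le> K\<^sup>2" using 2 z by simp
  then have MK: "M \<le> K" using K by (rule power2_le_imp_le)
  have "K\<^sup>2 - M\<^sup>2 = (K + M) * (K - M)" by (simp add: power2_eq_square algebra_simps)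
  also have "\<dots> \<le> (2 * K) * (K - M)" using MK by (intro mult_right_mono) simp_all
  also have "2 * K = A + B" by (simp add: K_def)
  finally have 3: "4 * (K\<^sup>2 - M\<^sup>2) \<le> 4 * ((A + B) * (K - M))" by simp
  have "d \<le> P * (4 * ((A + B) * (K - M)))"
    by (rule order_trans[OF 1]) (unfold 2, rule mult_left_mono[OF 3 P])
  also have "\<dots> = 4 * P * (A + B) * (K - M)" by (simp only: mult.assoc mult.left_commute)
  finally show ?thesis unfolding P_def K_def .
qed

lemma jnorm_midpoint_gap:
  fixes a b :: "'b::real_inner"
  shows "(norm (a - b))\<^sup>2
    \<le> 4 * (jnorm a * jnorm b) * (jnorm a + jnorm b) * ((jnorm a + jnorm b) / 2 - jnorm ((1/2) *\<^sub>R (a + b)))"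
proof (rule midpoint_gap_aux[where z="1 + a \<bullet> b"])
  have sq: "(jnorm c)\<^sup>2 = 1 + c \<bullet> c" for c :: 'b
    unfolding jnorm_def by (subst real_sqrt_pow2) (simp_all only: power2_norm_eq_inner add_nonneg_nonneg zero_le_one inner_ge_zero)
  have half: "((1/2) *\<^sub>R c) \<bullet> ((1/2) *\<^sub>R c) = (c \<bullet> c) / 4" for c :: 'b by simp
  show "4 * (jnorm ((1/2) *\<^sub>R (a + b)))\<^sup>2 = (jnorm a)\<^sup>2 + (jnorm b)\<^sup>2 + 2 * (1 + a \<bullet> b)"
    unfolding sq half by (simp add: inner_add_left inner_add_right inner_commute[of b a])
  have n: "(norm (a - b))\<^sup>2 = a \<bullet> a + b \<bullet> b - 2 * (a \<bullet> b)"
    unfolding power2_norm_eq_inner inner_diff_left inner_diff_right inner_commute[of b a] by simp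
  \<comment> \<open>The right side minus the left side is x y - t^2.\<close>
  have aux: "x + y - 2 * t \<le> (1 + x) * (1 + y) - (1 + t)\<^sup>2" if "t\<^sup>2 \<le> x * y" for x y t :: real
    using that by (simp add: power2_eq_square algebra_simps)
  show "(norm (a - b))\<^sup>2 \<le> (jnorm a)\<^sup>2 * (jnorm b)\<^sup>2 - (1 + a \<bullet> b)\<^sup>2"
    unfolding n sq by (rule aux[OF Cauchy_Schwarz_ineq])
qed (simp_all add: jnorm_ge_1 order_trans[OF zero_le_one jnorm_ge_1])

lemma jnorm_midpoint_le: "jnorm ((1/2) *\<^sub>R (a + b)) \<le> (jnorm a + jnorm b) / 2"
proof -
  have "0 \<le> 4 * (jnorm a * jnorm b) * (jnorm a + jnorm b) * ((jnorm a + jnorm b) / 2 - jnorm ((1/2) *\<^sub>R (a + b)))"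
    using jnorm_midpoint_gap[of a b] by (meson order_trans zero_le_power2)
  moreover have "0 < 4 * (jnorm a * jnorm b) * (jnorm a + jnorm b)"
    using jnorm_ge_1[of a] jnorm_ge_1[of b] by (intro mult_pos_pos add_pos_pos) auto
  ultimately have "0 \<le> (jnorm a + jnorm b) / 2 - jnorm ((1/2) *\<^sub>R (a + b))"
    by (simp only: zero_le_mult_iff) linarith
  then show ?thesis by simp
qed

text \<open>Strict convexity made quantitative, in a form that can be integrated. Where both values
  of \<open>jnorm\<close> are at most R, the squared distance is at most 8 R^3 times the gap, and 2
  \<eta> d \<le> \<eta>^2 + d^2 turns the square into a first power. Elsewhere p-th powers with p >
  1 dominate the distance, with a factor that is small for large R.\<close>

lemma norm_diff_le_midpoint_gap:
  fixes a b :: "'b::real_inner"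
  assumes "\<eta> > 0" "R > 0" "p > 1"
  shows "norm (a - b) \<le> \<eta> + 8 * R ^ 3 / \<eta> * ((jnorm a + jnorm b) / 2 - jnorm ((1/2) *\<^sub>R (a + b)))
    + 2 * R powr (1 - p) * (jnorm a powr p + jnorm b powr p)"
proof -
  let ?g = "(jnorm a + jnorm b) / 2 - jnorm ((1/2) *\<^sub>R (a + b))"
  have g: "0 \<le> ?g" using jnorm_midpoint_le[of a b] by simp
  have ge: "1 \<le> jnorm a" "1 \<le> jnorm b" by (rule jnorm_ge_1)+
  show ?thesis
  proof (cases "jnorm a \<le> R \<and> jnorm b \<le> R")
    case True
    have "(norm (a - b))\<^sup>2 \<le> 4 * (jnorm a * jnorm b) * (jnorm a + jnorm b) * ?g"
      by (rule jnorm_midpoint_gap)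
    also have "\<dots> \<le> 4 * (R * R) * (R + R) * ?g"
      using True ge g assms by (intro mult_right_mono mult_mono add_mono) auto
    finally have 1: "(norm (a - b))\<^sup>2 \<le> 8 * R ^ 3 * ?g" by (simp add: power3_eq_cube)
    have "2 * \<eta> * norm (a - b) \<le> \<eta>\<^sup>2 + (norm (a - b))\<^sup>2" by (rule sum_squares_bound)
    moreover have "0 \<le> \<eta> * norm (a - b)" using assms by simp
    ultimately have "\<eta> * norm (a - b) \<le> \<eta> * \<eta> + 8 * R ^ 3 * ?g" using 1 unfolding power2_eq_square by linarith
    then have "norm (a - b) \<le> (\<eta> * \<eta> + 8 * R ^ 3 * ?g) / \<eta>"
      using assms by (subst pos_le_divide_eq) (auto simp: ac_simps)
    also have "\<dots> = \<eta> + 8 * R ^ 3 / \<eta> * ?g" using assms by (simp add: field_simps)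
    also have "\<dots> \<le> \<eta> + 8 * R ^ 3 / \<eta> * ?g + 2 * R powr (1 - p) * (jnorm a powr p + jnorm b powr p)" by simp
    finally show ?thesis .
  next
    case False
    define m where "m = max (jnorm a) (jnorm b)"
    have m: "R < m" "0 < m" using False assms ge by (auto simp: m_def)
    have "norm (a - b) \<le> norm a + norm b" by (rule norm_triangle_ineq4)
    also have "\<dots> \<le> 2 * m" using norm_le_jnorm[of a] norm_le_jnorm[of b] by (simp add: m_def)
    also have "\<dots> = 2 * (m powr (1 - p) * m powr p)" using m by (simp add: powr_add[symmetric])
    also have "\<dots> \<le> 2 * (R powr (1 - p) * (jnorm a powr p + jnorm b powr p))"
    proof (intro mult_left_mono mult_mono)
      show "m powr (1 - p) \<le> R powr (1 - p)"
        using m assms by (intro powr_mono2') auto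
      show "m powr p \<le> jnorm a powr p + jnorm b powr p" by (auto simp: m_def max_def)
    qed auto
    finally have "norm (a - b) \<le> 2 * R powr (1 - p) * (jnorm a powr p + jnorm b powr p)" by simp
    moreover have "0 \<le> \<eta> + 8 * R ^ 3 / \<eta> * ?g" using g assms by simp
    ultimately show ?thesis by linarith
  qed
qed

lemma jnorm_powr_le:
  assumes "p > 1" shows "jnorm a powr p \<le> 2 powr p * (1 + norm a powr p)"
proof -
  have "jnorm a \<le> 2 * max 1 (norm a)" using jnorm_le[of a] by simp
  then have "jnorm a powr p \<le> (2 * max 1 (norm a)) powr p"
    using jnorm_ge_1[of a] assms by (intro powr_mono2) auto
  also have "\<dots> = 2 powr p * max 1 (norm a) powr p" by (simp add: powr_mult)
  also have "\<dots> \<le> 2 powr p * (1 + norm a powr p)" by (intro mult_left_mono) (auto simp: max_def)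
  finally show ?thesis .
qed

text \<open>Since \<open>jnorm\<close> is strictly convex, a sequence that almost minimises its integral along the decreasing
  sets is Cauchy in \<open>L\<^sup>1\<close>. This replaces weak compactness and Mazur's lemma.\<close>

lemma (in finite_measure) convex_selection:
  fixes S :: "nat \<Rightarrow> ('a \<Rightarrow> 'b::euclidean_space) set"
  assumes p: "p > 1"
    and dec: "\<And>n. S (Suc n) \<subseteq> S n" and ne: "\<And>n. S n \<noteq> {}"
    and mid: "\<And>n u v. u \<in> S n \<Longrightarrow> v \<in> S n \<Longrightarrow> (\<lambda>x. (1/2) *\<^sub>R (u x + v x)) \<in> S n"
    and meas: "\<And>u. u \<in> S 0 \<Longrightarrow> u \<in> borel_measurable M"
    and bd: "\<And>u. u \<in> S 0 \<Longrightarrow> powr_integral M p u \<le> ennreal C"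
  obtains u v where "\<And>n. u n \<in> S n" "AE x in M. (\<lambda>n. u n x) \<longlonglongrightarrow> v x"
    "integrable M v" "(\<lambda>n. \<integral>x. norm (u n x - v x) \<partial>M) \<longlonglongrightarrow> 0"
proof -
  have sub: "S n \<subseteq> S 0" for n by (induction n) (use dec in blast)+
  have mono: "m \<le> n \<Longrightarrow> S n \<subseteq> S m" for m n
    by (rule lift_Suc_antimono_le[of S]) (use dec in auto)
  have powi: "integrable M (\<lambda>x. norm (u x) powr p)" and powb: "(\<integral>x. norm (u x) powr p \<partial>M) \<le> max C 0" if "u \<in> S 0" for u
  proof -
    have [measurable]: "u \<in> borel_measurable M" using meas that .
    have *: "powr_integral M p u \<le> ennreal (max C 0)"
      using bd[OF that] by (auto simp: max_def ennreal_neg)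
    then show "integrable M (\<lambda>x. norm (u x) powr p)"
      by (intro integrableI_bounded) (auto intro: le_less_trans)
    from nn_integral_eq_integral[OF this] * show "(\<integral>x. norm (u x) powr p \<partial>M) \<le> max C 0" by simp
  qed
  have powj: "integrable M (\<lambda>x. jnorm (u x) powr p)" if "u \<in> S 0" for u
  proof (rule Bochner_Integration.integrable_bound[of _ "\<lambda>x. 2 powr p * (1 + norm (u x) powr p)"])
    have [measurable]: "u \<in> borel_measurable M" using meas that .
    show "(\<lambda>x. jnorm (u x) powr p) \<in> borel_measurable M" unfolding jnorm_def by measurable
    show "AE x in M. norm (jnorm (u x) powr p) \<le> norm (2 powr p * (1 + norm (u x) powr p))"
      using jnorm_powr_le[OF p] by auto
  qed (use powi[OF that] in auto)
  define D where "D = 2 powr p * (measure M (space M) + max C 0)"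
  have powjb: "(\<integral>x. jnorm (u x) powr p \<partial>M) \<le> D" if "u \<in> S 0" for u
  proof -
    have "(\<integral>x. jnorm (u x) powr p \<partial>M) \<le> (\<integral>x. 2 powr p * (1 + norm (u x) powr p) \<partial>M)"
      using powj[OF that] powi[OF that] jnorm_powr_le[OF p] by (intro integral_mono) auto
    also have "\<dots> = 2 powr p * (measure M (space M) + (\<integral>x. norm (u x) powr p \<partial>M))"
      using powi[OF that] by simp
    also have "\<dots> \<le> D" unfolding D_def using powb[OF that] by (intro mult_left_mono) auto
    finally show ?thesis .
  qed
  have le_powr: "jnorm a \<le> jnorm a powr p" for a :: 'b
  proof -
    have "jnorm a powr 1 \<le> jnorm a powr p" using jnorm_ge_1[of a] p by (intro powr_mono) auto
    then show ?thesis using jnorm_ge_1[of a] by simp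
  qed
  have ji: "integrable M (\<lambda>x. jnorm (u x))" if "u \<in> S 0" for u
  proof (rule Bochner_Integration.integrable_bound[OF powj[OF that]])
    have [measurable]: "u \<in> borel_measurable M" using meas that .
    show "(\<lambda>x. jnorm (u x)) \<in> borel_measurable M" unfolding jnorm_def by measurable
    show "AE x in M. norm (jnorm (u x)) \<le> norm (jnorm (u x) powr p)"
    proof (rule AE_I2)
      fix x
      have "0 \<le> jnorm (u x)" using jnorm_ge_1[of "u x"] by linarith
      then show "norm (jnorm (u x)) \<le> norm (jnorm (u x) powr p)" using le_powr[of "u x"] by simp
    qed
  qed
  have ui: "integrable M u" if "u \<in> S 0" for u
    by (rule Bochner_Integration.integrable_bound[OF ji[OF that] meas[OF that]])
       (auto intro!: AE_I2 order_trans[OF norm_le_jnorm abs_ge_self])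
  define \<Phi> where "\<Phi> u = (\<integral>x. jnorm (u x) \<partial>M)" for u :: "'a \<Rightarrow> 'b"
  \<comment> \<open>The sets shrink, so these infima increase; the bound D makes them
    converge.\<close>
  define I where "I n = Inf (\<Phi> ` S n)" for n
  have \<Phi>0: "0 \<le> \<Phi> u" for u
    unfolding \<Phi>_def by (intro Bochner_Integration.integral_nonneg order_trans[OF zero_le_one jnorm_ge_1])
  have bdd: "bdd_below (\<Phi> ` S n)" for n using \<Phi>0 by (intro bdd_belowI[of _ 0]) auto
  have I_le: "I n \<le> \<Phi> u" if "u \<in> S n" for u n
    unfolding I_def using that bdd by (intro cInf_lower) auto
  have I_mono: "I m \<le> I n" if "m \<le> n" for m n
    unfolding I_def using mono[OF that] ne bdd by (intro cInf_superset_mono) auto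
  have I_bd: "I n \<le> D" for n
  proof -
    obtain u where u: "u \<in> S n" using ne by blast
    then have u0: "u \<in> S 0" using sub by blast
    have "I n \<le> \<Phi> u" by (rule I_le[OF u])
    also have "\<dots> \<le> (\<integral>x. jnorm (u x) powr p \<partial>M)"
      unfolding \<Phi>_def using ji[OF u0] powj[OF u0] le_powr by (intro integral_mono) auto
    also have "\<dots> \<le> D" by (rule powjb[OF u0])
    finally show ?thesis .
  qed
  have "\<exists>u. u \<in> S n \<and> \<Phi> u < I n + 1 / real (Suc n)" for n
  proof -
    have "\<exists>y\<in>\<Phi> ` S n. y < I n + 1 / real (Suc n)"
      using ne bdd unfolding I_def by (intro cInf_lessD) (auto simp: less_add_same_cancel1)
    then show ?thesis by blast
  qed
  then obtain u where u: "\<And>n. u n \<in> S n" "\<And>n. \<Phi> (u n) < I n + 1 / real (Suc n)" by metis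
  have u0: "u n \<in> S 0" for n using u(1) sub by blast
  obtain L where L: "I \<longlonglongrightarrow> L" "\<And>n. I n \<le> L"
    using incseq_convergent[of I D] I_mono I_bd by (auto simp: incseq_def)
  \<comment> \<open>A bound for the convexity gap of any two members with index at least n: their
    values of \<Phi> are at most L + 1 / (n + 1), while their midpoint lies in \<open>S n\<close>
    and so has value at least \<open>I n\<close>.\<close>
  define \<epsilon> where "\<epsilon> n = L + 1 / real (Suc n) - I n" for n
  have \<epsilon>: "\<epsilon> \<longlonglongrightarrow> 0"
  proof -
    have "(\<lambda>n. L + inverse (real (Suc n)) - I n) \<longlonglongrightarrow> L + 0 - L"
      by (intro tendsto_intros L LIMSEQ_inverse_real_of_nat)
    then show ?thesis by (simp add: \<epsilon>_def[abs_def] inverse_eq_divide)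
  qed
  define gap where "gap a b = (jnorm a + jnorm b) / 2 - jnorm ((1/2) *\<^sub>R (a + b))" for a b :: 'b
  have gap_int: "integrable M (\<lambda>x. gap (u i x) (u j x))"
    and gap_le: "i \<ge> N \<Longrightarrow> j \<ge> N \<Longrightarrow> (\<integral>x. gap (u i x) (u j x) \<partial>M) \<le> \<epsilon> N" for i j N
  proof -
    let ?w = "\<lambda>x. (1/2) *\<^sub>R (u i x + u j x)"
    have w0: "?w \<in> S 0" by (intro mid u0)
    note ints = ji[OF u0[of i]] ji[OF u0[of j]] ji[OF w0]
    show "integrable M (\<lambda>x. gap (u i x) (u j x))" unfolding gap_def using ints by auto
    assume ij: "i \<ge> N" "j \<ge> N"
    have "?w \<in> S N" using u(1)[of i] u(1)[of j] mono[OF ij(1)] mono[OF ij(2)] by (intro mid) auto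
    then have "I N \<le> \<Phi> ?w" by (rule I_le)
    moreover have "(\<Phi> (u i) + \<Phi> (u j)) / 2 \<le> L + 1 / real (Suc N)"
    proof -
      have bound: "\<Phi> (u k) \<le> L + 1 / real (Suc N)" if "k \<ge> N" for k
      proof -
        have "1 / real (Suc k) \<le> 1 / real (Suc N)" using that by (intro divide_left_mono) auto
        with less_imp_le[OF u(2)[of k]] L(2)[of k] show ?thesis by linarith
      qed
      have "(x + y) / 2 \<le> c" if "x \<le> c" "y \<le> c" for x y c :: real using that by simp
      then show ?thesis using bound[OF ij(1)] bound[OF ij(2)] by blast
    qed
    moreover have "(\<integral>x. gap (u i x) (u j x) \<partial>M) = (\<Phi> (u i) + \<Phi> (u j)) / 2 - \<Phi> ?w"
      unfolding gap_def \<Phi>_def using ints by simp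
    ultimately show "(\<integral>x. gap (u i x) (u j x) \<partial>M) \<le> \<epsilon> N" unfolding \<epsilon>_def by linarith
  qed
  have cauchy: "\<exists>N. \<forall>i\<ge>N. \<forall>j\<ge>N. (\<integral>x. norm (u i x - u j x) \<partial>M) < e" if e: "e > 0" for e
  proof -
    let ?\<mu> = "measure M (space M)"
    \<comment> \<open>The integrated distance splits into three parts below e / 3: \<eta> takes care
      of the constant term, R of the tail, and N, chosen after both, of the convexity gap.\<close>
    define \<eta> where "\<eta> = e / (3 * (?\<mu> + 1))"
    have \<mu>: "?\<mu> + 1 > 0" by (simp add: add_nonneg_pos)
    have \<eta>: "\<eta> > 0" "\<eta> * ?\<mu> < e / 3"
      using e \<mu> by (auto simp: \<eta>_def field_simps)
    have "((\<lambda>R. R powr (1 - p)) \<longlongrightarrow> 0) at_top"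
      using p by (intro tendsto_neg_powr filterlim_ident) auto
    then have "((\<lambda>R. 4 * D * R powr (1 - p)) \<longlongrightarrow> 4 * D * 0) at_top" by (intro tendsto_intros)
    then have "\<forall>\<^sub>F R in at_top. 4 * D * R powr (1 - p) < e / 3" using e by (intro order_tendstoD) auto
    then have "\<forall>\<^sub>F R in at_top. 4 * D * R powr (1 - p) < e / 3 \<and> 0 < R"
      using eventually_gt_at_top by (rule eventually_conj)
    then obtain R where R: "4 * D * R powr (1 - p) < e / 3" "0 < R"
      by (auto dest: eventually_happens)
    have "(\<lambda>n. 8 * R ^ 3 / \<eta> * \<epsilon> n) \<longlonglongrightarrow> 8 * R ^ 3 / \<eta> * 0" by (intro tendsto_intros \<epsilon>)
    then have "\<forall>\<^sub>F n in sequentially. 8 * R ^ 3 / \<eta> * \<epsilon> n < e / 3" using e by (intro order_tendstoD) auto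
    then obtain N where N: "8 * R ^ 3 / \<eta> * \<epsilon> N < e / 3" by (auto dest: eventually_happens)
    have "(\<integral>x. norm (u i x - u j x) \<partial>M) < e" if ij: "i \<ge> N" "j \<ge> N" for i j
    proof -
      note ints = powj[OF u0[of i]] powj[OF u0[of j]] gap_int[of i j]
      have "(\<integral>x. norm (u i x - u j x) \<partial>M) \<le> (\<integral>x. \<eta> + 8 * R ^ 3 / \<eta> * gap (u i x) (u j x)
          + 2 * R powr (1 - p) * (jnorm (u i x) powr p + jnorm (u j x) powr p) \<partial>M)"
        using ints ui[OF u0[of i]] ui[OF u0[of j]] norm_diff_le_midpoint_gap[OF \<eta>(1) R(2) p] unfolding gap_def
        by (intro integral_mono) auto
      also have "\<dots> = \<eta> * ?\<mu> + 8 * R ^ 3 / \<eta> * (\<integral>x. gap (u i x) (u j x) \<partial>M)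
          + 2 * R powr (1 - p) * ((\<integral>x. jnorm (u i x) powr p \<partial>M) + (\<integral>x. jnorm (u j x) powr p \<partial>M))"
        using ints by (simp add: mult.commute)
      also have "\<dots> \<le> \<eta> * ?\<mu> + 8 * R ^ 3 / \<eta> * \<epsilon> N + 2 * R powr (1 - p) * (D + D)"
        using gap_le[OF ij] powjb[OF u0[of i]] powjb[OF u0[of j]] \<eta>(1) R(2)
        by (intro add_mono mult_left_mono order_refl) auto
      also have "\<dots> < e"
      proof -
        have "x + y + 2 * r * (D + D) < e" if "x < e / 3" "y < e / 3" "4 * D * r < e / 3" for x y r
          using that by (simp add: algebra_simps)
        from this[OF \<eta>(2) N R(1)] show ?thesis .
      qed
      finally show ?thesis .
    qed
    then show ?thesis by blast
  qed
  obtain r where r: "strict_mono r" "AE x in M. Cauchy (\<lambda>i. u (r i) x)"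
    using cauchy_L1_AE_cauchy_subseq[of M u, OF ui[OF u0] cauchy] by blast
  define v where "v x = lim (\<lambda>n. u (r n) x)" for x
  have conv: "AE x in M. (\<lambda>n. u (r n) x) \<longlonglongrightarrow> v x"
    using r(2) by eventually_elim (simp add: v_def Cauchy_convergent_iff convergent_LIMSEQ_iff)
  have vm: "v \<in> borel_measurable M"
    unfolding v_def by (rule borel_measurable_lim_metric) (rule meas[OF u0])
  \<comment> \<open>Fatou's lemma in the second index carries the Cauchy estimate over to the
    pointwise limit. This gives both the integrability of v and the convergence in L^1.\<close>
  have nn_le: "\<exists>N. \<forall>n\<ge>N. (\<integral>\<^sup>+x. ennreal (norm (u (r n) x - v x)) \<partial>M) \<le> ennreal e" if e: "e > 0" for e
  proof -
    obtain N where N: "\<And>i j. i \<ge> N \<Longrightarrow> j \<ge> N \<Longrightarrow> (\<integral>x. norm (u i x - u j x) \<partial>M) < e"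
      using cauchy[OF e] by meson
    have "(\<integral>\<^sup>+x. ennreal (norm (u (r n) x - v x)) \<partial>M) \<le> ennreal e" if n: "n \<ge> N" for n
    proof -
      have rN: "r k \<ge> N" if "k \<ge> N" for k using seq_suble[OF r(1), of k] that by linarith
      have "(\<integral>\<^sup>+x. ennreal (norm (u (r n) x - v x)) \<partial>M)
          = (\<integral>\<^sup>+x. liminf (\<lambda>k. ennreal (norm (u (r n) x - u (r k) x))) \<partial>M)"
      proof (rule nn_integral_cong_AE)
        show "AE x in M. ennreal (norm (u (r n) x - v x)) = liminf (\<lambda>k. ennreal (norm (u (r n) x - u (r k) x)))"
          using conv
        proof eventually_elim
          case (elim x)
          have "(\<lambda>k. ennreal (norm (u (r n) x - u (r k) x))) \<longlonglongrightarrow> ennreal (norm (u (r n) x - v x))"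
            by (intro tendsto_intros elim)
          then show ?case by (intro lim_imp_Liminf[symmetric]) simp_all
        qed
      qed
      also have "\<dots> \<le> liminf (\<lambda>k. \<integral>\<^sup>+x. ennreal (norm (u (r n) x - u (r k) x)) \<partial>M)"
        using meas[OF u0] by (intro nn_integral_liminf) simp
      also have "\<dots> \<le> liminf (\<lambda>k. ennreal e)"
      proof (rule Liminf_mono)
        show "\<forall>\<^sub>F k in sequentially. (\<integral>\<^sup>+x. ennreal (norm (u (r n) x - u (r k) x)) \<partial>M) \<le> ennreal e"
          using eventually_ge_at_top[of N]
        proof eventually_elim
          case (elim k)
          have "(\<integral>\<^sup>+x. ennreal (norm (u (r n) x - u (r k) x)) \<partial>M) = ennreal (\<integral>x. norm (u (r n) x - u (r k) x) \<partial>M)"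
            using ui[OF u0] by (intro nn_integral_eq_integral) auto
          then show ?case using N[OF rN[OF n] rN[OF elim]] by (simp add: ennreal_leI)
        qed
      qed
      also have "\<dots> = ennreal e" by (simp add: Liminf_const)
      finally show ?thesis .
    qed
    then show ?thesis by blast
  qed
  obtain N1 where N1: "(\<integral>\<^sup>+x. ennreal (norm (u (r N1) x - v x)) \<partial>M) \<le> ennreal 1"
    using nn_le[of 1] by auto
  have "integrable M (\<lambda>x. u (r N1) x - v x)"
    using N1 meas[OF u0] vm by (intro integrableI_bounded) (auto intro: le_less_trans)
  from Bochner_Integration.integrable_diff[OF ui[OF u0[of "r N1"]] this] have vi: "integrable M v" by simp
  have lim: "(\<lambda>n. \<integral>x. norm (u (r n) x - v x) \<partial>M) \<longlonglongrightarrow> 0"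
  proof (rule LIMSEQ_I)
    fix e :: real assume e: "0 < e"
    then obtain N where N: "\<And>n. n \<ge> N \<Longrightarrow> (\<integral>\<^sup>+x. ennreal (norm (u (r n) x - v x)) \<partial>M) \<le> ennreal (e / 2)"
      using nn_le[of "e / 2"] by auto
    have "norm ((\<integral>x. norm (u (r n) x - v x) \<partial>M) - 0) < e" if n: "n \<ge> N" for n
    proof -
      have "(\<integral>\<^sup>+x. ennreal (norm (u (r n) x - v x)) \<partial>M) = ennreal (\<integral>x. norm (u (r n) x - v x) \<partial>M)"
        using ui[OF u0] vi by (intro nn_integral_eq_integral) auto
      then have "ennreal (\<integral>x. norm (u (r n) x - v x) \<partial>M) \<le> ennreal (e / 2)" using N[OF n] by simp
      then have "(\<integral>x. norm (u (r n) x - v x) \<partial>M) \<le> e / 2" using e by (subst (asm) ennreal_le_iff) auto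
      moreover have "0 \<le> (\<integral>x. norm (u (r n) x - v x) \<partial>M)" by simp
      ultimately show ?thesis using e by simp
    qed
    then show "\<exists>N. \<forall>n\<ge>N. norm ((\<integral>x. norm (u (r n) x - v x) \<partial>M) - 0) < e" by blast
  qed
  \<comment> \<open>\<open>u (r n)\<close> was chosen in \<open>S (r n)\<close>, and
    \<open>r n \<ge> n\<close> because r is strictly increasing.\<close>
  have sel: "u (r n) \<in> S n" for n
    using u(1)[of "r n"] mono[OF seq_suble[OF r(1)]] by blast
  show thesis by (rule that[OF sel conv vi lim])
qed

section \<open>Mollification\<close>

text \<open>Expresses the standard kernel through \<open>flat 0\<close>, from which its continuity
  across the unit sphere and its bounds follow.\<close>

lemma chi0_eq_flat: "chi0 x = flat 0 (1 - (norm x)\<^sup>2)"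
proof (cases "norm x < 1")
  case True
  then have "(norm x)\<^sup>2 < 1" by (simp add: power_less_one_iff)
  moreover have "1 / ((norm x)\<^sup>2 - 1) = - (1 / (1 - (norm x)\<^sup>2))"
    by (metis minus_diff_eq minus_divide_right)
  ultimately show ?thesis using True by (simp add: chi0_def flat_def)
next
  case False
  then have "1 \<le> (norm x)\<^sup>2" by (intro one_le_power) simp
  then have "\<not> 0 < 1 - (norm x)\<^sup>2" by linarith
  then show ?thesis using False by (simp only: chi0_def flat_def if_False)
qed

lemma continuous_on_chi0: "continuous_on UNIV (chi0 :: 'a::euclidean_space \<Rightarrow> real)"
proof -
  have "continuous_on UNIV (\<lambda>x::'a. flat 0 (1 - (norm x)\<^sup>2))"
    by (rule continuous_on_compose2[OF continuous_on_flat[of UNIV]]) (auto intro!: continuous_intros)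
  then show ?thesis by (simp add: chi0_eq_flat[abs_def])
qed

lemma chi0_bounds: "0 \<le> chi0 x" "chi0 x \<le> 1"
  by (simp_all add: chi0_eq_flat flat_nonneg flat_le_1)

lemma chi0_eq_0: "1 \<le> norm x \<Longrightarrow> chi0 x = 0"
  by (simp add: chi0_def)

lemma integrable_chi0: "integrable lborel (chi0 :: 'a::euclidean_space \<Rightarrow> real)"
proof -
  have "integrable lborel (\<lambda>x::'a. indicator (cball 0 1) x *\<^sub>R chi0 x)"
    by (intro borel_integrable_compact compact_cball continuous_on_subset[OF continuous_on_chi0]) auto
  moreover have "(\<lambda>x::'a. indicator (cball 0 1) x *\<^sub>R chi0 x) = chi0"
  proof
    fix x :: 'a show "indicator (cball 0 1) x *\<^sub>R chi0 x = chi0 x"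
      using chi0_eq_0[of x] by (cases "norm x \<le> 1") (auto simp: indicator_def)
  qed
  ultimately show ?thesis by simp
qed

text \<open>The inequality also covers the convention 1 / 0 = 0: if the normalising integral c were
  0, \<open>chi\<close> would vanish identically.\<close>

lemma nn_integral_chi_le_1: "(\<integral>\<^sup>+x. ennreal (chi (x::'a::euclidean_space)) \<partial>lborel) \<le> 1"
proof -
  define c where "c = (LINT y|lebesgue. chi0 (y::'a))"
  have meas: "(chi0 :: 'a \<Rightarrow> real) \<in> borel_measurable borel"
    by (rule borel_measurable_continuous_onI[OF continuous_on_chi0])
  have c: "c = (LINT y|lborel. chi0 (y::'a))" unfolding c_def by (rule integral_completion) (simp add: meas)
  have c0: "0 \<le> c" unfolding c by (intro Bochner_Integration.integral_nonneg chi0_bounds)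
  have nn: "(\<integral>\<^sup>+x. ennreal (chi0 (x::'a)) \<partial>lborel) = ennreal c"
    unfolding c by (intro nn_integral_eq_integral integrable_chi0 AE_I2 chi0_bounds)
  have "(\<integral>\<^sup>+x. ennreal (chi (x::'a)) \<partial>lborel) = (\<integral>\<^sup>+x. ennreal (1 / c) * ennreal (chi0 (x::'a)) \<partial>lborel)"
    using c0 chi0_bounds by (intro nn_integral_cong) (simp add: chi_def c_def[symmetric] ennreal_mult'[symmetric])
  also have "\<dots> = ennreal (1 / c) * ennreal c"
    using meas by (subst nn_integral_cmult) (simp_all add: nn)
  also have "\<dots> = ennreal (1 / c * c)" by (rule ennreal_mult[symmetric]) (use c0 in auto)
  also have "\<dots> \<le> 1" by (cases "c = 0") auto
  finally show ?thesis .
qed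

lemma chi_nonneg: "0 \<le> chi x"
  unfolding chi_def by (intro divide_nonneg_nonneg chi0_bounds Bochner_Integration.integral_nonneg)

lemma continuous_on_chi: "continuous_on UNIV (chi :: 'a::euclidean_space \<Rightarrow> real)"
proof -
  have "continuous_on UNIV (\<lambda>x::'a. chi0 x * inverse (LINT y|lebesgue. chi0 (y::'a)))"
    by (intro continuous_on_mult_right continuous_on_chi0)
  then show ?thesis unfolding chi_def divide_inverse .
qed

lemma chi_eps_nonneg: "0 < \<epsilon> \<Longrightarrow> 0 \<le> chi_eps \<epsilon> x"
  unfolding chi_eps_def by (intro mult_nonneg_nonneg chi_nonneg) simp

lemma continuous_on_chi_eps: "continuous_on UNIV (chi_eps \<epsilon> :: 'a::euclidean_space \<Rightarrow> real)"
  unfolding chi_eps_def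
  by (intro continuous_on_mult_left continuous_on_compose2[OF continuous_on_chi] continuous_intros) auto

lemma chi_eps_minus: "chi_eps \<epsilon> (- x) = chi_eps \<epsilon> x"
  by (simp add: chi_eps_def chi_def chi0_def)

lemma chi_eps_eq_0: "0 < \<epsilon> \<Longrightarrow> \<epsilon> \<le> norm x \<Longrightarrow> chi_eps \<epsilon> x = 0"
  by (simp add: chi_eps_def chi_def chi0_eq_0)

lemma borel_measurable_chi_eps: "(chi_eps \<epsilon> :: 'a::euclidean_space \<Rightarrow> real) \<in> borel_measurable borel"
  by (rule borel_measurable_continuous_onI[OF continuous_on_chi_eps])

lemma nn_integral_chi_eps_le_1:
  fixes y :: "'a::euclidean_space"
  assumes "0 < \<epsilon>"
  shows "(\<integral>\<^sup>+x. ennreal (chi_eps \<epsilon> (x - y)) \<partial>lebesgue) \<le> 1"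
proof -
  have meas: "(\<lambda>x. ennreal (chi_eps \<epsilon> (x - y))) \<in> borel_measurable borel"
    by (intro measurable_compose[OF _ measurable_ennreal] measurable_compose[OF _ borel_measurable_chi_eps]) simp
  have "(\<integral>\<^sup>+x. ennreal (chi_eps \<epsilon> (x - y)) \<partial>lebesgue) = (\<integral>\<^sup>+x. ennreal (chi_eps \<epsilon> (x - y)) \<partial>lborel)"
    by (rule nn_integral_completion)
  also have "\<dots> = ennreal (\<epsilon> ^ DIM('a)) * (\<integral>\<^sup>+z. ennreal (chi_eps \<epsilon> (\<epsilon> *\<^sub>R (z::'a))) \<partial>lborel)"
    using assms meas
    by (subst lborel_affine[of \<epsilon> y])
       (simp_all add: nn_integral_density nn_integral_distr nn_integral_cmult ennreal_power[symmetric])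
  also have "\<dots> = (\<integral>\<^sup>+z. ennreal (\<epsilon> ^ DIM('a)) * ennreal (chi_eps \<epsilon> (\<epsilon> *\<^sub>R (z::'a))) \<partial>lborel)"
    by (intro nn_integral_cmult[symmetric] measurable_compose[OF _ measurable_ennreal] measurable_compose[OF _ borel_measurable_chi_eps]) simp
  also have "\<dots> = (\<integral>\<^sup>+z. ennreal (chi (z::'a)) \<partial>lborel)"
    using assms by (intro nn_integral_cong) (simp add: chi_eps_def ennreal_mult'[symmetric])
  also have "\<dots> \<le> 1" by (rule nn_integral_chi_le_1)
  finally show ?thesis .
qed

lemma chi_eps_bounded:
  assumes "0 < \<epsilon>"
  obtains B where "0 \<le> B" "\<And>x::'a::euclidean_space. chi_eps \<epsilon> x \<le> B"
proof -
  have "compact (chi_eps \<epsilon> ` (cball 0 \<epsilon> :: 'a set))"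
    by (intro compact_continuous_image continuous_on_subset[OF continuous_on_chi_eps]) auto
  then obtain B where B: "\<And>x::'a. x \<in> cball 0 \<epsilon> \<Longrightarrow> norm (chi_eps \<epsilon> x) \<le> B"
    using compact_imp_bounded bounded_iff by (metis imageI)
  have "chi_eps \<epsilon> x \<le> max B 0" for x :: 'a
    using B[of x] chi_eps_eq_0[OF assms, of x] by (cases "norm x \<le> \<epsilon>") auto
  then show ?thesis by (intro that[of "max B 0"]) auto
qed

lemma chi_eps_uniformly_continuous:
  assumes "0 < \<epsilon>" "0 < e"
  obtains d where "0 < d" "\<And>x y::'a::euclidean_space. dist x y < d \<Longrightarrow> \<bar>chi_eps \<epsilon> x - chi_eps \<epsilon> y\<bar> < e"
proof -
  have "uniformly_continuous_on (cball 0 (\<epsilon> + 1)) (chi_eps \<epsilon> :: 'a \<Rightarrow> real)"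
    by (intro compact_uniformly_continuous continuous_on_subset[OF continuous_on_chi_eps]) auto
  then obtain d where d: "0 < d"
    "\<And>x y::'a. x \<in> cball 0 (\<epsilon> + 1) \<Longrightarrow> y \<in> cball 0 (\<epsilon> + 1) \<Longrightarrow> dist x y < d \<Longrightarrow> dist (chi_eps \<epsilon> x) (chi_eps \<epsilon> y) < e"
    using assms(2) unfolding uniformly_continuous_on_def by (metis dist_commute)
  \<comment> \<open>The restriction to distances below 1 puts both points into the ball of radius
    \<epsilon> + 1 as soon as one of them lies in the ball of radius \<epsilon> that carries the
    kernel.\<close>
  have "\<bar>chi_eps \<epsilon> x - chi_eps \<epsilon> y\<bar> < e" if xy: "dist x y < min d 1" for x y :: 'a
  proof (cases "norm x \<le> \<epsilon> \<or> norm y \<le> \<epsilon>")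
    case True
    have "norm x \<le> norm y + dist x y" "norm y \<le> norm x + dist x y"
      using norm_triangle_ineq2[of x y] norm_triangle_ineq2[of y x] by (simp_all add: dist_norm norm_minus_commute)
    then have "x \<in> cball 0 (\<epsilon> + 1)" "y \<in> cball 0 (\<epsilon> + 1)" using True xy by auto
    then show ?thesis using d(2) xy by (simp add: dist_real_def)
  next
    case False
    then show ?thesis using chi_eps_eq_0[OF assms(1), of x] chi_eps_eq_0[OF assms(1), of y] assms(2) by simp
  qed
  then show ?thesis using d(1) by (intro that[of "min d 1"]) auto
qed

text \<open>The tangent at a of the convex function t^q lies below its graph; this is Young's
  inequality for t^q and a^q with weights 1 / q and 1 - 1 / q. It serves as a Jensen inequality for
  kernels of mass at most 1.\<close>

lemma powr_tangent:
  fixes a t q :: real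
  assumes "0 \<le> a" "0 \<le> t" "1 \<le> q"
  shows "(1 - q) * a powr q + q * a powr (q - 1) * t \<le> t powr q"
proof (cases "a = 0 \<or> t = 0")
  case True
  then show ?thesis using assms by (auto simp: mult_nonpos_nonneg)
next
  case False
  then have pos: "0 < a" "0 < t" using assms by auto
  have "(t powr q) powr (1 / q) * (a powr q) powr (1 - 1 / q) \<le> 1 / q * t powr q + (1 - 1 / q) * a powr q"
    using pos assms by (intro Youngs_inequality_0) auto
  moreover have "(t powr q) powr (1 / q) = t" using pos assms by (simp add: powr_powr)
  moreover have "(a powr q) powr (1 - 1 / q) = a powr (q - 1)"
    using pos assms by (simp add: powr_powr right_diff_distrib)
  ultimately have "q * (t * a powr (q - 1)) \<le> q * (1 / q * t powr q + (1 - 1 / q) * a powr q)"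
    using assms by (intro mult_left_mono) auto
  also have "\<dots> = t powr q + (q - 1) * a powr q" using assms by (simp add: field_simps)
  finally show ?thesis by (simp add: algebra_simps)
qed

lemma moll_eq_lebesgue_on:
  assumes "S \<in> sets lebesgue"
  shows "moll S \<epsilon> m x = (LINT y|lebesgue_on S. m y * chi_eps \<epsilon> (x - y))"
  unfolding moll_def by (rule set_lebesgue_integral_eq_lebesgue_on[OF assms])

lemma measurable_chi_eps_diff:
  "(\<lambda>y. chi_eps \<epsilon> (x - y)) \<in> borel_measurable (lebesgue_on S)"
  using id_borel_measurable_lebesgue_on[of S]
  by (intro measurable_compose[OF _ borel_measurable_chi_eps] borel_measurable_diff) (simp_all add: id_def)

lemma integrable_mult_chi_eps:
  assumes "0 < \<epsilon>" "integrable (lebesgue_on S) m"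
  shows "integrable (lebesgue_on S) (\<lambda>y. m y * chi_eps \<epsilon> (x - y))"
proof -
  obtain B where B: "0 \<le> B" "\<And>x::'a. chi_eps \<epsilon> x \<le> B" by (rule chi_eps_bounded[OF assms(1)]) (rule that)
  show ?thesis
  proof (rule Bochner_Integration.integrable_bound)
    show "integrable (lebesgue_on S) (\<lambda>y. B * m y)" using assms(2) by simp
    show "(\<lambda>y. m y * chi_eps \<epsilon> (x - y)) \<in> borel_measurable (lebesgue_on S)"
      by (intro borel_measurable_times borel_measurable_integrable[OF assms(2)] measurable_chi_eps_diff)
    show "AE y in lebesgue_on S. norm (m y * chi_eps \<epsilon> (x - y)) \<le> norm (B * m y)"
    proof (rule AE_I2)
      fix y
      have "\<bar>chi_eps \<epsilon> (x - y)\<bar> \<le> \<bar>B\<bar>" using B chi_eps_nonneg[OF assms(1), of "x - y"] by simp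
      from mult_left_mono[OF this abs_ge_zero, of "m y"]
      show "norm (m y * chi_eps \<epsilon> (x - y)) \<le> norm (B * m y)"
        by (simp add: abs_mult mult.commute)
    qed
  qed
qed

text \<open>Integration against a bounded kernel turns L^1 distance into uniform distance, so
  mollified densities converge at every point when the densities converge in L^1.\<close>

lemma moll_lipschitz_L1:
  fixes S :: "'a::euclidean_space set"
  assumes "0 < \<epsilon>" "S \<in> sets lebesgue" "integrable (lebesgue_on S) m" "integrable (lebesgue_on S) m'"
    and B: "\<And>x::'a. chi_eps \<epsilon> x \<le> B"
  shows "\<bar>moll S \<epsilon> m x - moll S \<epsilon> m' x\<bar> \<le> B * (LINT y|lebesgue_on S. \<bar>m y - m' y\<bar>)"
proof -
  note int = integrable_mult_chi_eps[OF assms(1,3), of x] integrable_mult_chi_eps[OF assms(1,4), of x]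
  have "moll S \<epsilon> m x - moll S \<epsilon> m' x = (LINT y|lebesgue_on S. m y * chi_eps \<epsilon> (x - y) - m' y * chi_eps \<epsilon> (x - y))"
    unfolding moll_eq_lebesgue_on[OF assms(2)] by (rule Bochner_Integration.integral_diff[OF int, symmetric])
  also have "\<bar>\<dots>\<bar> \<le> (LINT y|lebesgue_on S. \<bar>m y * chi_eps \<epsilon> (x - y) - m' y * chi_eps \<epsilon> (x - y)\<bar>)"
    by (rule integral_abs_bound)
  also have "\<dots> \<le> (LINT y|lebesgue_on S. B * \<bar>m y - m' y\<bar>)"
  proof (rule integral_mono)
    fix y
    have "\<bar>m y * chi_eps \<epsilon> (x - y) - m' y * chi_eps \<epsilon> (x - y)\<bar> = \<bar>m y - m' y\<bar> * chi_eps \<epsilon> (x - y)"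
      using chi_eps_nonneg[OF assms(1), of "x - y"] by (simp add: left_diff_distrib[symmetric] abs_mult)
    also have "\<dots> \<le> \<bar>m y - m' y\<bar> * B" by (intro mult_left_mono B) simp
    finally show "\<bar>m y * chi_eps \<epsilon> (x - y) - m' y * chi_eps \<epsilon> (x - y)\<bar> \<le> B * \<bar>m y - m' y\<bar>"
      by (simp only: mult.commute)
  qed (use int assms(3,4) in auto)
  finally show ?thesis by simp
qed

text \<open>The modulus of continuity is that of the kernel. One d serves all m at once, which for
  densities of mass 1 is the equicontinuity that Arzela-Ascoli asks for.\<close>

lemma moll_equicontinuous:
  fixes S :: "'a::euclidean_space set"
  assumes "0 < \<epsilon>" "S \<in> sets lebesgue" "0 < e"
  obtains d where "0 < d"
    "\<And>m x x'. integrable (lebesgue_on S) m \<Longrightarrow> dist x x' < d \<Longrightarrow>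
       \<bar>moll S \<epsilon> m x - moll S \<epsilon> m x'\<bar> \<le> e * (LINT y|lebesgue_on S. \<bar>m y\<bar>)"
proof -
  obtain d where d: "0 < d" "\<And>x y::'a. dist x y < d \<Longrightarrow> \<bar>chi_eps \<epsilon> x - chi_eps \<epsilon> y\<bar> < e"
    by (rule chi_eps_uniformly_continuous[OF assms(1,3)]) (rule that)
  have "\<bar>moll S \<epsilon> m x - moll S \<epsilon> m x'\<bar> \<le> e * (LINT y|lebesgue_on S. \<bar>m y\<bar>)"
    if m: "integrable (lebesgue_on S) m" and xx': "dist x x' < d" for m and x x' :: 'a
  proof -
    note int = integrable_mult_chi_eps[OF assms(1) m, of x] integrable_mult_chi_eps[OF assms(1) m, of x']
    have "moll S \<epsilon> m x - moll S \<epsilon> m x' = (LINT y|lebesgue_on S. m y * chi_eps \<epsilon> (x - y) - m y * chi_eps \<epsilon> (x' - y))"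
      unfolding moll_eq_lebesgue_on[OF assms(2)] by (rule Bochner_Integration.integral_diff[OF int, symmetric])
    also have "\<bar>\<dots>\<bar> \<le> (LINT y|lebesgue_on S. \<bar>m y * chi_eps \<epsilon> (x - y) - m y * chi_eps \<epsilon> (x' - y)\<bar>)"
      by (rule integral_abs_bound)
    also have "\<dots> \<le> (LINT y|lebesgue_on S. e * \<bar>m y\<bar>)"
    proof (rule integral_mono)
      fix y
      have "\<bar>chi_eps \<epsilon> (x - y) - chi_eps \<epsilon> (x' - y)\<bar> \<le> e"
        using d(2)[of "x - y" "x' - y"] xx' by (simp add: dist_norm)
      then have "\<bar>m y\<bar> * \<bar>chi_eps \<epsilon> (x - y) - chi_eps \<epsilon> (x' - y)\<bar> \<le> \<bar>m y\<bar> * e"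
        by (rule mult_left_mono) simp
      then show "\<bar>m y * chi_eps \<epsilon> (x - y) - m y * chi_eps \<epsilon> (x' - y)\<bar> \<le> e * \<bar>m y\<bar>"
        by (simp add: right_diff_distrib[symmetric] abs_mult mult.commute)
    qed (use int m in auto)
    finally show ?thesis by simp
  qed
  then show ?thesis using d(1) that by blast
qed

lemma moll_nonneg:
  assumes "0 < \<epsilon>" "S \<in> sets lebesgue" "AE y in lebesgue_on S. 0 \<le> m y"
  shows "0 \<le> moll S \<epsilon> m x"
  unfolding moll_eq_lebesgue_on[OF assms(2)]
  by (rule integral_nonneg_AE, rule eventually_mono[OF assms(3)]) (intro mult_nonneg_nonneg chi_eps_nonneg[OF assms(1)])

text \<open>Jensen at each point, then Fubini. Jensen comes from \<open>powr_tangent\<close> at the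
  value of the mollification. Restricted to S the kernel may have mass below 1; this is harmless,
  because its mass multiplies the term with the factor 1 - q \<le> 0.\<close>

lemma nn_integral_moll_powr_le:
  fixes S :: "'a::euclidean_space set"
  assumes \<epsilon>: "0 < \<epsilon>" and S: "S \<in> lmeasurable" and q: "1 \<le> q"
    and m: "integrable (lebesgue_on S) m" and mq: "integrable (lebesgue_on S) (\<lambda>y. \<bar>m y\<bar> powr q)"
    and m0: "AE y in lebesgue_on S. 0 \<le> m y"
  shows "(\<integral>\<^sup>+x. ennreal (moll S \<epsilon> m x powr q) \<partial>lebesgue_on S) \<le> (\<integral>\<^sup>+y. ennreal (\<bar>m y\<bar> powr q) \<partial>lebesgue_on S)"
proof -
  let ?M = "lebesgue_on S"
  have Sm: "S \<in> sets lebesgue" using S by auto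
  interpret finite_measure ?M using S by (rule finite_measure_lebesgue_on)
  interpret pair_sigma_finite ?M ?M ..
  have one: "(\<integral>\<^sup>+x. ennreal (chi_eps \<epsilon> (x - y)) \<partial>?M) \<le> 1" for y :: 'a
  proof -
    have "(\<integral>\<^sup>+x. ennreal (chi_eps \<epsilon> (x - y)) \<partial>?M) \<le> (\<integral>\<^sup>+x. ennreal (chi_eps \<epsilon> (x - y)) \<partial>lebesgue)"
      using Sm by (subst nn_integral_restrict_space) (auto intro!: nn_integral_mono simp: indicator_def)
    also have "\<dots> \<le> 1" by (rule nn_integral_chi_eps_le_1[OF \<epsilon>])
    finally show ?thesis .
  qed
  have ptw: "ennreal (moll S \<epsilon> m x powr q) \<le> (\<integral>\<^sup>+y. ennreal (\<bar>m y\<bar> powr q) * ennreal (chi_eps \<epsilon> (x - y)) \<partial>?M)" for x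
  proof -
    define a where "a = moll S \<epsilon> m x"
    have a: "0 \<le> a" unfolding a_def by (rule moll_nonneg[OF \<epsilon> Sm m0])
    have ic: "integrable ?M (\<lambda>y. chi_eps \<epsilon> (x - y))"
      using integrable_mult_chi_eps[OF \<epsilon>, of S "\<lambda>_. 1" x] by simp
    have im: "integrable ?M (\<lambda>y. m y * chi_eps \<epsilon> (x - y))" by (rule integrable_mult_chi_eps[OF \<epsilon> m])
    have iq: "integrable ?M (\<lambda>y. \<bar>m y\<bar> powr q * chi_eps \<epsilon> (x - y))" by (rule integrable_mult_chi_eps[OF \<epsilon> mq])
    have c1: "(LINT y|?M. chi_eps \<epsilon> (x - y)) \<le> 1"
    proof -
      have "ennreal (LINT y|?M. chi_eps \<epsilon> (x - y)) = (\<integral>\<^sup>+y. ennreal (chi_eps \<epsilon> (x - y)) \<partial>?M)"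
        by (rule nn_integral_eq_integral[symmetric, OF ic]) (simp add: chi_eps_nonneg[OF \<epsilon>])
      \<comment> \<open>The kernel is even, so its mass in y equals its mass in x.\<close>
      also have "\<dots> = (\<integral>\<^sup>+y. ennreal (chi_eps \<epsilon> (y - x)) \<partial>?M)"
        by (metis chi_eps_minus minus_diff_eq)
      also have "\<dots> \<le> 1" by (rule one)
      finally show ?thesis by simp
    qed
    have "a powr q \<le> (1 - q) * a powr q * (LINT y|?M. chi_eps \<epsilon> (x - y)) + q * a powr (q - 1) * a"
    proof -
      have "(1 - q) * a powr q * 1 \<le> (1 - q) * a powr q * (LINT y|?M. chi_eps \<epsilon> (x - y))"
        using q c1 by (intro mult_left_mono_neg mult_nonpos_nonneg) auto
      moreover have "a powr (q - 1) * a = a powr q"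
        using a by (cases "a = 0") (auto simp: powr_diff)
      then have "q * a powr (q - 1) * a = q * a powr q" by simp
      moreover have "(1 - q) * a powr q * 1 = a powr q - q * a powr q" by (simp add: left_diff_distrib)
      ultimately show ?thesis by linarith
    qed
    also have "\<dots> = (LINT y|?M. (1 - q) * a powr q * chi_eps \<epsilon> (x - y) + q * a powr (q - 1) * (m y * chi_eps \<epsilon> (x - y)))"
      using ic im by (simp add: a_def moll_eq_lebesgue_on[OF Sm])
    also have "\<dots> \<le> (LINT y|?M. \<bar>m y\<bar> powr q * chi_eps \<epsilon> (x - y))"
    proof (rule integral_mono_AE)
      show "AE y in ?M. (1 - q) * a powr q * chi_eps \<epsilon> (x - y) + q * a powr (q - 1) * (m y * chi_eps \<epsilon> (x - y))
          \<le> \<bar>m y\<bar> powr q * chi_eps \<epsilon> (x - y)"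
        using m0
      proof eventually_elim
        case (elim y)
        have "((1 - q) * a powr q + q * a powr (q - 1) * m y) * chi_eps \<epsilon> (x - y) \<le> \<bar>m y\<bar> powr q * chi_eps \<epsilon> (x - y)"
          using powr_tangent[OF a elim q] elim by (intro mult_right_mono chi_eps_nonneg \<epsilon>) simp
        then show ?case by (simp add: algebra_simps)
      qed
    qed (use ic im iq in auto)
    finally have "ennreal (a powr q) \<le> ennreal (LINT y|?M. \<bar>m y\<bar> powr q * chi_eps \<epsilon> (x - y))"
      by (rule ennreal_leI)
    also have "\<dots> = (\<integral>\<^sup>+y. ennreal (\<bar>m y\<bar> powr q * chi_eps \<epsilon> (x - y)) \<partial>?M)"
      by (rule nn_integral_eq_integral[symmetric, OF iq]) (simp add: chi_eps_nonneg[OF \<epsilon>])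
    also have "\<dots> = (\<integral>\<^sup>+y. ennreal (\<bar>m y\<bar> powr q) * ennreal (chi_eps \<epsilon> (x - y)) \<partial>?M)"
      by (intro nn_integral_cong ennreal_mult) (simp_all add: chi_eps_nonneg[OF \<epsilon>])
    finally show ?thesis by (simp add: a_def)
  qed
  have idm: "(\<lambda>x. x) \<in> borel_measurable ?M"
    using id_borel_measurable_lebesgue_on[of S] by (simp add: id_def)
  have mm: "m \<in> borel_measurable ?M" using m by (rule borel_measurable_integrable)
  have chim: "(\<lambda>p. chi_eps \<epsilon> (fst p - snd p)) \<in> borel_measurable (?M \<Otimes>\<^sub>M ?M)"
    by (intro measurable_compose[OF _ borel_measurable_chi_eps] borel_measurable_diff
        measurable_compose[OF measurable_fst idm] measurable_compose[OF measurable_snd idm])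
  have mqm: "(\<lambda>y. ennreal (\<bar>m y\<bar> powr q)) \<in> borel_measurable ?M" using mm by simp
  have joint: "case_prod (\<lambda>x y. ennreal (\<bar>m y\<bar> powr q) * ennreal (chi_eps \<epsilon> (x - y))) \<in> borel_measurable (?M \<Otimes>\<^sub>M ?M)"
    unfolding case_prod_beta
    by (rule borel_measurable_times_ennreal[OF measurable_compose[OF measurable_snd mqm] measurable_compose[OF chim measurable_ennreal]])
  have "(\<integral>\<^sup>+x. ennreal (moll S \<epsilon> m x powr q) \<partial>?M)
      \<le> (\<integral>\<^sup>+x. (\<integral>\<^sup>+y. ennreal (\<bar>m y\<bar> powr q) * ennreal (chi_eps \<epsilon> (x - y)) \<partial>?M) \<partial>?M)"
    by (intro nn_integral_mono ptw)
  also have "\<dots> = (\<integral>\<^sup>+y. (\<integral>\<^sup>+x. ennreal (\<bar>m y\<bar> powr q) * ennreal (chi_eps \<epsilon> (x - y)) \<partial>?M) \<partial>?M)"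
    by (rule Fubini'[OF joint, symmetric])
  also have "\<dots> \<le> (\<integral>\<^sup>+y. ennreal (\<bar>m y\<bar> powr q) \<partial>?M)"
  proof (rule nn_integral_mono)
    fix y
    have "(\<integral>\<^sup>+x. ennreal (\<bar>m y\<bar> powr q) * ennreal (chi_eps \<epsilon> (x - y)) \<partial>?M)
        = ennreal (\<bar>m y\<bar> powr q) * (\<integral>\<^sup>+x. ennreal (chi_eps \<epsilon> (x - y)) \<partial>?M)"
      using idm by (intro nn_integral_cmult measurable_compose[OF _ measurable_ennreal]
          measurable_compose[OF _ borel_measurable_chi_eps] borel_measurable_diff) simp_all
    also have "\<dots> \<le> ennreal (\<bar>m y\<bar> powr q) * 1" by (intro mult_left_mono one) simp
    finally show "(\<integral>\<^sup>+x. ennreal (\<bar>m y\<bar> powr q) * ennreal (chi_eps \<epsilon> (x - y)) \<partial>?M) \<le> ennreal (\<bar>m y\<bar> powr q)" by simp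
  qed
  finally show ?thesis .
qed

section \<open>The kinetic energy density\<close>

lemma Lag_bdd_above:
  fixes H :: "'a::euclidean_space \<Rightarrow> real"
  assumes "\<gamma> > 1" "C > 0" and H: "\<And>p. norm p powr \<gamma> / C - K \<le> H p"
  shows "bdd_above (range (\<lambda>p. p \<bullet> v - H p))"
proof (rule bdd_aboveI2)
  fix p :: 'a
  \<comment> \<open>The solution of T^(\<gamma> - 1) = C |v|. Beyond this radius |p|^\<gamma> / C is
    at least |p| |v|; within it the product |p| |v| is at most T |v|.\<close>
  define T where "T = (C * norm v) powr (1 / (\<gamma> - 1))"
  have T: "0 \<le> T" "T powr (\<gamma> - 1) = C * norm v" using assms by (simp_all add: T_def powr_powr)
  have pv: "p \<bullet> v \<le> norm p * norm v" by (rule norm_cauchy_schwarz)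
  show "p \<bullet> v - H p \<le> T * norm v + K"
  proof (cases "norm p \<le> T")
    case True
    have "norm p * norm v \<le> T * norm v" using True by (rule mult_right_mono) simp
    moreover have "0 \<le> norm p powr \<gamma> / C" using assms by simp
    ultimately show ?thesis using pv H[of p] by linarith
  next
    case False
    then have p: "0 < norm p" using T(1) by linarith
    have "C * norm v \<le> norm p powr (\<gamma> - 1)"
      using False T assms by (metis less_eq_real_def linorder_not_less powr_mono2 diff_ge_0_iff_ge)
    then have "C * norm v * norm p \<le> norm p powr (\<gamma> - 1) * norm p" by (rule mult_right_mono) simp
    also have "\<dots> = norm p powr \<gamma>" using p by (simp add: powr_diff)
    finally have "norm p * norm v \<le> norm p powr \<gamma> / C" using assms(2) by (simp add: field_simps)
    moreover have "0 \<le> T * norm v" using T by simp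
    ultimately show ?thesis using pv H[of p] by linarith
  qed
qed

lemma Lag_upper: "bdd_above (range (\<lambda>p. p \<bullet> v - H p)) \<Longrightarrow> p \<bullet> v - H p \<le> Lag H v"
  unfolding Lag_def by (rule cSUP_upper) simp_all

text \<open>A finite convex function on the whole space is continuous. This is how
  \<open>Lag H\<close>, a supremum over uncountably many p, becomes Borel measurable.\<close>

lemma convex_on_Lag:
  fixes H :: "'a::euclidean_space \<Rightarrow> real"
  assumes "\<And>v. bdd_above (range (\<lambda>p. p \<bullet> v - H p))"
  shows "convex_on UNIV (Lag H)"
proof (rule convex_onI)
  fix t :: real and x y :: 'a assume t: "0 < t" "t < 1"
  show "Lag H ((1 - t) *\<^sub>R x + t *\<^sub>R y) \<le> (1 - t) * Lag H x + t * Lag H y"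
    unfolding Lag_def[of H "(1 - t) *\<^sub>R x + t *\<^sub>R y"]
  proof (rule cSUP_least)
    fix p :: 'a
    have "p \<bullet> ((1 - t) *\<^sub>R x + t *\<^sub>R y) - H p = (1 - t) * (p \<bullet> x - H p) + t * (p \<bullet> y - H p)"
      by (simp add: inner_add_right algebra_simps)
    also have "\<dots> \<le> (1 - t) * Lag H x + t * Lag H y"
      using t by (intro add_mono mult_left_mono Lag_upper assms) simp_all
    finally show "p \<bullet> ((1 - t) *\<^sub>R x + t *\<^sub>R y) - H p \<le> (1 - t) * Lag H x + t * Lag H y" .
  qed simp
qed simp

text \<open>The perspective of the Legendre transform as a supremum of functions affine in (m, w).
  The formula includes m = 0: there the terms reduce to -p \<bullet> w, with supremum 0 or
  \<infinity>, which is the convention in \<open>mL\<close>. Negative values are cut off by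
  \<open>ennreal\<close> on both sides. Convexity and lower semicontinuity can then be checked for
  each p separately.\<close>

lemma mL_eq_SUP:
  fixes H :: "'a::euclidean_space \<Rightarrow> real"
  assumes bdd: "\<And>v. bdd_above (range (\<lambda>p. p \<bullet> v - H p))" and m: "0 \<le> m"
  shows "mL H m w = (SUP p. ennreal (- (p \<bullet> w) - m * H p))"
proof (rule antisym)
  let ?S = "SUP p. ennreal (- (p \<bullet> w) - m * H p)"
  show "?S \<le> mL H m w"
  proof (rule SUP_least)
    fix p
    show "ennreal (- (p \<bullet> w) - m * H p) \<le> mL H m w"
    proof (cases "m > 0")
      case True
      have "- (p \<bullet> w) - m * H p = m * (p \<bullet> (- ((1 / m) *\<^sub>R w)) - H p)"
        using True by (simp add: field_simps)
      also have "\<dots> \<le> m * Lag H (- ((1 / m) *\<^sub>R w))"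
        using True by (intro mult_left_mono Lag_upper bdd) simp
      finally show ?thesis using True by (simp add: mL_def ennreal_leI)
    next
      case False
      then show ?thesis using m by (auto simp: mL_def)
    qed
  qed
  show "mL H m w \<le> ?S"
  proof (cases "?S = \<infinity>")
    case False
    then obtain s where s: "?S = ennreal s" "0 \<le> s" by (cases ?S) auto
    have le: "- (p \<bullet> w) - m * H p \<le> s" for p
    proof -
      have "ennreal (- (p \<bullet> w) - m * H p) \<le> ?S" by (rule SUP_upper) simp
      then show ?thesis using s by (simp add: ennreal_le_iff)
    qed
    show ?thesis
    proof (cases "m > 0")
      case True
      have "Lag H (- ((1 / m) *\<^sub>R w)) \<le> s / m"
        unfolding Lag_def
      proof (rule cSUP_least)
        fix p
        have "m * (p \<bullet> (- ((1 / m) *\<^sub>R w)) - H p) = - (p \<bullet> w) - m * H p"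
          using True by (simp add: field_simps)
        then have "m * (p \<bullet> (- ((1 / m) *\<^sub>R w)) - H p) \<le> s" using le by simp
        then show "p \<bullet> (- ((1 / m) *\<^sub>R w)) - H p \<le> s / m"
          using True by (simp add: pos_le_divide_eq mult.commute)
      qed simp
      then have "m * Lag H (- ((1 / m) *\<^sub>R w)) \<le> s" using True by (simp add: pos_le_divide_eq mult.commute)
      then show ?thesis using True s by (simp add: mL_def ennreal_leI)
    next
      case F: False
      then have m0: "m = 0" using m by simp
      have "w = 0"
      proof (rule ccontr)
        assume "w \<noteq> 0"
        \<comment> \<open>With this p the affine term at (0, w) exceeds the supposed supremum s by
          1.\<close>
        then have "- ((- ((s + 1) / (w \<bullet> w)) *\<^sub>R w) \<bullet> w) = s + 1" by simp
        then show False using le[of "- ((s + 1) / (w \<bullet> w)) *\<^sub>R w"] m0 by simp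
      qed
      then show ?thesis using m0 by (simp add: mL_def)
    qed
  next
    case True
    then show ?thesis by (simp only: infinity_ennreal_def top_greatest)
  qed
qed

lemma mL_midpoint:
  fixes H :: "'a::euclidean_space \<Rightarrow> real"
  assumes bdd: "\<And>v. bdd_above (range (\<lambda>p. p \<bullet> v - H p))" and m: "0 \<le> m" "0 \<le> m'"
  shows "mL H ((1/2) * (m + m')) ((1/2) *\<^sub>R (w + w')) \<le> ennreal (1/2) * (mL H m w + mL H m' w')"
proof -
  have mid: "0 \<le> (1/2) * (m + m')" using m by simp
  have "ennreal (- (p \<bullet> ((1/2) *\<^sub>R (w + w'))) - (1/2) * (m + m') * H p) \<le> ennreal (1/2) * (mL H m w + mL H m' w')" for p
  proof -
    define a b where "a = - (p \<bullet> w) - m * H p" and "b = - (p \<bullet> w') - m' * H p"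
    \<comment> \<open>\<open>ennreal\<close> takes the positive part, which is subadditive.\<close>
    have ab: "ennreal (a + b) \<le> ennreal a + ennreal b"
    proof -
      have "ennreal (a + b) \<le> ennreal (max a 0 + max b 0)" by (intro ennreal_leI) simp
      also have "\<dots> = ennreal (max a 0) + ennreal (max b 0)" by (intro ennreal_plus) simp_all
      also have "\<dots> = ennreal a + ennreal b" by (simp add: max_def ennreal_neg)
      finally show ?thesis .
    qed
    have "- (p \<bullet> ((1/2) *\<^sub>R (w + w'))) - (1/2) * (m + m') * H p = (1/2) * (a + b)"
      by (simp add: a_def b_def inner_add_right algebra_simps)
    then have "ennreal (- (p \<bullet> ((1/2) *\<^sub>R (w + w'))) - (1/2) * (m + m') * H p) = ennreal (1/2) * ennreal (a + b)"
      by (simp only: ennreal_mult')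
    also have "\<dots> \<le> ennreal (1/2) * (ennreal a + ennreal b)" by (intro mult_left_mono ab) simp
    also have "\<dots> \<le> ennreal (1/2) * (mL H m w + mL H m' w')"
      unfolding mL_eq_SUP[OF bdd m(1)] mL_eq_SUP[OF bdd m(2)] a_def b_def
      by (intro mult_left_mono add_mono SUP_upper2[of p]) simp_all
    finally show ?thesis .
  qed
  then show ?thesis unfolding mL_eq_SUP[OF bdd mid] by (intro SUP_least) simp
qed

lemma mL_lower_semicontinuous:
  fixes H :: "'a::euclidean_space \<Rightarrow> real"
  assumes bdd: "\<And>v. bdd_above (range (\<lambda>p. p \<bullet> v - H p))"
    and m: "\<And>n. 0 \<le> m n" "m \<longlonglongrightarrow> m'" and w: "w \<longlonglongrightarrow> w'"
  shows "mL H m' w' \<le> liminf (\<lambda>n. mL H (m n) (w n))"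
proof -
  have m': "0 \<le> m'" using m by (intro LIMSEQ_le_const[OF m(2)]) auto
  show ?thesis unfolding mL_eq_SUP[OF bdd m']
  proof (rule SUP_least)
    fix p
    have "(\<lambda>n. ennreal (- (p \<bullet> w n) - m n * H p)) \<longlonglongrightarrow> ennreal (- (p \<bullet> w') - m' * H p)"
      by (intro tendsto_intros m w)
    then have "ennreal (- (p \<bullet> w') - m' * H p) = liminf (\<lambda>n. ennreal (- (p \<bullet> w n) - m n * H p))"
      by (intro lim_imp_Liminf[symmetric]) simp_all
    also have "\<dots> \<le> liminf (\<lambda>n. mL H (m n) (w n))"
      unfolding mL_eq_SUP[OF bdd m(1)] by (intro Liminf_mono always_eventually allI SUP_upper) simp
    finally show "ennreal (- (p \<bullet> w') - m' * H p) \<le> liminf (\<lambda>n. mL H (m n) (w n))" .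
  qed
qed

lemma measurable_mL:
  fixes H :: "'a::euclidean_space \<Rightarrow> real"
  assumes bdd: "\<And>v. bdd_above (range (\<lambda>p. p \<bullet> v - H p))"
    and [measurable]: "m \<in> borel_measurable M" "w \<in> borel_measurable M"
  shows "(\<lambda>x. mL H (m x) (w x)) \<in> borel_measurable M"
proof -
  have [measurable]: "Lag H \<in> borel_measurable borel"
    by (intro borel_measurable_continuous_onI convex_on_continuous[OF open_UNIV] convex_on_Lag bdd)
  show ?thesis unfolding mL_def by measurable
qed

lemma measurable_wm_density:
  assumes [measurable]: "m \<in> borel_measurable M" "w \<in> borel_measurable M"
  shows "(\<lambda>x. wm_density g (m x) (w x :: 'a::euclidean_space)) \<in> borel_measurable M"
  unfolding wm_density_def by measurable

lemma wm_density_le_mL: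
  assumes "0 < C" and L: "\<And>v. C * norm v powr g \<le> Lag H v"
  shows "ennreal C * wm_density g m w \<le> mL H m w"
proof (cases "m > 0")
  case True
  have "C * (norm w powr g * m powr (1 - g)) = m * (C * norm (- ((1 / m) *\<^sub>R w)) powr g)"
    using True by (simp add: powr_divide powr_diff)
  also have "\<dots> \<le> m * Lag H (- ((1 / m) *\<^sub>R w))" using True by (intro mult_left_mono L) simp
  finally have "ennreal (C * (norm w powr g * m powr (1 - g))) \<le> ennreal (m * Lag H (- ((1 / m) *\<^sub>R w)))"
    by (rule ennreal_leI)
  then show ?thesis using True assms(1) by (simp add: wm_density_def mL_def ennreal_mult')
qed (auto simp: wm_density_def mL_def)

text \<open>The exponent is the one for which Young's inequality between |w|^g m^(1 - g) and m^q
  eliminates m: with the weights q / (g + q - 1) and (g - 1) / (g + q - 1) the powers of m cancel.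
  Thus the kinetic energy and the L^q bound on m together control w.\<close>

lemma norm_powr_le_wm_density:
  fixes w :: "'a::euclidean_space"
  assumes g: "g > 1" and q: "q > 1" and m: "0 \<le> m"
  shows "ennreal (norm w powr (g * q / (g + q - 1))) \<le> wm_density g m w + ennreal (m powr q)"
proof (cases "m > 0 \<and> w \<noteq> 0")
  case True
  define X \<alpha> \<beta> where "X = norm w powr g * m powr (1 - g)" and "\<alpha> = q / (g + q - 1)" and "\<beta> = (g - 1) / (g + q - 1)"
  have gq: "g + q - 1 > 0" using g q by simp
  have ab: "0 \<le> \<alpha>" "0 \<le> \<beta>" "\<alpha> + \<beta> = 1" using g q gq by (simp_all add: \<alpha>_def \<beta>_def add_divide_distrib[symmetric])
  then have ab1: "\<alpha> \<le> 1" "\<beta> \<le> 1" by linarith+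
  have X: "X > 0" "m powr q > 0" using True by (simp_all add: X_def)
  have "(1 - g) * \<alpha> + q * \<beta> = 0" by (simp add: \<alpha>_def \<beta>_def add_divide_distrib[symmetric] algebra_simps)
  then have "m powr ((1 - g) * \<alpha>) * m powr (q * \<beta>) = 1" using True by (simp add: powr_add[symmetric])
  moreover have "X powr \<alpha> * (m powr q) powr \<beta> = norm w powr (g * \<alpha>) * (m powr ((1 - g) * \<alpha>) * m powr (q * \<beta>))"
    using True by (simp add: X_def powr_mult powr_powr)
  ultimately have "norm w powr (g * \<alpha>) = X powr \<alpha> * (m powr q) powr \<beta>" by simp
  also have "\<dots> \<le> \<alpha> * X + \<beta> * m powr q" by (intro Youngs_inequality_0 ab X)
  also have "\<dots> \<le> X + m powr q"
    using ab1 X by (intro add_mono) (simp_all add: mult_left_le_one_le ab)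
  finally have "ennreal (norm w powr (g * \<alpha>)) \<le> ennreal (X + m powr q)" by (rule ennreal_leI)
  then show ?thesis using True X by (simp add: wm_density_def X_def \<alpha>_def ennreal_plus)
next
  case False
  then show ?thesis using m by (auto simp: wm_density_def)
qed

section \<open>The coupling term\<close>

lemma continuous_on_of_locally_Lipschitz:
  fixes f :: "'a::euclidean_space \<Rightarrow> real \<Rightarrow> real"
  assumes "locally_Lipschitz_f f"
  shows "continuous_on (UNIV \<times> {0..}) (\<lambda>(x, m). f x m)"
  unfolding continuous_on_eq_continuous_within
proof
  fix z :: "'a \<times> real" assume z: "z \<in> UNIV \<times> {0..}"
  then obtain \<rho> C where *: "\<rho> > 0" "C-lipschitz_on (ball z \<rho> \<inter> (UNIV \<times> {0..})) (\<lambda>(x, m). f x m)"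
    using assms unfolding locally_Lipschitz_f_def by meson
  then have "continuous (at z within ball z \<rho> \<inter> (UNIV \<times> {0..})) (\<lambda>(x, m). f x m)"
    using z lipschitz_on_continuous_on[OF *(2)] by (simp add: continuous_on_eq_continuous_within)
  moreover have "at z within ball z \<rho> \<inter> (UNIV \<times> {0..}) = at z within (UNIV \<times> {0..})"
    using *(1) z by (intro at_within_nhd[of z "ball z \<rho>"]) auto
  ultimately show "continuous (at z within UNIV \<times> {0..}) (\<lambda>(x, m). f x m)" by simp
qed

context
  fixes f :: "'a::euclidean_space \<Rightarrow> real \<Rightarrow> real" and C K q :: real
  assumes cont: "continuous_on (UNIV \<times> {0..}) (\<lambda>(x, m). f x m)"
    and C: "C > 0" and K: "K > 0" and q: "q > 1"
    and bound: "\<And>x m. m \<ge> 0 \<Longrightarrow> \<bar>f x m\<bar> \<le> C * m powr (q - 1) + K"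
begin

lemma coupling_integrable: "0 \<le> a \<Longrightarrow> f x integrable_on {a..b}"
proof (rule integrable_continuous_interval)
  assume "0 \<le> a"
  then show "continuous_on {a..b} (f x)"
    using continuous_on_compose2[OF cont, of "{a..b}" "Pair x"]
      continuous_on_Pair[OF continuous_on_const continuous_on_id, of "{a..b}" x]
    by (simp add: id_def image_subset_iff)
qed

lemma abs_Fpot_le:
  assumes "0 \<le> m" shows "\<bar>Fpot f x m\<bar> \<le> C / q * m powr q + K * m"
proof -
  have "((\<lambda>n. n powr (q - 1)) has_integral (m powr q / q)) {0..m}"
    using has_integral_powr_from_0[of "q - 1" m] q assms by simp
  then have "((\<lambda>n. C * n powr (q - 1)) has_integral C * (m powr q / q)) {0..m}"
    by (rule has_integral_mult_right)
  moreover have "((\<lambda>n. K) has_integral (m * K)) {0..m}" using has_integral_const_real[of K 0 m] assms by simp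
  ultimately have "((\<lambda>n. C * n powr (q - 1) + K) has_integral (C * (m powr q / q) + m * K)) {0..m}"
    by (rule has_integral_add)
  then have I: "(\<lambda>n. C * n powr (q - 1) + K) integrable_on {0..m}"
    "integral {0..m} (\<lambda>n. C * n powr (q - 1) + K) = C * (m powr q / q) + m * K"
    by (auto simp: has_integral_iff)
  have "norm (integral {0..m} (f x)) \<le> integral {0..m} (\<lambda>n. C * n powr (q - 1) + K)"
    using bound by (intro Henstock_Kurzweil_Integration.integral_norm_bound_integral coupling_integrable I) auto
  then show ?thesis unfolding Fpot_def I(2) by (simp add: mult.commute)
qed

lemma Fpot_lipschitz:
  assumes "a \<in> {0..B}" "b \<in> {0..B}"
  shows "\<bar>Fpot f x a - Fpot f x b\<bar> \<le> (C * B powr (q - 1) + K) * \<bar>a - b\<bar>"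
proof -
  have le: "\<bar>Fpot f x b - Fpot f x a\<bar> \<le> (C * B powr (q - 1) + K) * (b - a)" if ab: "0 \<le> a" "a \<le> b" "b \<le> B" for a b
  proof -
    have "Fpot f x b - Fpot f x a = integral {a..b} (f x)"
      unfolding Fpot_def using Henstock_Kurzweil_Integration.integral_combine[of 0 a b "f x"] ab coupling_integrable[of 0 x b] by simp
    moreover have "norm (integral {a..b} (f x)) \<le> integral {a..b} (\<lambda>n. C * B powr (q - 1) + K)"
    proof (rule Henstock_Kurzweil_Integration.integral_norm_bound_integral)
      fix n assume n: "n \<in> {a..b}"
      then have "\<bar>f x n\<bar> \<le> C * n powr (q - 1) + K" using ab by (intro bound) simp
      also have "\<dots> \<le> C * B powr (q - 1) + K"
        using n ab q C by (intro add_mono mult_left_mono powr_mono2) auto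
      finally show "norm (f x n) \<le> C * B powr (q - 1) + K" by simp
    qed (use ab coupling_integrable in auto)
    ultimately show ?thesis using ab by (simp add: mult.commute)
  qed
  show ?thesis
  proof (cases "a \<le> b")
    case True then show ?thesis using le[of a b] assms by (simp add: abs_minus_commute)
  next
    case False then show ?thesis using le[of b a] assms by simp
  qed
qed

text \<open>Rescaling moves m from the domain of integration into the integrand, where the
  continuity of parameter integrals applies. Joint continuity in (x, m) makes \<open>Fpot\<close>
  measurable along a function h of x.\<close>

lemma Fpot_eq_unit_interval:
  assumes "0 \<le> m" shows "Fpot f x m = integral (cbox 0 1) (\<lambda>t. m * f x (m * t))"
proof (cases "m = 0")
  case False
  then have m: "0 < m" using assms by simp
  have "(f x has_integral Fpot f x m) {0..m}"
    unfolding Fpot_def by (rule integrable_integral[OF coupling_integrable]) simp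
  from has_integral_stretch_real[OF this False]
  have "((\<lambda>t. f x (m * t)) has_integral (1 / m * Fpot f x m)) ((\<lambda>t. t / m) ` {0..m})" using m by simp
  moreover have "(\<lambda>t. t / m) ` {0..m} = {0..1}"
    using image_divide_atLeastAtMost[of m 0 m] m by simp
  ultimately have "((\<lambda>t. m * f x (m * t)) has_integral (m * (1 / m * Fpot f x m))) {0..1}"
    using has_integral_mult_right by metis
  then show ?thesis using m by (simp add: has_integral_iff)
qed (simp add: Fpot_def)

lemma continuous_on_Fpot: "continuous_on (UNIV \<times> {0..}) (\<lambda>(x, m). Fpot f x m)"
proof -
  have "continuous_on ((UNIV \<times> {0..}) \<times> cbox 0 1) (\<lambda>(z, t). snd z * f (fst z) (snd z * t))"
    unfolding case_prod_beta
    by (intro continuous_intros continuous_on_compose2[OF cont[unfolded case_prod_beta],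
          of _ "\<lambda>p. (fst (fst p), snd (fst p) * snd p)", simplified]) auto
  from integral_continuous_on_param[OF this]
  have "continuous_on (UNIV \<times> {0..}) (\<lambda>z. integral (cbox 0 1) (\<lambda>t. snd z * f (fst z) (snd z * t)))" .
  then show ?thesis
    by (rule continuous_on_eq) (auto simp: Fpot_eq_unit_interval)
qed

lemma measurable_Fpot:
  assumes idm: "(\<lambda>x. x) \<in> borel_measurable M" and h: "h \<in> borel_measurable M" "\<And>x. 0 \<le> h x"
  shows "(\<lambda>x. Fpot f x (h x)) \<in> borel_measurable M"
proof -
  have "(\<lambda>(x, m). Fpot f x m) \<in> borel_measurable (restrict_space borel (UNIV \<times> {0..}))"
    by (rule borel_measurable_continuous_on_restrict[OF continuous_on_Fpot])
  moreover have "(\<lambda>x. (x, h x)) \<in> M \<rightarrow>\<^sub>M restrict_space borel (UNIV \<times> {0..})"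
    using h idm by (intro measurable_restrict_space2 borel_measurable_Pair) auto
  ultimately have "(\<lambda>x. (\<lambda>(x, m). Fpot f x m) (x, h x)) \<in> borel_measurable M"
    by (rule measurable_compose[rotated])
  then show ?thesis by simp
qed

end

text \<open>Convexity of t^q with weights l and 1 - l at the points |a| / l and |b| / (1 - l). The
  factor of |a|^q tends to 1 as l tends to 1; this freedom lets a strict bound on an L^q norm
  survive small perturbations.\<close>

lemma abs_add_powr_le:
  fixes a b l q :: real
  assumes l: "0 < l" "l < 1" and q: "1 \<le> q"
  shows "\<bar>a + b\<bar> powr q \<le> l powr (1 - q) * \<bar>a\<bar> powr q + (1 - l) powr (1 - q) * \<bar>b\<bar> powr q"
proof -
  define x y c where "x = \<bar>a\<bar> / l" and "y = \<bar>b\<bar> / (1 - l)" and "c = \<bar>a\<bar> + \<bar>b\<bar>"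
  have nn: "0 \<le> x" "0 \<le> y" "0 \<le> c" using l by (simp_all add: x_def y_def c_def)
  have xy: "l * x = \<bar>a\<bar>" "(1 - l) * y = \<bar>b\<bar>" using l by (simp_all add: x_def y_def)
  have "\<bar>a + b\<bar> powr q \<le> c powr q" using q by (intro powr_mono2) (simp_all add: c_def abs_triangle_ineq)
  also have "c powr q = (1 - q) * c powr q + q * (c powr (q - 1) * c)"
    using nn(3) by (cases "c = 0") (auto simp: powr_diff left_diff_distrib)
  also have "\<dots> = l * ((1 - q) * c powr q + q * c powr (q - 1) * x) + (1 - l) * ((1 - q) * c powr q + q * c powr (q - 1) * y)"
  proof -
    have "c = l * x + (1 - l) * y" by (simp add: c_def xy)
    then have "q * (c powr (q - 1) * c) = q * (c powr (q - 1) * (l * x + (1 - l) * y))" by simp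
    then show ?thesis by (simp add: algebra_simps)
  qed
  also have "\<dots> \<le> l * x powr q + (1 - l) * y powr q"
    using l nn q by (intro add_mono mult_left_mono powr_tangent) simp_all
  also have "\<dots> = l powr (1 - q) * \<bar>a\<bar> powr q + (1 - l) powr (1 - q) * \<bar>b\<bar> powr q"
    using l by (simp add: x_def y_def powr_divide powr_diff)
  finally show ?thesis .
qed

section \<open>Gradients of smooth functions\<close>

lemma gradient_partial:
  assumes "is_gradient u D"
  shows "((\<lambda>t. u (x + t *\<^sub>R b)) has_real_derivative (D x \<bullet> b)) (at 0)"
proof -
  have "((\<lambda>t::real. x + t *\<^sub>R b) has_derivative (\<lambda>t. t *\<^sub>R b)) (at 0)"
    by (auto intro!: derivative_eq_intros)
  moreover have "(u has_derivative (\<lambda>h. D x \<bullet> h)) (at (x + 0 *\<^sub>R b))"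
    using assms by (simp add: is_gradient_def)
  ultimately have "((\<lambda>t. u (x + t *\<^sub>R b)) has_derivative (\<lambda>t. D x \<bullet> (t *\<^sub>R b))) (at 0)"
    by (rule has_derivative_compose)
  then show ?thesis by (simp add: has_field_derivative_def mult.commute[of "D x \<bullet> b"] mult_commute_abs)
qed

text \<open>The components of a gradient are partial derivatives, and these are continuous by the
  first-order case of \<open>Ck\<close>.\<close>

lemma smooth_gradient_continuous:
  fixes u :: "'a::euclidean_space \<Rightarrow> real"
  assumes "smooth u" "is_gradient u D"
  shows "continuous_on UNIV D"
proof (subst continuous_on_componentwise, rule ballI)
  fix b :: 'a assume b: "b \<in> Basis"
  have "Ck (Suc 0) u" using assms(1) by (simp only: smooth_def)
  then obtain g where g: "\<forall>x. ((\<lambda>t. u (x + t *\<^sub>R b)) has_real_derivative g x) (at 0)" "continuous_on UNIV g"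
    using b by auto
  have "D x \<bullet> b = g x" for x
    by (rule DERIV_unique[OF gradient_partial[OF assms(2)] g(1)[rule_format]])
  then show "continuous_on UNIV (\<lambda>x. D x \<bullet> b)" using g(2) by simp
qed

lemma smooth_continuous: "smooth u \<Longrightarrow> continuous_on UNIV u"
  unfolding smooth_def by (metis Ck.simps(1))

lemma continuous_bounded_on_bounded:
  fixes D :: "'a::euclidean_space \<Rightarrow> 'b::real_normed_vector"
  assumes "continuous_on UNIV D" "bounded S"
  obtains B where "0 \<le> B" "\<forall>x\<in>S. norm (D x) \<le> B"
proof -
  have "bounded (D ` closure S)"
    using assms by (intro compact_imp_bounded compact_continuous_image continuous_on_subset[OF assms(1)]) auto
  then obtain B where "\<forall>y\<in>D ` closure S. norm y \<le> B" unfolding bounded_iff by blast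
  then have "\<forall>x\<in>S. norm (D x) \<le> max B 0" using closure_subset[of S] by (auto simp: le_max_iff_disj)
  then show ?thesis by (intro that[of "max B 0"]) auto
qed

lemma gradient_zero_outside_support:
  assumes "is_gradient u D" "x \<notin> closure {x. u x \<noteq> 0}"
  shows "D x = 0"
proof -
  have "(u has_derivative (\<lambda>h. 0)) (at x)"
    by (rule has_derivative_transform_within_open[of "\<lambda>x. 0" _ _ _ "- closure {x. u x \<noteq> 0}"])
       (use assms(2) closure_subset[of "{x. u x \<noteq> 0}"] in auto)
  then have "(\<lambda>h. D x \<bullet> h) = (\<lambda>h. 0)"
    using assms(1) has_derivative_unique unfolding is_gradient_def by blast
  then show ?thesis by (metis inner_eq_zero_iff)
qed

lemma gradient_increment_le:
  fixes u :: "'a::euclidean_space \<Rightarrow> real"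
  assumes "is_gradient u D" "\<And>x. norm (D x) \<le> B"
  shows "\<bar>u (x + h) - u x\<bar> \<le> B * norm h"
proof -
  have "norm (u (x + h) - u x) \<le> B * norm (x + h - x)"
  proof (rule differentiable_bound[of UNIV u "\<lambda>x h. D x \<bullet> h"])
    show "onorm ((\<bullet>) (D x)) \<le> B" for x
    proof (rule onorm_le)
      fix h show "norm (D x \<bullet> h) \<le> B * norm h"
        using Cauchy_Schwarz_ineq2[of "D x" h] mult_right_mono[OF assms(2)[of x] norm_ge_zero[of h]] by simp
    qed
  qed (use assms(1) in \<open>auto simp: is_gradient_def\<close>)
  then show ?thesis by simp
qed

text \<open>By translation invariance the integrals of the difference quotients of a test function vanish.\<close>

lemma integral_gradient_eq_0:
  fixes u :: "'a::euclidean_space \<Rightarrow> real"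
  assumes u: "smooth u" "is_gradient u D" and supp: "compact (closure {x. u x \<noteq> 0})"
  shows "integral\<^sup>L lborel D = 0"
proof (rule euclidean_eqI)
  fix b :: 'a assume b: "b \<in> Basis"
  let ?K = "closure {x. u x \<noteq> 0}"
  have uc: "continuous_on UNIV u" and Dc: "continuous_on UNIV D"
    using u by (simp_all add: smooth_continuous smooth_gradient_continuous)
  have um: "u \<in> borel_measurable borel" and Dm: "D \<in> borel_measurable borel"
    using uc Dc by (simp_all add: borel_measurable_continuous_onI)
  obtain R where R: "\<forall>x\<in>?K. norm x \<le> R" using supp compact_imp_bounded bounded_iff by blast
  obtain B where B: "0 \<le> B" "\<forall>x\<in>?K. norm (D x) \<le> B"
    by (rule continuous_bounded_on_bounded[OF Dc compact_imp_bounded[OF supp]])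
  have D0: "D x = 0" if "x \<notin> ?K" for x by (rule gradient_zero_outside_support[OF u(2) that])
  have BD: "norm (D x) \<le> B" for x using B D0 by (cases "x \<in> ?K") auto
  have u0: "u x = 0" if "x \<notin> ?K" for x
    using that closure_subset[of "{x. u x \<noteq> 0}"] by (simp add: subset_iff) metis
  have int_ind: "integrable lborel (\<lambda>x. indicator (cball 0 (R + 1)) x *\<^sub>R v x)"
    if "continuous_on UNIV v" for v :: "'a \<Rightarrow> 'b::euclidean_space"
    by (intro borel_integrable_compact compact_cball continuous_on_subset[OF that]) auto
  have ui: "integrable lborel u"
  proof -
    have "(\<lambda>x. indicator (cball 0 (R + 1)) x *\<^sub>R u x) = u"
    proof
      fix x show "indicator (cball 0 (R + 1)) x *\<^sub>R u x = u x"
        using u0[of x] R by (cases "x \<in> ?K") (auto simp: indicator_def intro: order_trans)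
    qed
    with int_ind[OF uc] show ?thesis by simp
  qed
  have Di: "integrable lborel D"
  proof -
    have "(\<lambda>x. indicator (cball 0 (R + 1)) x *\<^sub>R D x) = D"
    proof
      fix x show "indicator (cball 0 (R + 1)) x *\<^sub>R D x = D x"
        using D0[of x] R by (cases "x \<in> ?K") (auto simp: indicator_def intro: order_trans)
    qed
    with int_ind[OF Dc] show ?thesis by simp
  qed
  have shift: "integrable lborel (\<lambda>x. u (x + c))" "(\<integral>x. u (x + c) \<partial>lborel) = (\<integral>x. u x \<partial>lborel)" for c
  proof -
    have *: "(+) c \<in> borel_measurable borel" by simp
    show "integrable lborel (\<lambda>x. u (x + c))"
      using ui integrable_distr_eq[of "(+) c" lborel borel u] um by (simp add: lborel_distr_plus add.commute)
    show "(\<integral>x. u (x + c) \<partial>lborel) = (\<integral>x. u x \<partial>lborel)"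
      using integral_distr[of "(+) c" lborel borel u] um by (simp add: lborel_distr_plus add.commute)
  qed
  \<comment> \<open>Increments of length at most 1 keep all difference quotients at 0 outside the
    ball of radius R + 1, which carries the dominating function.\<close>
  define h where "h n = inverse (real (Suc n))" for n
  have h: "0 < h n" "h n \<le> 1" for n by (simp_all add: h_def field_simps)
  have h0: "h \<longlonglongrightarrow> 0" unfolding h_def by (rule LIMSEQ_inverse_real_of_nat)
  define d where "d n x = (u (x + h n *\<^sub>R b) - u x) / h n" for n x
  have "(\<lambda>n. \<integral>x. d n x \<partial>lborel) \<longlonglongrightarrow> (\<integral>x. D x \<bullet> b \<partial>lborel)"
  proof (rule integral_dominated_convergence[where w="\<lambda>x. indicator (cball 0 (R + 1)) x *\<^sub>R B"])
    show "(\<lambda>x. D x \<bullet> b) \<in> borel_measurable lborel" using Dm by simp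
    show "d n \<in> borel_measurable lborel" for n
      unfolding d_def using um by (intro borel_measurable_divide borel_measurable_diff) (auto intro: measurable_compose[OF _ um])
    show "integrable lborel (\<lambda>x::'a. indicator (cball 0 (R + 1)) x *\<^sub>R B)" by (rule int_ind) simp
    show "AE x in lborel. (\<lambda>n. d n x) \<longlonglongrightarrow> D x \<bullet> b"
    proof (rule AE_I2)
      fix x
      have "((\<lambda>t. (u (x + t *\<^sub>R b) - u x) / t) \<longlongrightarrow> D x \<bullet> b) (at 0)"
        using gradient_partial[OF u(2), of x b] by (simp add: DERIV_def)
      moreover have "filterlim h (at 0) sequentially"
        using h0 h(1) by (auto simp: filterlim_at intro!: always_eventually) (metis less_irrefl)
      ultimately show "(\<lambda>n. d n x) \<longlonglongrightarrow> D x \<bullet> b"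
        unfolding d_def by (rule filterlim_compose)
    qed
    show "AE x in lborel. norm (d n x) \<le> indicator (cball 0 (R + 1)) x *\<^sub>R B" for n
    proof (rule AE_I2)
      fix x
      have nb: "norm (h n *\<^sub>R b) = h n" using b h(1)[of n] by simp
      show "norm (d n x) \<le> indicator (cball 0 (R + 1)) x *\<^sub>R B"
      proof (cases "norm x \<le> R + 1")
        case True
        have "\<bar>u (x + h n *\<^sub>R b) - u x\<bar> \<le> B * h n" using gradient_increment_le[OF u(2) BD, of x "h n *\<^sub>R b"] nb by simp
        then have "norm (d n x) \<le> B" using h(1)[of n] by (simp add: d_def field_simps)
        then show ?thesis using True by simp
      next
        case False
        have "norm x \<le> norm (x + h n *\<^sub>R b) + norm (h n *\<^sub>R b)" using norm_triangle_ineq4[of "x + h n *\<^sub>R b" "h n *\<^sub>R b"] by simp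
        then have "R < norm (x + h n *\<^sub>R b)" using False h(2)[of n] nb by linarith
        then have "u (x + h n *\<^sub>R b) = 0" "u x = 0" using False R by (auto intro!: u0 dest!: bspec)
        then show ?thesis using B by (simp add: d_def)
      qed
    qed
  qed
  moreover have "(\<integral>x. d n x \<partial>lborel) = 0" for n
    unfolding d_def using shift[of "h n *\<^sub>R b"] ui by simp
  ultimately have "(\<integral>x. D x \<bullet> b \<partial>lborel) = 0" by (simp add: LIMSEQ_const_iff)
  then show "integral\<^sup>L lborel D \<bullet> b = 0 \<bullet> b" using integral_inner_left[OF Di, of b] by simp
qed

section \<open>Lebesgue spaces and the constraint set\<close>

lemma lp_pow_eq:
  assumes "S \<in> sets lebesgue"
  shows "lp_pow S p u = powr_integral (lebesgue_on S) p u"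
  using assms by (simp add: lp_pow_def nn_integral_restrict_space mult.commute)

lemma norm_midpoint_powr_le:
  fixes a b :: "'b::real_normed_vector"
  assumes "1 \<le> p"
  shows "norm ((1/2) *\<^sub>R (a + b)) powr p \<le> (1/2) * (norm a powr p + norm b powr p)"
proof -
  have "norm ((1/2) *\<^sub>R (a + b)) powr p \<le> \<bar>norm a / 2 + norm b / 2\<bar> powr p"
    using assms norm_triangle_ineq[of a b] by (intro powr_mono2) auto
  also have "\<dots> \<le> (1/2) powr (1 - p) * \<bar>norm a / 2\<bar> powr p + (1 - 1/2) powr (1 - p) * \<bar>norm b / 2\<bar> powr p"
    by (rule abs_add_powr_le) (use assms in auto)
  also have "\<dots> = (1/2) * (norm a powr p + norm b powr p)"
  proof -
    have "(1/2) powr (1 - p) * (t / 2) powr p = (1/2) * t powr p" if "0 \<le> t" for t :: real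
      using that by (simp add: powr_divide powr_diff)
    from this[of "norm a"] this[of "norm b"] show ?thesis by (simp add: distrib_left)
  qed
  finally show ?thesis .
qed

lemma ennreal_half_add: "ennreal (1/2) * (c + c) = c"
proof -
  have "ennreal (1/2) * (c + c) = (ennreal (1/2) * 2) * c" by (simp only: mult_2[symmetric] mult.assoc)
  also have "ennreal (1/2) * 2 = 1" using ennreal_mult[of "1/2" 2] by simp
  finally show ?thesis by simp
qed

lemma nn_integral_midpoint_powr_le:
  fixes u v :: "'a \<Rightarrow> 'b::{real_normed_vector, second_countable_topology}"
  assumes [measurable]: "u \<in> borel_measurable M" "v \<in> borel_measurable M" and p: "1 \<le> p"
    and "powr_integral M p u \<le> c" "powr_integral M p v \<le> c"
  shows "(\<integral>\<^sup>+x. ennreal (norm ((1/2) *\<^sub>R (u x + v x)) powr p) \<partial>M) \<le> c"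
proof -
  have "(\<integral>\<^sup>+x. ennreal (norm ((1/2) *\<^sub>R (u x + v x)) powr p) \<partial>M)
      \<le> (\<integral>\<^sup>+x. ennreal (1/2) * (ennreal (norm (u x) powr p) + ennreal (norm (v x) powr p)) \<partial>M)"
  proof (rule nn_integral_mono)
    fix x
    have "ennreal (norm ((1/2) *\<^sub>R (u x + v x)) powr p) \<le> ennreal ((1/2) * (norm (u x) powr p + norm (v x) powr p))"
      by (intro ennreal_leI norm_midpoint_powr_le p)
    also have "\<dots> = ennreal (1/2) * (ennreal (norm (u x) powr p) + ennreal (norm (v x) powr p))"
      by (subst ennreal_mult) (simp_all add: ennreal_plus)
    finally show "ennreal (norm ((1/2) *\<^sub>R (u x + v x)) powr p)
      \<le> ennreal (1/2) * (ennreal (norm (u x) powr p) + ennreal (norm (v x) powr p))" .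
  qed
  also have "\<dots> = ennreal (1/2) * (powr_integral M p u + powr_integral M p v)"
    by (subst nn_integral_cmult) (simp_all add: nn_integral_add)
  also have "\<dots> \<le> ennreal (1/2) * (c + c)" using assms by (intro mult_left_mono add_mono) simp_all
  also have "\<dots> = c" by (rule ennreal_half_add)
  finally show ?thesis .
qed

lemma memLp_iff:
  assumes "S \<in> sets lebesgue"
  shows "memLp S p u \<longleftrightarrow> u \<in> borel_measurable (lebesgue_on S) \<and>
    powr_integral (lebesgue_on S) p u < \<infinity>"
  by (simp add: memLp_def lp_pow_eq[OF assms])

lemma (in finite_measure) integrable_of_powr:
  fixes u :: "'a \<Rightarrow> 'b::{banach, second_countable_topology}"
  assumes u: "u \<in> borel_measurable M" and p: "1 \<le> p" and fin: "powr_integral M p u < \<infinity>"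
  shows "integrable M u" "integrable M (\<lambda>x. norm (u x) powr p)"
proof -
  show i: "integrable M (\<lambda>x. norm (u x) powr p)"
    using u fin by (intro integrableI_bounded) auto
  show "integrable M u"
  proof (rule Bochner_Integration.integrable_bound[of _ "\<lambda>x. 1 + norm (u x) powr p"])
    show "AE x in M. norm (u x) \<le> norm (1 + norm (u x) powr p)"
    proof (rule AE_I2)
      fix x
      show "norm (u x) \<le> norm (1 + norm (u x) powr p)"
      proof (cases "norm (u x) \<le> 1")
        case False
        then have "norm (u x) powr 1 \<le> norm (u x) powr p" using p by (intro powr_mono) auto
        then show ?thesis using False by simp
      qed (simp add: add_increasing2)
    qed
  qed (use i u in auto)
qed

text \<open>The weak gradient is carried along as data, which makes the constraints stable under convex combinations
  and limits. By uniqueness of weak gradients, the condition for all \<open>G\<close> in \<open>Kset\<close> is a condition on one.\<close>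

definition flow_triple :: "'a::euclidean_space set \<Rightarrow> ('a \<Rightarrow> real) \<Rightarrow> ('a \<Rightarrow> 'a) \<Rightarrow> ('a \<Rightarrow> 'a) \<Rightarrow> bool" where
  "flow_triple \<Omega> m w G \<longleftrightarrow>
     integrable (lebesgue_on \<Omega>) m \<and> integrable (lebesgue_on \<Omega>) w \<and> integrable (lebesgue_on \<Omega>) G \<and>
     weak_grad \<Omega> m G \<and>
     (\<forall>phi Dphi. smooth phi \<and> is_gradient phi Dphi \<longrightarrow>
        (LINT x|lebesgue_on \<Omega>. G x \<bullet> Dphi x) = (LINT x|lebesgue_on \<Omega>. w x \<bullet> Dphi x)) \<and>
     (LINT x|lebesgue_on \<Omega>. m x) = 1 \<and> (AE x in lebesgue_on \<Omega>. 0 \<le> m x)"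

lemma Kset_iff_flow_triple:
  fixes \<Omega> :: "'a::euclidean_space set"
  assumes \<Omega>: "open \<Omega>" "\<Omega> \<in> lmeasurable" and s: "1 \<le> s"
  shows "(m, w) \<in> Kset \<Omega> s s \<longleftrightarrow> memLp \<Omega> s m \<and> memLp \<Omega> s w \<and> (\<exists>G. memLp \<Omega> s G \<and> flow_triple \<Omega> m w G)"
proof -
  have S: "\<Omega> \<in> sets lebesgue" using \<Omega> by auto
  interpret finite_measure "lebesgue_on \<Omega>" using \<Omega>(2) by (rule finite_measure_lebesgue_on)
  have int: "integrable (lebesgue_on \<Omega>) u" if "memLp \<Omega> s u" for u :: "'a \<Rightarrow> 'b::{banach, second_countable_topology}"
    using that s by (intro integrable_of_powr(1)[of u s]) (auto simp: memLp_iff[OF S])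
  have AEiff: "(AE x in lebesgue. x \<in> \<Omega> \<longrightarrow> 0 \<le> m x) \<longleftrightarrow> (AE x in lebesgue_on \<Omega>. 0 \<le> m x)"
    using S by (simp add: AE_restrict_space_iff)
  show ?thesis
  proof
    assume K: "(m, w) \<in> Kset \<Omega> s s"
    then obtain G where G: "weak_grad \<Omega> m G" "memLp \<Omega> s G" by (auto simp: Kset_def sobolev1_def)
    with K show "memLp \<Omega> s m \<and> memLp \<Omega> s w \<and> (\<exists>G. memLp \<Omega> s G \<and> flow_triple \<Omega> m w G)"
      by (auto simp: Kset_def sobolev1_def flow_triple_def int AEiff set_lebesgue_integral_eq_lebesgue_on[OF S])
  next
    assume R: "memLp \<Omega> s m \<and> memLp \<Omega> s w \<and> (\<exists>G. memLp \<Omega> s G \<and> flow_triple \<Omega> m w G)"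
    then obtain G where G: "memLp \<Omega> s G" "flow_triple \<Omega> m w G" by blast
    have mi: "integrable (lebesgue_on \<Omega>) m" and wG: "weak_grad \<Omega> m G"
      using G(2) by (simp_all add: flow_triple_def)
    have m1: "memLp \<Omega> 1 m"
      using mi by (auto simp: memLp_iff[OF S] integrable_iff_bounded)
    \<comment> \<open>Any other weak gradient G' agrees with G almost everywhere, so the equation
      passes from G to G'.\<close>
    have all: "(LINT x:\<Omega>|lebesgue. G' x \<bullet> Dphi x) = (LINT x:\<Omega>|lebesgue. w x \<bullet> Dphi x)"
      if G': "weak_grad \<Omega> m G'" "memLp \<Omega> s G'" and phi: "smooth phi" "is_gradient phi Dphi" for G' phi Dphi
    proof -
      have eq: "AE x in lebesgue_on \<Omega>. G' x = G x"
        by (rule weak_grad_unique[OF \<Omega>(1) G'(1) wG int[OF G'(2)] int[OF G(1)]])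
      have Dm: "Dphi \<in> borel_measurable (lebesgue_on \<Omega>)"
        by (intro measurable_restrict_space1 measurable_completion)
           (simp add: borel_measurable_continuous_onI[OF smooth_gradient_continuous[OF phi]])
      have "(LINT x|lebesgue_on \<Omega>. G' x \<bullet> Dphi x) = (LINT x|lebesgue_on \<Omega>. G x \<bullet> Dphi x)"
        using eq Dm int[OF G'(2)] int[OF G(1)]
        by (intro integral_cong_AE borel_measurable_inner) (auto elim: eventually_mono)
      also have "\<dots> = (LINT x|lebesgue_on \<Omega>. w x \<bullet> Dphi x)"
        using G(2) phi by (simp add: flow_triple_def)
      finally show ?thesis by (simp add: set_lebesgue_integral_eq_lebesgue_on[OF S])
    qed
    have rest: "(LINT x|lebesgue_on \<Omega>. m x) = 1" "AE x in lebesgue_on \<Omega>. 0 \<le> m x"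
      using G(2) by (simp_all add: flow_triple_def)
    have sob: "sobolev1 \<Omega> s m" unfolding sobolev1_def using R wG G(1) by blast
    have all': "\<forall>G. weak_grad \<Omega> m G \<and> memLp \<Omega> s G \<longrightarrow> (\<forall>phi Dphi. smooth phi \<and> is_gradient phi Dphi \<longrightarrow>
        (LINT x:\<Omega>|lebesgue. G x \<bullet> Dphi x) = (LINT x:\<Omega>|lebesgue. w x \<bullet> Dphi x))"
      by (intro allI impI, elim conjE) (rule all)
    have one: "(LINT x:\<Omega>|lebesgue. m x) = 1"
      using rest(1) by (simp add: set_lebesgue_integral_eq_lebesgue_on[OF S])
    show "(m, w) \<in> Kset \<Omega> s s"
      unfolding Kset_def using R m1 sob one rest(2)[folded AEiff] all' by simp
  qed
qed

text \<open>Stated for bilinear maps so that one argument serves the products of m with the gradient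
  of a test function, of a test function with G, and the inner products in the divergence
  equation.\<close>

lemma integrable_bilinear:
  fixes pr :: "'b::euclidean_space \<Rightarrow> 'c::euclidean_space \<Rightarrow> 'd::euclidean_space"
  assumes pr: "bounded_bilinear pr"
    and u: "integrable M u" and D: "D \<in> borel_measurable M" "\<forall>x\<in>space M. norm (D x) \<le> B"
  shows "integrable M (\<lambda>x. pr (u x) (D x))"
proof -
  interpret bounded_bilinear pr by (rule pr)
  obtain K where K: "0 \<le> K" "\<And>a b. norm (pr a b) \<le> norm a * norm b * K" using nonneg_bounded by blast
  show ?thesis
  proof (rule Bochner_Integration.integrable_bound[of _ "\<lambda>x. B * K * norm (u x)"])
    show "(\<lambda>x. pr (u x) (D x)) \<in> borel_measurable M"
      using u D(1) by (intro borel_measurable_continuous_Pair[where H=pr] continuous_on continuous_intros) auto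
    show "AE x in M. norm (pr (u x) (D x)) \<le> norm (B * K * norm (u x))"
    proof (rule AE_I2)
      fix x assume x: "x \<in> space M"
      have "norm (pr (u x) (D x)) \<le> norm (u x) * norm (D x) * K" by (rule K)
      also have "\<dots> \<le> norm (u x) * B * K" using D(2) x K(1) by (intro mult_left_mono mult_right_mono) auto
      also have "\<dots> \<le> norm (B * K * norm (u x))" by (simp add: ac_simps)
      finally show "norm (pr (u x) (D x)) \<le> norm (B * K * norm (u x))" .
    qed
  qed (use u in auto)
qed

lemma tendsto_integral_bilinear:
  fixes pr :: "'b::euclidean_space \<Rightarrow> 'c::euclidean_space \<Rightarrow> 'd::euclidean_space"
  assumes pr: "bounded_bilinear pr"
    and u: "\<And>n. integrable M (u n)" "integrable M v" and D: "D \<in> borel_measurable M" "\<forall>x\<in>space M. norm (D x) \<le> B"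
    and lim: "(\<lambda>n. \<integral>x. norm (u n x - v x) \<partial>M) \<longlonglongrightarrow> 0"
  shows "(\<lambda>n. \<integral>x. pr (u n x) (D x) \<partial>M) \<longlonglongrightarrow> (\<integral>x. pr (v x) (D x) \<partial>M)"
proof -
  interpret bounded_bilinear pr by (rule pr)
  obtain K where K: "0 \<le> K" "\<And>a b. norm (pr a b) \<le> norm a * norm b * K" using nonneg_bounded by blast
  have "(\<lambda>n. (\<integral>x. pr (u n x) (D x) \<partial>M) - (\<integral>x. pr (v x) (D x) \<partial>M)) \<longlonglongrightarrow> 0"
  proof (rule Lim_null_comparison)
    show "(\<lambda>n. B * K * (\<integral>x. norm (u n x - v x) \<partial>M)) \<longlonglongrightarrow> 0" using tendsto_mult_right_zero[OF lim] .
    show "\<forall>\<^sub>F n in sequentially. norm ((\<integral>x. pr (u n x) (D x) \<partial>M) - (\<integral>x. pr (v x) (D x) \<partial>M))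
        \<le> B * K * (\<integral>x. norm (u n x - v x) \<partial>M)"
    proof (intro always_eventually allI)
      fix n
      have diff_i: "integrable M (\<lambda>x. u n x - v x)" using u by simp
      have "(\<integral>x. pr (u n x) (D x) \<partial>M) - (\<integral>x. pr (v x) (D x) \<partial>M) = (\<integral>x. pr (u n x - v x) (D x) \<partial>M)"
        using integrable_bilinear[OF pr u(1) D] integrable_bilinear[OF pr u(2) D] by (simp add: diff_left)
      also have "norm \<dots> \<le> (\<integral>x. B * K * norm (u n x - v x) \<partial>M)"
      proof (rule order_trans[OF integral_norm_bound integral_mono])
        fix x assume x: "x \<in> space M"
        have "norm (pr (u n x - v x) (D x)) \<le> norm (u n x - v x) * norm (D x) * K" by (rule K)
        also have "\<dots> \<le> norm (u n x - v x) * B * K" using D(2) x K(1) by (intro mult_left_mono mult_right_mono) auto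
        finally show "norm (pr (u n x - v x) (D x)) \<le> B * K * norm (u n x - v x)" by (simp add: ac_simps)
      qed (use diff_i integrable_bilinear[OF pr diff_i D] in auto)
      finally show "norm ((\<integral>x. pr (u n x) (D x) \<partial>M) - (\<integral>x. pr (v x) (D x) \<partial>M))
        \<le> B * K * (\<integral>x. norm (u n x - v x) \<partial>M)" by simp
    qed
  qed
  then show ?thesis by (simp add: LIM_zero_iff)
qed

lemma bounded_bilinear_scaleR_flip: "bounded_bilinear (\<lambda>(v::'a::real_normed_vector) c. c *\<^sub>R v)"
  by (rule bounded_bilinear.flip[OF bounded_bilinear_scaleR])

lemma continuous_measurable_lebesgue_on:
  "continuous_on UNIV u \<Longrightarrow> u \<in> borel_measurable (lebesgue_on S)"
  for u :: "'a::euclidean_space \<Rightarrow> 'b::{second_countable_topology, topological_space}"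
  by (intro measurable_restrict_space1 measurable_completion) (simp add: borel_measurable_continuous_onI)

context
  fixes \<Omega> :: "'a::euclidean_space set"
  assumes bounded: "bounded \<Omega>" and S: "\<Omega> \<in> sets lebesgue"
begin

lemma weak_grad_iff:
  "weak_grad \<Omega> m G \<longleftrightarrow> (\<forall>phi Dphi. smooth phi \<and> is_gradient phi Dphi \<and>
      compact (closure {x. phi x \<noteq> 0}) \<and> closure {x. phi x \<noteq> 0} \<subseteq> \<Omega> \<longrightarrow>
      (LINT x|lebesgue_on \<Omega>. m x *\<^sub>R Dphi x) = - (LINT x|lebesgue_on \<Omega>. phi x *\<^sub>R G x))"
  by (simp only: weak_grad_def set_lebesgue_integral_eq_lebesgue_on[OF S])

lemma continuous_bounded_on_domain:
  fixes D :: "'a \<Rightarrow> 'b::real_normed_vector"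
  assumes "continuous_on UNIV D"
  obtains B where "\<forall>x\<in>space (lebesgue_on \<Omega>). norm (D x) \<le> B"
proof -
  obtain B where "0 \<le> B" "\<forall>x\<in>\<Omega>. norm (D x) \<le> B"
    by (rule continuous_bounded_on_bounded[OF assms bounded])
  then show ?thesis using that[of B] by (simp add: space_restrict_space)
qed

text \<open>The integral constraints are linear and test against continuous functions, which are
  bounded on the bounded set \<Omega>, so they pass to L^1 limits. Nonnegativity comes from
  convergence almost everywhere.\<close>

lemma flow_triple_limit:
  assumes flow: "\<And>n. flow_triple \<Omega> (m n) (w n) (G n)"
    and int: "integrable (lebesgue_on \<Omega>) m'" "integrable (lebesgue_on \<Omega>) w'" "integrable (lebesgue_on \<Omega>) G'"
    and lim: "(\<lambda>n. \<integral>x. norm (m n x - m' x) \<partial>lebesgue_on \<Omega>) \<longlonglongrightarrow> 0"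
      "(\<lambda>n. \<integral>x. norm (w n x - w' x) \<partial>lebesgue_on \<Omega>) \<longlonglongrightarrow> 0"
      "(\<lambda>n. \<integral>x. norm (G n x - G' x) \<partial>lebesgue_on \<Omega>) \<longlonglongrightarrow> 0"
    and AE: "AE x in lebesgue_on \<Omega>. (\<lambda>n. m n x) \<longlonglongrightarrow> m' x"
  shows "flow_triple \<Omega> m' w' G'"
proof -
  let ?M = "lebesgue_on \<Omega>"
  have ints: "integrable ?M (m n)" "integrable ?M (w n)" "integrable ?M (G n)" for n
    using flow[of n] by (simp_all add: flow_triple_def)
  have weak: "weak_grad \<Omega> m' G'"
    unfolding weak_grad_iff
  proof (intro allI impI, elim conjE)
    fix phi Dphi assume phi: "smooth phi" "is_gradient phi Dphi"
      and supp: "compact (closure {x. phi x \<noteq> 0})" "closure {x. phi x \<noteq> 0} \<subseteq> \<Omega>"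
    note c = smooth_continuous[OF phi(1)] smooth_gradient_continuous[OF phi]
    obtain B1 where B1: "\<forall>x\<in>space ?M. norm (phi x) \<le> B1" by (rule continuous_bounded_on_domain[OF c(1)])
    obtain B2 where B2: "\<forall>x\<in>space ?M. norm (Dphi x) \<le> B2" by (rule continuous_bounded_on_domain[OF c(2)])
    have "(\<lambda>n. LINT x|?M. m n x *\<^sub>R Dphi x) \<longlonglongrightarrow> (LINT x|?M. m' x *\<^sub>R Dphi x)"
      by (rule tendsto_integral_bilinear[OF bounded_bilinear_scaleR ints(1) int(1)
            continuous_measurable_lebesgue_on[OF c(2)] B2 lim(1)])
    moreover have "(\<lambda>n. - (LINT x|?M. phi x *\<^sub>R G n x)) \<longlonglongrightarrow> - (LINT x|?M. phi x *\<^sub>R G' x)"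
      by (rule tendsto_minus, rule tendsto_integral_bilinear[OF bounded_bilinear_scaleR_flip ints(3) int(3)
            continuous_measurable_lebesgue_on[OF c(1)] B1 lim(3)])
    moreover have "(LINT x|?M. m n x *\<^sub>R Dphi x) = - (LINT x|?M. phi x *\<^sub>R G n x)" for n
      using flow[of n] phi supp unfolding flow_triple_def weak_grad_iff by blast
    ultimately show "(LINT x|?M. m' x *\<^sub>R Dphi x) = - (LINT x|?M. phi x *\<^sub>R G' x)"
      by (simp add: LIMSEQ_unique)
  qed
  have eqn: "(LINT x|?M. G' x \<bullet> Dphi x) = (LINT x|?M. w' x \<bullet> Dphi x)"
    if phi: "smooth phi" "is_gradient phi Dphi" for phi Dphi
  proof -
    note c = smooth_gradient_continuous[OF phi]
    obtain B where B: "\<forall>x\<in>space ?M. norm (Dphi x) \<le> B" by (rule continuous_bounded_on_domain[OF c])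
    have "(\<lambda>n. LINT x|?M. G n x \<bullet> Dphi x) \<longlonglongrightarrow> (LINT x|?M. G' x \<bullet> Dphi x)"
      by (rule tendsto_integral_bilinear[OF bounded_bilinear_inner ints(3) int(3)
            continuous_measurable_lebesgue_on[OF c] B lim(3)])
    moreover have "(\<lambda>n. LINT x|?M. w n x \<bullet> Dphi x) \<longlonglongrightarrow> (LINT x|?M. w' x \<bullet> Dphi x)"
      by (rule tendsto_integral_bilinear[OF bounded_bilinear_inner ints(2) int(2)
            continuous_measurable_lebesgue_on[OF c] B lim(2)])
    moreover have "(LINT x|?M. G n x \<bullet> Dphi x) = (LINT x|?M. w n x \<bullet> Dphi x)" for n
      using flow[of n] phi unfolding flow_triple_def by blast
    ultimately show ?thesis by (simp add: LIMSEQ_unique)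
  qed
  have mass: "(LINT x|?M. m' x) = 1"
  proof -
    have "(\<lambda>n. LINT x|?M. m n x *\<^sub>R (1::real)) \<longlonglongrightarrow> (LINT x|?M. m' x *\<^sub>R (1::real))"
      by (rule tendsto_integral_bilinear[OF bounded_bilinear_scaleR ints(1) int(1) _ _ lim(1), of _ 1]) simp_all
    moreover have "(LINT x|?M. m n x) = 1" for n using flow[of n] by (simp add: flow_triple_def)
    ultimately show ?thesis by (simp add: LIMSEQ_const_iff)
  qed
  have "AE x in ?M. \<forall>n. 0 \<le> m n x"
    using flow by (subst AE_all_countable) (simp add: flow_triple_def)
  with AE have nonneg: "AE x in ?M. 0 \<le> m' x"
    by eventually_elim (rule LIMSEQ_le_const, auto)
  show ?thesis unfolding flow_triple_def using int weak eqn mass nonneg by blast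
qed

lemma flow_triple_midpoint:
  assumes flow: "flow_triple \<Omega> m w G" "flow_triple \<Omega> m' w' G'"
  shows "flow_triple \<Omega> (\<lambda>x. (1/2) *\<^sub>R (m x + m' x)) (\<lambda>x. (1/2) *\<^sub>R (w x + w' x)) (\<lambda>x. (1/2) *\<^sub>R (G x + G' x))"
proof -
  let ?M = "lebesgue_on \<Omega>"
  have ints: "integrable ?M m" "integrable ?M w" "integrable ?M G" "integrable ?M m'" "integrable ?M w'" "integrable ?M G'"
    using flow by (simp_all add: flow_triple_def)
  have lin: "(LINT x|?M. pr ((1/2) *\<^sub>R (u x + v x)) (D x)) = (1/2) *\<^sub>R ((LINT x|?M. pr (u x) (D x)) + (LINT x|?M. pr (v x) (D x)))"
    if pr: "bounded_bilinear pr" and uv: "integrable ?M u" "integrable ?M v" and D: "continuous_on UNIV D"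
    for pr :: "'b::euclidean_space \<Rightarrow> 'c::euclidean_space \<Rightarrow> 'd::euclidean_space" and u v D
  proof -
    obtain B where B: "\<forall>x\<in>space ?M. norm (D x) \<le> B" by (rule continuous_bounded_on_domain[OF D])
    interpret bounded_bilinear pr by (rule pr)
    note i = integrable_bilinear[OF pr uv(1) continuous_measurable_lebesgue_on[OF D] B]
      integrable_bilinear[OF pr uv(2) continuous_measurable_lebesgue_on[OF D] B]
    have "(LINT x|?M. pr ((1/2) *\<^sub>R (u x + v x)) (D x)) = (LINT x|?M. (1/2) *\<^sub>R (pr (u x) (D x) + pr (v x) (D x)))"
      by (simp only: scaleR_left add_left)
    also have "\<dots> = (1/2) *\<^sub>R ((LINT x|?M. pr (u x) (D x)) + (LINT x|?M. pr (v x) (D x)))"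
      using i by (simp only: integral_scaleR_right Bochner_Integration.integral_add)
    finally show ?thesis .
  qed
  have weak: "weak_grad \<Omega> (\<lambda>x. (1/2) *\<^sub>R (m x + m' x)) (\<lambda>x. (1/2) *\<^sub>R (G x + G' x))"
    unfolding weak_grad_iff
  proof (intro allI impI)
    fix phi Dphi assume phi: "smooth phi \<and> is_gradient phi Dphi \<and>
      compact (closure {x. phi x \<noteq> 0}) \<and> closure {x. phi x \<noteq> 0} \<subseteq> \<Omega>"
    have c: "continuous_on UNIV phi" "continuous_on UNIV Dphi"
      using phi smooth_continuous smooth_gradient_continuous by auto
    have "(LINT x|?M. m x *\<^sub>R Dphi x) = - (LINT x|?M. phi x *\<^sub>R G x)"
      "(LINT x|?M. m' x *\<^sub>R Dphi x) = - (LINT x|?M. phi x *\<^sub>R G' x)"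
      using flow phi unfolding flow_triple_def weak_grad_iff by blast+
    then show "(LINT x|?M. ((1/2) *\<^sub>R (m x + m' x)) *\<^sub>R Dphi x) = - (LINT x|?M. phi x *\<^sub>R ((1/2) *\<^sub>R (G x + G' x)))"
      unfolding lin[OF bounded_bilinear_scaleR ints(1,4) c(2)] lin[OF bounded_bilinear_scaleR_flip ints(3,6) c(1)]
      by (simp add: algebra_simps)
  qed
  have eqn: "(LINT x|?M. ((1/2) *\<^sub>R (G x + G' x)) \<bullet> Dphi x) = (LINT x|?M. ((1/2) *\<^sub>R (w x + w' x)) \<bullet> Dphi x)"
    if phi: "smooth phi" "is_gradient phi Dphi" for phi Dphi
  proof -
    have "(LINT x|?M. G x \<bullet> Dphi x) = (LINT x|?M. w x \<bullet> Dphi x)" "(LINT x|?M. G' x \<bullet> Dphi x) = (LINT x|?M. w' x \<bullet> Dphi x)"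
      using flow phi unfolding flow_triple_def by blast+
    then show ?thesis
      unfolding lin[OF bounded_bilinear_inner ints(3,6) smooth_gradient_continuous[OF phi]]
        lin[OF bounded_bilinear_inner ints(2,5) smooth_gradient_continuous[OF phi]] by simp
  qed
  have mass: "(LINT x|?M. (1/2) *\<^sub>R (m x + m' x)) = 1"
    using flow by (simp add: flow_triple_def)
  have nonneg: "AE x in ?M. 0 \<le> (1/2) *\<^sub>R (m x + m' x)"
  proof -
    have "AE x in ?M. 0 \<le> m x" "AE x in ?M. 0 \<le> m' x" using flow by (simp_all add: flow_triple_def)
    then show ?thesis by eventually_elim simp
  qed
  show ?thesis unfolding flow_triple_def
    using ints weak eqn mass nonneg by (intro conjI allI impI) auto
qed

text \<open>A constant has weak gradient 0 since gradients of test functions integrate to 0, and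
  this one has mass 1 since the domain has measure 1. It is the competitor in the energy
  comparison.\<close>

lemma flow_triple_const:
  assumes "\<Omega> \<in> lmeasurable" "measure lebesgue \<Omega> = 1"
  shows "flow_triple \<Omega> (\<lambda>x. 1) (\<lambda>x. 0) (\<lambda>x. 0)"
proof -
  let ?M = "lebesgue_on \<Omega>"
  interpret finite_measure ?M using assms(1) by (rule finite_measure_lebesgue_on)
  have one: "measure ?M (space ?M) = 1"
    using assms S by (simp add: measure_restrict_space space_restrict_space)
  have "weak_grad \<Omega> (\<lambda>x. 1) (\<lambda>x. 0)"
    unfolding weak_grad_iff
  proof (intro allI impI, elim conjE)
    fix phi Dphi assume phi: "smooth phi" "is_gradient phi Dphi"
      and supp: "compact (closure {x. phi x \<noteq> 0})" "closure {x. phi x \<noteq> 0} \<subseteq> \<Omega>"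
    have Dm: "Dphi \<in> borel_measurable lborel"
      by (simp add: borel_measurable_continuous_onI[OF smooth_gradient_continuous[OF phi]])
    have "(LINT x|?M. Dphi x) = (LINT x|lebesgue. indicator \<Omega> x *\<^sub>R Dphi x)"
      using S by (simp add: integral_restrict_space)
    also have "(\<lambda>x. indicator \<Omega> x *\<^sub>R Dphi x) = Dphi"
    proof
      fix x
      show "indicator \<Omega> x *\<^sub>R Dphi x = Dphi x"
        using gradient_zero_outside_support[OF phi(2), of x] supp(2)
        by (cases "x \<in> \<Omega>") (auto simp: subset_iff)
    qed
    also have "(LINT x|lebesgue. Dphi x) = (LINT x|lborel. Dphi x)"
      by (rule integral_completion[OF Dm])
    also have "\<dots> = 0" by (rule integral_gradient_eq_0[OF phi supp(1)])
    finally show "(LINT x|?M. 1 *\<^sub>R Dphi x) = - (LINT x|?M. phi x *\<^sub>R 0)" by simp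
  qed
  then show ?thesis using one by (simp add: flow_triple_def)
qed

end

section \<open>Minimisation on the constraint set\<close>

text \<open>The exponents \<open>r\<close> and \<open>s\<close> of the statement coincide (\<open>exponents_agree\<close>), and \<open>g\<close> stands for \<open>\<gamma>'\<close>.\<close>

locale potential_game =
  fixes \<Omega> :: "'a::euclidean_space set" and H :: "'a \<Rightarrow> real" and f :: "'a \<Rightarrow> real \<Rightarrow> real"
    and g q s C_f K_f C_L C_q \<epsilon> :: real
  assumes open_domain: "open \<Omega>" and bounded_domain: "bounded \<Omega>" and vol: "measure lebesgue \<Omega> = 1"
    and bdd: "\<And>v. bdd_above (range (\<lambda>p. p \<bullet> v - H p))"
    and g: "g > 1" and q: "q > 1" and s_def: "s = g * q / (g + q - 1)"
    and C_f: "C_f > 0" and K_f: "K_f > 0"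
    and f_cont: "continuous_on (UNIV \<times> {0..}) (\<lambda>(x, m). f x m)"
    and f_bound: "\<And>x m. m \<ge> 0 \<Longrightarrow> \<bar>f x m\<bar> \<le> C_f * m powr (q - 1) + K_f"
    and C_L: "C_L > 0" and Lag_ge: "\<And>v. C_L * norm v powr g \<le> Lag H v" and Lag_0: "Lag H 0 \<le> 1 / C_L"
    and C_q: "C_q > 0" and eps: "\<epsilon> > 0"
    and a_priori: "\<And>m w. (m, w) \<in> Kset \<Omega> s s \<Longrightarrow> Ekin \<Omega> g m w < \<infinity> \<Longrightarrow>
      (\<forall>G. weak_grad \<Omega> m G \<and> memLp \<Omega> s G \<longrightarrow>
        Lp_norm \<Omega> s m + Lp_norm \<Omega> s G \<le> C_q * (enn2real (Ekin \<Omega> g m w) + 1)) \<and>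
      lp_pow \<Omega> q m \<le> ennreal ((C_q * (enn2real (Ekin \<Omega> g m w) + 1)) powr q)"
begin

abbreviation M :: "'a measure" where "M \<equiv> lebesgue_on \<Omega>"

definition Kin :: "('a \<Rightarrow> real) \<Rightarrow> ('a \<Rightarrow> 'a) \<Rightarrow> ennreal" where
  "Kin m w = (\<integral>\<^sup>+x. mL H (m x) (w x) \<partial>M)"

lemma domain_lmeasurable: "\<Omega> \<in> lmeasurable"
  using open_domain bounded_domain by (simp add: lmeasurable_open)

lemma domain_sets: "\<Omega> \<in> sets lebesgue"
  using domain_lmeasurable by auto

sublocale finite_measure M
  by (rule finite_measure_lebesgue_on[OF domain_lmeasurable])

lemma measure_M: "measure M (space M) = 1"
  using domain_sets vol by (simp add: measure_restrict_space space_restrict_space)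

lemma s_gt_1: "s > 1"
proof -
  have "0 < (g - 1) * (q - 1)" using g q by simp
  then have "g + q - 1 < g * q" by (simp add: algebra_simps)
  then show ?thesis using g q by (simp add: s_def)
qed

text \<open>Lets the L^q bound on m control its L^s norm, s being the common exponent of the convex
  selection.\<close>

lemma s_le_q: "s \<le> q"
proof -
  have "g * q \<le> q * (g + q - 1)" using g q by (simp add: algebra_simps)
  then show ?thesis using g q by (simp add: s_def field_simps)
qed

lemma Ekin_eq: "Ekin \<Omega> g m w = (\<integral>\<^sup>+x. wm_density g (m x) (w x) \<partial>M)"
  using domain_sets by (simp add: Ekin_def nn_integral_restrict_space mult.commute)

lemma Eeps_eq:
  "(m, w) \<in> Kset \<Omega> r s' \<Longrightarrow> Eeps H f \<Omega> r s' \<epsilon> m w = enn2ereal (Kin m w) + ereal (Feps f \<Omega> \<epsilon> m)"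
  using domain_sets by (simp add: Eeps_def Kin_def nn_integral_restrict_space mult.commute)

lemma idm: "(\<lambda>x. x) \<in> borel_measurable M"
  using id_borel_measurable_lebesgue_on[of \<Omega>] by (simp add: id_def)

lemma Kset_measurable:
  assumes "(m, w) \<in> Kset \<Omega> s s"
  shows "m \<in> borel_measurable M" "w \<in> borel_measurable M" "integrable M m"
    "AE x in M. 0 \<le> m x" "(\<integral>x. m x \<partial>M) = 1"
  using assms unfolding Kset_iff_flow_triple[OF open_domain domain_lmeasurable less_imp_le[OF s_gt_1]]
  by (auto simp: memLp_iff[OF domain_sets] flow_triple_def)

lemma Ekin_le_Kin:
  assumes "m \<in> borel_measurable M" "w \<in> borel_measurable M"
  shows "ennreal C_L * Ekin \<Omega> g m w \<le> Kin m w"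
proof -
  have "ennreal C_L * Ekin \<Omega> g m w = (\<integral>\<^sup>+x. ennreal C_L * wm_density g (m x) (w x) \<partial>M)"
    unfolding Ekin_eq by (rule nn_integral_cmult[symmetric]) (rule measurable_wm_density[OF assms])
  also have "\<dots> \<le> Kin m w"
    unfolding Kin_def by (intro nn_integral_mono wm_density_le_mL C_L Lag_ge)
  finally show ?thesis .
qed

lemma continuous_on_moll:
  assumes "integrable M m" shows "continuous_on UNIV (moll \<Omega> \<epsilon> m)"
  unfolding continuous_on_iff
proof (intro ballI allI impI)
  fix x :: 'a and e :: real assume e: "0 < e"
  define I where "I = (LINT y|M. \<bar>m y\<bar>)"
  have I: "0 \<le> I" by (simp add: I_def)
  define e' where "e' = e / (I + 1)"
  have e': "0 < e'" using e I by (simp add: e'_def)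
  obtain d where d: "0 < d" "\<And>m x x'. integrable M m \<Longrightarrow> dist x x' < d \<Longrightarrow>
       \<bar>moll \<Omega> \<epsilon> m x - moll \<Omega> \<epsilon> m x'\<bar> \<le> e' * (LINT y|M. \<bar>m y\<bar>)"
    by (rule moll_equicontinuous[OF eps domain_sets e']) (rule that)
  have "e' * I < e" using e I by (simp add: e'_def field_simps)
  then have "dist (moll \<Omega> \<epsilon> m x') (moll \<Omega> \<epsilon> m x) < e" if "dist x' x < d" for x'
    using d(2)[OF assms that] by (simp add: dist_real_def I_def)
  then show "\<exists>d>0. \<forall>x'\<in>UNIV. dist x' x < d \<longrightarrow> dist (moll \<Omega> \<epsilon> m x') (moll \<Omega> \<epsilon> m x) < e"
    using d(1) by blast
qed

text \<open>B bounds the kernel and, because densities have mass 1, also all their mollifications;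
  on [0, B] the potential is Lipschitz.\<close>

lemma moll_bounds:
  obtains B where "0 \<le> B" "\<forall>x::'a. chi_eps \<epsilon> x \<le> B"
    "\<forall>m w x. (m, w) \<in> Kset \<Omega> s s \<longrightarrow> moll \<Omega> \<epsilon> m x \<in> {0..B}"
proof -
  obtain B where B: "0 \<le> B" "\<And>x::'a. chi_eps \<epsilon> x \<le> B"
    by (rule chi_eps_bounded[OF eps]) (rule that)
  have "moll \<Omega> \<epsilon> m x \<in> {0..B}" if K: "(m, w) \<in> Kset \<Omega> s s" for m w x
  proof -
    note m = Kset_measurable[OF K]
    have "moll \<Omega> \<epsilon> (\<lambda>x. 0) x = 0" by (simp add: moll_eq_lebesgue_on[OF domain_sets])
    then have "\<bar>moll \<Omega> \<epsilon> m x\<bar> \<le> B * (LINT y|M. \<bar>m y\<bar>)"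
      using moll_lipschitz_L1[OF eps domain_sets m(3), of "\<lambda>x. 0" B x] B(2) by simp
    also have "(LINT y|M. \<bar>m y\<bar>) = (LINT y|M. m y)"
      using m(1,4) by (intro integral_cong_AE) (auto elim: eventually_mono)
    finally show ?thesis using moll_nonneg[OF eps domain_sets m(4), of x] m(5) by simp
  qed
  then have *: "\<forall>m w x. (m, w) \<in> Kset \<Omega> s s \<longrightarrow> moll \<Omega> \<epsilon> m x \<in> {0..B}" by blast
  show ?thesis by (rule that[OF B(1) allI[OF B(2)] *])
qed

lemma Fpot_integrable:
  assumes h: "h \<in> borel_measurable M" "\<And>x. h x \<in> {0..B}"
  shows "integrable M (\<lambda>x. Fpot f x (h x))"
proof (rule Bochner_Integration.integrable_bound[of _ "\<lambda>x. C_f / q * B powr q + K_f * B"])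
  show "(\<lambda>x. Fpot f x (h x)) \<in> borel_measurable M"
    by (rule measurable_Fpot[OF f_cont C_f K_f q f_bound idm h(1)]) (use h(2) in auto)
  show "AE x in M. norm (Fpot f x (h x)) \<le> norm (C_f / q * B powr q + K_f * B)"
  proof (rule AE_I2)
    fix x
    have hx: "0 \<le> h x" "h x \<le> B" using h(2)[of x] by auto
    have "\<bar>Fpot f x (h x)\<bar> \<le> C_f / q * h x powr q + K_f * h x"
      by (rule abs_Fpot_le[OF f_cont C_f K_f q f_bound hx(1)])
    also have "\<dots> \<le> C_f / q * B powr q + K_f * B"
      using hx C_f K_f q by (intro add_mono mult_left_mono powr_mono2) auto
    finally show "norm (Fpot f x (h x)) \<le> norm (C_f / q * B powr q + K_f * B)" by simp
  qed
qed simp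

lemma Feps_eq: "Feps f \<Omega> \<epsilon> m = (LINT x|M. Fpot f x (moll \<Omega> \<epsilon> m x))"
  unfolding Feps_def by (rule set_lebesgue_integral_eq_lebesgue_on[OF domain_sets])

lemma moll_measurable:
  assumes "(m, w) \<in> Kset \<Omega> s s" shows "moll \<Omega> \<epsilon> m \<in> borel_measurable M"
  by (intro continuous_measurable_lebesgue_on continuous_on_moll Kset_measurable(3)[OF assms])

text \<open>Mollification is a contraction in L^q, which treats the power term of the potential, and
  in L^1, which treats the linear term. Neither bound depends on \<epsilon>.\<close>

lemma abs_Feps_le:
  assumes K: "(m, w) \<in> Kset \<Omega> s s" and A: "lp_pow \<Omega> q m \<le> ennreal A" "0 \<le> A"
  shows "\<bar>Feps f \<Omega> \<epsilon> m\<bar> \<le> C_f / q * A + K_f"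
proof -
  note m = Kset_measurable[OF K]
  let ?h = "moll \<Omega> \<epsilon> m"
  have hm: "?h \<in> borel_measurable M" by (rule moll_measurable[OF K])
  obtain B where B: "0 \<le> B" "\<forall>m w x. (m, w) \<in> Kset \<Omega> s s \<longrightarrow> moll \<Omega> \<epsilon> m x \<in> {0..B}"
    by (rule moll_bounds) (rule that; blast)
  have hB: "?h x \<in> {0..B}" for x using B(2) K by blast
  have h0: "0 \<le> ?h x" for x using hB[of x] by simp
  have hi: "integrable M ?h"
    by (rule integrable_const_bound[of _ B]) (use hB hm in \<open>auto simp: abs_of_nonneg\<close>)
  have hqi: "integrable M (\<lambda>x. ?h x powr q)"
  proof (rule integrable_const_bound[of _ "B powr q"])
    show "AE x in M. norm (?h x powr q) \<le> B powr q"
      using hB q by (intro AE_I2) (auto intro!: powr_mono2)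
  qed (use hm in simp)
  have fin: "powr_integral M q m < \<infinity>"
    using A(1) unfolding lp_pow_eq[OF domain_sets] by (rule le_less_trans) simp
  have mq: "integrable M (\<lambda>x. \<bar>m x\<bar> powr q)"
    using integrable_of_powr(2)[OF m(1) less_imp_le[OF q] fin] by simp
  have "ennreal (\<integral>x. ?h x powr q \<partial>M) = (\<integral>\<^sup>+x. ennreal (?h x powr q) \<partial>M)"
    by (rule nn_integral_eq_integral[symmetric, OF hqi]) simp
  also have "\<dots> \<le> (\<integral>\<^sup>+x. ennreal (\<bar>m x\<bar> powr q) \<partial>M)"
    by (rule nn_integral_moll_powr_le[OF eps domain_lmeasurable less_imp_le[OF q] m(3) mq m(4)])
  also have "\<dots> \<le> ennreal A" using A(1) by (simp add: lp_pow_eq[OF domain_sets])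
  finally have hq: "(\<integral>x. ?h x powr q \<partial>M) \<le> A" using A(2) by simp
  have "ennreal (\<integral>x. ?h x \<partial>M) = (\<integral>\<^sup>+x. ennreal (?h x powr 1) \<partial>M)"
    using h0 by (subst nn_integral_eq_integral[OF _ , symmetric]) (auto simp: hi)
  also have "\<dots> \<le> (\<integral>\<^sup>+x. ennreal (\<bar>m x\<bar> powr 1) \<partial>M)"
    by (rule nn_integral_moll_powr_le[OF eps domain_lmeasurable order_refl m(3) _ m(4)]) (use m(3) in simp)
  also have "\<dots> = (\<integral>\<^sup>+x. ennreal (m x) \<partial>M)"
    using m(4) by (intro nn_integral_cong_AE) (auto elim: eventually_mono)
  also have "\<dots> = ennreal 1" using nn_integral_eq_integral[OF m(3,4)] m(5) by simp
  finally have h1: "(\<integral>x. ?h x \<partial>M) \<le> 1" by simp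
  have "\<bar>Feps f \<Omega> \<epsilon> m\<bar> \<le> (\<integral>x. \<bar>Fpot f x (?h x)\<bar> \<partial>M)" unfolding Feps_eq by (rule integral_abs_bound)
  also have "\<dots> \<le> (\<integral>x. C_f / q * ?h x powr q + K_f * ?h x \<partial>M)"
    using Fpot_integrable[OF hm hB] hi hqi
    by (intro integral_mono abs_Fpot_le[OF f_cont C_f K_f q f_bound h0]) auto
  also have "\<dots> = C_f / q * (\<integral>x. ?h x powr q \<partial>M) + K_f * (\<integral>x. ?h x \<partial>M)" using hi hqi by simp
  also have "\<dots> \<le> C_f / q * A + K_f * 1"
    using hq h1 C_f K_f q by (intro add_mono mult_left_mono) auto
  finally show ?thesis by simp
qed

text \<open>The comparison is with an arbitrary function h, because a uniform limit of mollified
  densities is not known beforehand to be the mollification of an admissible one.\<close>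

lemma Feps_diff_le:
  assumes K: "(m, w) \<in> Kset \<Omega> s s" and B: "\<forall>x. moll \<Omega> \<epsilon> m x \<in> {0..B}"
    and h: "h \<in> borel_measurable M" "\<And>x. h x \<in> {0..B}"
    and close: "\<And>x. x \<in> \<Omega> \<Longrightarrow> \<bar>moll \<Omega> \<epsilon> m x - h x\<bar> \<le> d"
  shows "\<bar>Feps f \<Omega> \<epsilon> m - (LINT x|M. Fpot f x (h x))\<bar> \<le> (C_f * B powr (q - 1) + K_f) * d"
proof -
  let ?h = "moll \<Omega> \<epsilon> m" and ?L = "C_f * B powr (q - 1) + K_f"
  have hm: "?h \<in> borel_measurable M" by (rule moll_measurable[OF K])
  note i = Fpot_integrable[OF hm, of B] Fpot_integrable[OF h]
  have i1: "integrable M (\<lambda>x. Fpot f x (?h x))" using i(1) B by blast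
  have L: "0 \<le> ?L" using C_f K_f by simp
  have "Feps f \<Omega> \<epsilon> m - (LINT x|M. Fpot f x (h x)) = (LINT x|M. Fpot f x (?h x) - Fpot f x (h x))"
    unfolding Feps_eq using i1 i(2) by simp
  also have "\<bar>\<dots>\<bar> \<le> (LINT x|M. \<bar>Fpot f x (?h x) - Fpot f x (h x)\<bar>)" by (rule integral_abs_bound)
  also have "\<dots> \<le> (LINT x|M. ?L * d)"
  proof (rule integral_mono)
    fix x assume "x \<in> space M"
    then have x: "x \<in> \<Omega>" by (simp add: space_restrict_space)
    have "\<bar>Fpot f x (?h x) - Fpot f x (h x)\<bar> \<le> ?L * \<bar>?h x - h x\<bar>"
      using B h(2)[of x] by (intro Fpot_lipschitz[OF f_cont C_f K_f q f_bound]) auto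
    also have "\<dots> \<le> ?L * d" by (intro mult_left_mono close x L)
    finally show "\<bar>Fpot f x (?h x) - Fpot f x (h x)\<bar> \<le> ?L * d" .
  qed (use i1 i(2) in auto)
  also have "\<dots> = ?L * d" using measure_M by simp
  finally show ?thesis .
qed

lemma const_in_Kset: "((\<lambda>x. 1), (\<lambda>x. 0)) \<in> Kset \<Omega> s s"
  and lp_pow_const: "lp_pow \<Omega> q (\<lambda>x. 1::real) = 1"
  and Kin_const: "Kin (\<lambda>x. 1) (\<lambda>x. 0) \<le> ennreal (1 / C_L)"
proof -
  have e1: "emeasure M (space M) = 1"
    using measure_M by (simp add: emeasure_eq_measure)
  have e2: "emeasure M \<Omega> = 1" using e1 by (simp add: space_restrict_space)
  have "memLp \<Omega> s (\<lambda>x. 1::real)" "memLp \<Omega> s (\<lambda>x. 0::'a)"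
    by (simp_all add: memLp_iff[OF domain_sets] e2)
  then show "((\<lambda>x. 1), (\<lambda>x. 0)) \<in> Kset \<Omega> s s"
    unfolding Kset_iff_flow_triple[OF open_domain domain_lmeasurable less_imp_le[OF s_gt_1]]
    using flow_triple_const[OF bounded_domain domain_sets domain_lmeasurable vol] by blast
  show "lp_pow \<Omega> q (\<lambda>x. 1::real) = 1" by (simp add: lp_pow_eq[OF domain_sets] e2)
  have "Kin (\<lambda>x. 1) (\<lambda>x. 0) = ennreal (Lag H 0)" by (simp add: Kin_def mL_def e2)
  then show "Kin (\<lambda>x. 1) (\<lambda>x. 0) \<le> ennreal (1 / C_L)" using Lag_0 by (simp add: ennreal_leI)
qed

text \<open>A bound k on the kinetic energy controls all three components of a triple: C_L relates
  it to \<open>Ekin\<close>, the a priori estimate then gives m and its weak gradient, and Young's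
  inequality gives w.\<close>

lemma energy_bounds:
  assumes K: "(m, w) \<in> Kset \<Omega> s s" and Kfin: "Kin m w \<le> ennreal k" and k: "0 \<le> k"
  shows "Ekin \<Omega> g m w \<le> ennreal (k / C_L)"
    "lp_pow \<Omega> q m \<le> ennreal ((C_q * (k / C_L + 1)) powr q)"
    "weak_grad \<Omega> m G \<Longrightarrow> memLp \<Omega> s G \<Longrightarrow> lp_pow \<Omega> s G \<le> ennreal ((C_q * (k / C_L + 1)) powr s)"
    "lp_pow \<Omega> s w \<le> ennreal (k / C_L + (C_q * (k / C_L + 1)) powr q)"
proof -
  note m = Kset_measurable[OF K]
  let ?E = "Ekin \<Omega> g m w"
  have "ennreal C_L * ?E \<le> ennreal C_L * ennreal (k / C_L)"
    using order_trans[OF Ekin_le_Kin[OF m(1,2)] Kfin] C_L k by (simp add: ennreal_mult[symmetric])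
  then show E: "?E \<le> ennreal (k / C_L)"
    using C_L by (subst (asm) ennreal_mult_le_mult_iff) auto
  then have Efin: "?E < \<infinity>" by (rule le_less_trans) simp
  define e where "e = enn2real ?E"
  have e: "0 \<le> e" "e \<le> k / C_L"
    using E k C_L by (auto simp: e_def intro: enn2real_leI)
  have le: "C_q * (e + 1) \<le> C_q * (k / C_L + 1)" using e C_q by simp
  have ap: "\<forall>G. weak_grad \<Omega> m G \<and> memLp \<Omega> s G \<longrightarrow> Lp_norm \<Omega> s m + Lp_norm \<Omega> s G \<le> C_q * (e + 1)"
    "lp_pow \<Omega> q m \<le> ennreal ((C_q * (e + 1)) powr q)"
    using a_priori[OF K Efin] by (simp_all add: e_def)
  have "(C_q * (e + 1)) powr q \<le> (C_q * (k / C_L + 1)) powr q"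
    using le e C_q q by (intro powr_mono2) auto
  then show lpq: "lp_pow \<Omega> q m \<le> ennreal ((C_q * (k / C_L + 1)) powr q)"
    using order_trans[OF ap(2) ennreal_leI] by blast
  show "lp_pow \<Omega> s G \<le> ennreal ((C_q * (k / C_L + 1)) powr s)" if G: "weak_grad \<Omega> m G" "memLp \<Omega> s G"
  proof -
    \<comment> \<open>\<open>Lp_norm\<close> passes through \<open>enn2real\<close>, so the
      finiteness in \<open>memLp\<close> is what permits the return to
      \<open>lp_pow\<close>.\<close>
    define t where "t = enn2real (lp_pow \<Omega> s G)"
    have t: "0 \<le> t" "lp_pow \<Omega> s G = ennreal t"
      using G(2) by (auto simp: t_def memLp_def)
    have "t powr (1 / s) \<le> C_q * (e + 1)"
    proof -
      have "0 \<le> Lp_norm \<Omega> s m" by (simp add: Lp_norm_def)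
      moreover have "Lp_norm \<Omega> s m + Lp_norm \<Omega> s G \<le> C_q * (e + 1)" using ap(1) G by blast
      ultimately have "Lp_norm \<Omega> s G \<le> C_q * (e + 1)" by linarith
      then show ?thesis by (simp add: Lp_norm_def t_def)
    qed
    then have "t powr (1 / s) \<le> C_q * (k / C_L + 1)" using le by linarith
    then have "(t powr (1 / s)) powr s \<le> (C_q * (k / C_L + 1)) powr s"
      using s_gt_1 by (intro powr_mono2) auto
    then show ?thesis using t s_gt_1 by (simp add: powr_powr ennreal_leI)
  qed
  have "lp_pow \<Omega> s w \<le> (\<integral>\<^sup>+x. wm_density g (m x) (w x) + ennreal (norm (m x) powr q) \<partial>M)"
    unfolding lp_pow_eq[OF domain_sets]
  proof (rule nn_integral_mono_AE)
    show "AE x in M. ennreal (norm (w x) powr s) \<le> wm_density g (m x) (w x) + ennreal (norm (m x) powr q)"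
      using m(4)
    proof eventually_elim
      case (elim x)
      then show ?case using norm_powr_le_wm_density[OF g q elim, of "w x"] by (simp add: s_def)
    qed
  qed
  also have "\<dots> = ?E + lp_pow \<Omega> q m"
    unfolding Ekin_eq lp_pow_eq[OF domain_sets]
    using m(1) by (intro nn_integral_add measurable_wm_density m(1,2)) simp
  also have "\<dots> \<le> ennreal (k / C_L) + ennreal ((C_q * (k / C_L + 1)) powr q)" by (intro add_mono E lpq)
  also have "\<dots> = ennreal (k / C_L + (C_q * (k / C_L + 1)) powr q)"
    using k C_L by (simp add: ennreal_plus)
  finally show "lp_pow \<Omega> s w \<le> ennreal (k / C_L + (C_q * (k / C_L + 1)) powr q)" .
qed

end

section \<open>Limits of admissible triples and the constrained minimiser\<close>

lemma powr_sum3_le: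
  fixes a b c p :: real
  assumes "0 \<le> a" "0 \<le> b" "0 \<le> c" "0 \<le> p"
  shows "(a + b + c) powr p \<le> 3 powr p * (a powr p + b powr p + c powr p)"
proof -
  define m where "m = max a (max b c)"
  have "(a + b + c) powr p \<le> (3 * m) powr p" using assms by (intro powr_mono2) (auto simp: m_def)
  also have "\<dots> = 3 powr p * m powr p" by (simp add: powr_mult)
  also have "\<dots> \<le> 3 powr p * (a powr p + b powr p + c powr p)"
    by (intro mult_left_mono) (auto simp: m_def max_def)
  finally show ?thesis .
qed

lemma norm_proj1_le: "norm (fst z) \<le> norm z"
  using norm_fst_le[of "fst z" "snd z"] by simp

lemma norm_proj2_le: "norm (snd z) \<le> norm z"
  using norm_snd_le[of "snd z" "fst z"] by simp

lemma nn_integral_powr_le_of_AE_limit: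
  fixes u :: "nat \<Rightarrow> 'a \<Rightarrow> 'b::{real_normed_vector, second_countable_topology}"
  assumes meas: "\<And>n. u n \<in> borel_measurable M" and conv: "AE x in M. (\<lambda>n. u n x) \<longlonglongrightarrow> v x"
    and p: "0 < p" and bd: "\<And>n. powr_integral M p (u n) \<le> c"
  shows "powr_integral M p v \<le> c"
proof -
  have "powr_integral M p v = (\<integral>\<^sup>+x. liminf (\<lambda>n. ennreal (norm (u n x) powr p)) \<partial>M)"
  proof (rule nn_integral_cong_AE)
    show "AE x in M. ennreal (norm (v x) powr p) = liminf (\<lambda>n. ennreal (norm (u n x) powr p))"
      using conv
    proof eventually_elim
      case (elim x)
      have "(\<lambda>n. ennreal (norm (u n x) powr p)) \<longlonglongrightarrow> ennreal (norm (v x) powr p)"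
        using p by (intro tendsto_ennrealI tendsto_powr' tendsto_norm elim tendsto_const) auto
      then show ?case by (intro lim_imp_Liminf[symmetric]) simp_all
    qed
  qed
  also have "\<dots> \<le> liminf (\<lambda>n. \<integral>\<^sup>+x. ennreal (norm (u n x) powr p) \<partial>M)"
    using meas by (intro nn_integral_liminf) simp
  also have "\<dots> \<le> liminf (\<lambda>n. c)" by (intro Liminf_mono always_eventually allI bd)
  also have "\<dots> = c" by (simp add: Liminf_const)
  finally show ?thesis .
qed

lemma tendsto_integral_norm_0_mono:
  fixes u :: "nat \<Rightarrow> 'a \<Rightarrow> 'b::{banach, second_countable_topology}" and v :: "nat \<Rightarrow> 'a \<Rightarrow> 'c::{banach, second_countable_topology}"
  assumes lim: "(\<lambda>n. \<integral>x. norm (u n x) \<partial>M) \<longlonglongrightarrow> 0"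
    and le: "\<And>n x. norm (v n x) \<le> norm (u n x)" and int: "\<And>n. integrable M (u n)" "\<And>n. integrable M (v n)"
  shows "(\<lambda>n. \<integral>x. norm (v n x) \<partial>M) \<longlonglongrightarrow> 0"
proof (rule Lim_null_comparison[OF _ lim])
  show "\<forall>\<^sub>F n in sequentially. norm (\<integral>x. norm (v n x) \<partial>M) \<le> (\<integral>x. norm (u n x) \<partial>M)"
  proof (intro always_eventually allI)
    fix n
    have "(\<integral>x. norm (v n x) \<partial>M) \<le> (\<integral>x. norm (u n x) \<partial>M)"
      using int by (intro integral_mono le) auto
    then show "norm (\<integral>x. norm (v n x) \<partial>M) \<le> (\<integral>x. norm (u n x) \<partial>M)" by simp
  qed
qed

context potential_game
begin

lemma Kin_midpoint:
  assumes meas: "m \<in> borel_measurable M" "w \<in> borel_measurable M" "m' \<in> borel_measurable M" "w' \<in> borel_measurable M"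
    and nonneg: "AE x in M. 0 \<le> m x" "AE x in M. 0 \<le> m' x"
    and le: "Kin m w \<le> c" "Kin m' w' \<le> c"
  shows "Kin (\<lambda>x. (1/2) *\<^sub>R (m x + m' x)) (\<lambda>x. (1/2) *\<^sub>R (w x + w' x)) \<le> c"
proof -
  have "Kin (\<lambda>x. (1/2) *\<^sub>R (m x + m' x)) (\<lambda>x. (1/2) *\<^sub>R (w x + w' x))
      \<le> (\<integral>\<^sup>+x. ennreal (1/2) * (mL H (m x) (w x) + mL H (m' x) (w' x)) \<partial>M)"
    unfolding Kin_def
  proof (rule nn_integral_mono_AE)
    show "AE x in M. mL H ((1/2) *\<^sub>R (m x + m' x)) ((1/2) *\<^sub>R (w x + w' x)) \<le> ennreal (1/2) * (mL H (m x) (w x) + mL H (m' x) (w' x))"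
      using nonneg
    proof eventually_elim
      case (elim x)
      show ?case using mL_midpoint[OF bdd elim, of "w x" "w' x"] by simp
    qed
  qed
  also have "\<dots> = ennreal (1/2) * (Kin m w + Kin m' w')"
    unfolding Kin_def using measurable_mL[OF bdd meas(1,2)] measurable_mL[OF bdd meas(3,4)]
    by (simp only: nn_integral_cmult nn_integral_add borel_measurable_add)
  also have "\<dots> \<le> ennreal (1/2) * (c + c)" using le by (intro mult_left_mono add_mono) simp_all
  also have "\<dots> = c" by (rule ennreal_half_add)
  finally show ?thesis .
qed

lemma Kin_le_liminf:
  assumes meas: "\<And>n. m n \<in> borel_measurable M" "\<And>n. w n \<in> borel_measurable M"
    and nonneg: "\<And>n. AE x in M. 0 \<le> m n x"
    and conv: "AE x in M. (\<lambda>n. m n x) \<longlonglongrightarrow> m' x" "AE x in M. (\<lambda>n. w n x) \<longlonglongrightarrow> w' x"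
  shows "Kin m' w' \<le> liminf (\<lambda>n. Kin (m n) (w n))"
proof -
  have nn: "AE x in M. \<forall>n. 0 \<le> m n x" using nonneg by (subst AE_all_countable) simp
  have "Kin m' w' \<le> (\<integral>\<^sup>+x. liminf (\<lambda>n. mL H (m n x) (w n x)) \<partial>M)"
    unfolding Kin_def
  proof (rule nn_integral_mono_AE)
    show "AE x in M. mL H (m' x) (w' x) \<le> liminf (\<lambda>n. mL H (m n x) (w n x))"
      using nn conv by eventually_elim (rule mL_lower_semicontinuous[OF bdd], auto)
  qed
  also have "\<dots> \<le> liminf (\<lambda>n. Kin (m n) (w n))"
    unfolding Kin_def by (intro nn_integral_liminf measurable_mL[OF bdd] meas)
  finally show ?thesis .
qed

lemma moll_midpoint:
  assumes "integrable M m" "integrable M m'"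
  shows "moll \<Omega> \<epsilon> (\<lambda>x. (1/2) *\<^sub>R (m x + m' x)) x = (1/2) * (moll \<Omega> \<epsilon> m x + moll \<Omega> \<epsilon> m' x)"
proof -
  note i = integrable_mult_chi_eps[OF eps assms(1), of x] integrable_mult_chi_eps[OF eps assms(2), of x]
  have "moll \<Omega> \<epsilon> (\<lambda>x. (1/2) *\<^sub>R (m x + m' x)) x
      = (LINT y|M. (1/2) * (m y * chi_eps \<epsilon> (x - y) + m' y * chi_eps \<epsilon> (x - y)))"
    unfolding moll_eq_lebesgue_on[OF domain_sets] by (intro Bochner_Integration.integral_cong) (simp_all add: algebra_simps)
  also have "\<dots> = (1/2) * (moll \<Omega> \<epsilon> m x + moll \<Omega> \<epsilon> m' x)"
    unfolding moll_eq_lebesgue_on[OF domain_sets] using i by simp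
  finally show ?thesis .
qed

lemma Eeps_ge:
  assumes B: "(m, w) \<in> Bset \<Omega> s s q \<alpha>" and \<alpha>: "0 \<le> \<alpha>"
  shows "ereal (- (C_f / q * \<alpha> + K_f)) \<le> Eeps H f \<Omega> s s \<epsilon> m w"
proof -
  have K: "(m, w) \<in> Kset \<Omega> s s" "lp_pow \<Omega> q m \<le> ennreal \<alpha>" using B by (auto simp: Bset_def)
  have "- (C_f / q * \<alpha> + K_f) \<le> Feps f \<Omega> \<epsilon> m" using abs_Feps_le[OF K \<alpha>] by linarith
  then have "ereal (- (C_f / q * \<alpha> + K_f)) \<le> ereal (Feps f \<Omega> \<epsilon> m)" by simp
  also have "\<dots> \<le> enn2ereal (Kin m w) + ereal (Feps f \<Omega> \<epsilon> m)"
    by (rule add_increasing) simp_all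
  finally show ?thesis unfolding Eeps_eq[OF K(1)] .
qed

lemma Eeps_const_le:
  "Eeps H f \<Omega> s s \<epsilon> (\<lambda>x. 1) (\<lambda>x. 0) \<le> ereal (1 / C_L + (C_f / q + K_f))"
proof -
  have "\<bar>Feps f \<Omega> \<epsilon> (\<lambda>x. 1)\<bar> \<le> C_f / q * 1 + K_f"
    by (rule abs_Feps_le[OF const_in_Kset]) (simp_all add: lp_pow_const)
  then have F: "Feps f \<Omega> \<epsilon> (\<lambda>x. 1) \<le> C_f / q + K_f" by linarith
  have "enn2ereal (Kin (\<lambda>x. 1) (\<lambda>x. 0)) \<le> enn2ereal (ennreal (1 / C_L))"
    using Kin_const by (simp add: less_eq_ennreal.rep_eq)
  also have "\<dots> = ereal (1 / C_L)" using C_L by simp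
  finally have "enn2ereal (Kin (\<lambda>x. 1) (\<lambda>x. 0)) + ereal (Feps f \<Omega> \<epsilon> (\<lambda>x. 1)) \<le> ereal (1 / C_L) + ereal (C_f / q + K_f)"
    using F by (intro add_mono) simp_all
  then show ?thesis unfolding Eeps_eq[OF const_in_Kset] by simp
qed

lemma Eeps_less_imp_Kin:
  assumes K: "(m, w) \<in> Kset \<Omega> s s" and less: "Eeps H f \<Omega> s s \<epsilon> m w < ereal a"
  obtains k where "0 \<le> k" "Kin m w = ennreal k" "k + Feps f \<Omega> \<epsilon> m < a"
proof (cases "Kin m w")
  case (real k)
  then show ?thesis using less that[of k] unfolding Eeps_eq[OF K] by simp
next
  case top
  then show ?thesis using less unfolding Eeps_eq[OF K] by simp
qed

lemma moll_compactness:
  assumes K: "\<And>n. (m n, w n) \<in> Kset \<Omega> s s" and B: "\<forall>m w x. (m, w) \<in> Kset \<Omega> s s \<longrightarrow> moll \<Omega> \<epsilon> m x \<in> {0..B}"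
  obtains h k where "h \<in> borel_measurable M" "\<And>x. h x \<in> {0..B}" "strict_mono (k :: nat \<Rightarrow> nat)"
    "\<And>e. 0 < e \<Longrightarrow> \<exists>N. \<forall>j\<ge>N. \<forall>x\<in>\<Omega>. \<bar>moll \<Omega> \<epsilon> (m (k j)) x - h x\<bar> < e"
proof -
  have mB: "moll \<Omega> \<epsilon> (m n) x \<in> {0..B}" for n x using B K by blast
  have B0: "0 \<le> B" using mB[of 0 0] by simp
  have mass: "(LINT y|M. \<bar>m n y\<bar>) = 1" for n
  proof -
    note mn = Kset_measurable[OF K[of n]]
    have "(LINT y|M. \<bar>m n y\<bar>) = (LINT y|M. m n y)"
      using mn(1,4) by (intro integral_cong_AE) (auto elim: eventually_mono)
    then show ?thesis using mn(5) by simp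
  qed
  have bd: "norm (moll \<Omega> \<epsilon> (m n) x) \<le> B" for n x using mB[of n x] by simp
  have equi: "\<exists>d. 0 < d \<and> (\<forall>n y. y \<in> closure \<Omega> \<and> norm (x - y) < d \<longrightarrow> norm (moll \<Omega> \<epsilon> (m n) x - moll \<Omega> \<epsilon> (m n) y) < e)"
    if e: "0 < e" for x :: 'a and e
  proof -
    have e2: "0 < e / 2" using e by simp
    obtain d where d: "0 < d" "\<And>m x x'. integrable M m \<Longrightarrow> dist x x' < d \<Longrightarrow>
         \<bar>moll \<Omega> \<epsilon> m x - moll \<Omega> \<epsilon> m x'\<bar> \<le> e / 2 * (LINT y|M. \<bar>m y\<bar>)"
      by (rule moll_equicontinuous[OF eps domain_sets e2]) (rule that)
    have "norm (moll \<Omega> \<epsilon> (m n) x - moll \<Omega> \<epsilon> (m n) y) < e" if "norm (x - y) < d" for n y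
      using d(2)[OF Kset_measurable(3)[OF K[of n]], of x y] that mass[of n] e by (simp add: dist_norm)
    then show ?thesis using d(1) by blast
  qed
  obtain h0 k where hk: "continuous_on (closure \<Omega>) h0" "strict_mono (k :: nat \<Rightarrow> nat)"
    "\<And>e. 0 < e \<Longrightarrow> \<exists>N. \<forall>n x. n \<ge> N \<and> x \<in> closure \<Omega> \<longrightarrow> norm (moll \<Omega> \<epsilon> (m (k n)) x - h0 x) < e"
    by (rule Arzela_Ascoli[of "closure \<Omega>" "\<lambda>n. moll \<Omega> \<epsilon> (m n)" B])
       (use bounded_domain bd equi in \<open>simp_all add: compact_closure\<close>)
  \<comment> \<open>Arzela-Ascoli controls h0 only on the closure of \<Omega>. Truncation gives
    values in [0, B] everywhere and, as the mollifications also lie in [0, B], does not increase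
    their distance to the limit.\<close>
  define h where "h x = max 0 (min B (h0 x))" for x
  have "h0 \<in> borel_measurable M"
    using continuous_on_subset[OF hk(1) closure_subset] domain_sets by (rule continuous_imp_measurable_on_sets_lebesgue)
  then have hm: "h \<in> borel_measurable M" unfolding h_def by simp
  have hB: "h x \<in> {0..B}" for x using B0 by (simp add: h_def)
  have "\<exists>N. \<forall>j\<ge>N. \<forall>x\<in>\<Omega>. \<bar>moll \<Omega> \<epsilon> (m (k j)) x - h x\<bar> < e" if e: "0 < e" for e
  proof -
    obtain N where N: "\<forall>n x. n \<ge> N \<and> x \<in> closure \<Omega> \<longrightarrow> norm (moll \<Omega> \<epsilon> (m (k n)) x - h0 x) < e"
      using hk(3)[OF e] by blast
    have "\<bar>moll \<Omega> \<epsilon> (m (k j)) x - h x\<bar> < e" if j: "j \<ge> N" and x: "x \<in> \<Omega>" for j x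
    proof -
      have "\<bar>moll \<Omega> \<epsilon> (m (k j)) x - h0 x\<bar> < e" using N j x closure_subset[of \<Omega>] by auto
      then show ?thesis using mB[of "k j" x] unfolding h_def by (auto simp: max_def min_def abs_if split: if_splits)
    qed
    then show ?thesis by blast
  qed
  then show ?thesis using that[OF hm hB hk(2)] by blast
qed

text \<open>The kinetic energy is convex and the potential energy is continuous under uniform convergence of
  the mollified densities. Hence, once the mollified densities of a minimising sequence converge
  uniformly, the near-minimisers with almost this mollification form convex sets.\<close>

lemma minimiser_exists:
  assumes \<alpha>: "1 \<le> \<alpha>"
  obtains m0 w0 where "(m0, w0) \<in> Bset \<Omega> s s q \<alpha>"
    "\<And>m w. (m, w) \<in> Bset \<Omega> s s q \<alpha> \<Longrightarrow> Eeps H f \<Omega> s s \<epsilon> m0 w0 \<le> Eeps H f \<Omega> s s \<epsilon> m w"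
proof -
  let ?E = "Eeps H f \<Omega> s s \<epsilon>" and ?B = "Bset \<Omega> s s q \<alpha>"
  have \<alpha>0: "0 \<le> \<alpha>" using \<alpha> by simp
  define c where "c = (INF p\<in>?B. ?E (fst p) (snd p))"
  have c_le: "c \<le> ?E m w" if "(m, w) \<in> ?B" for m w
    unfolding c_def using INF_lower[OF that, of "\<lambda>p. ?E (fst p) (snd p)"] by simp
  have "((\<lambda>x. 1), (\<lambda>x. 0)) \<in> ?B"
    using const_in_Kset \<alpha> by (simp add: Bset_def lp_pow_const)
  then have "c \<le> ereal (1 / C_L + (C_f / q + K_f))" using c_le Eeps_const_le order_trans by blast
  moreover have "ereal (- (C_f / q * \<alpha> + K_f)) \<le> c"
    unfolding c_def
  proof (rule INF_greatest)
    fix p assume "p \<in> ?B"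
    then show "ereal (- (C_f / q * \<alpha> + K_f)) \<le> ?E (fst p) (snd p)"
      using Eeps_ge[of "fst p" "snd p" \<alpha>] \<alpha>0 by simp
  qed
  ultimately obtain cr where cr: "c = ereal cr" by (cases c) auto
  have "\<exists>p\<in>?B. ?E (fst p) (snd p) < ereal (cr + 1 / real (Suc n))" for n
  proof -
    have "c < ereal (cr + 1 / real (Suc n))" unfolding cr by simp
    then show ?thesis unfolding c_def INF_less_iff .
  qed
  then obtain p where p: "\<And>n. p n \<in> ?B" "\<And>n. ?E (fst (p n)) (snd (p n)) < ereal (cr + 1 / real (Suc n))" by metis
  define m w where "m n = fst (p n)" and "w n = snd (p n)" for n
  have mw: "(m n, w n) \<in> Kset \<Omega> s s" "lp_pow \<Omega> q (m n) \<le> ennreal \<alpha>" for n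
    using p(1)[of n] by (auto simp: m_def w_def Bset_def)
  have "\<exists>k\<ge>0. Kin (m n) (w n) = ennreal k \<and> k + Feps f \<Omega> \<epsilon> (m n) < cr + 1 / real (Suc n)" for n
    using Eeps_less_imp_Kin[OF mw(1) p(2)[folded m_def w_def]] by metis
  then obtain \<kappa> where \<kappa>: "\<And>n. 0 \<le> \<kappa> n" "\<And>n. Kin (m n) (w n) = ennreal (\<kappa> n)"
    "\<And>n. \<kappa> n + Feps f \<Omega> \<epsilon> (m n) < cr + 1 / real (Suc n)" by metis
  obtain B where B: "0 \<le> B" "\<forall>x::'a. chi_eps \<epsilon> x \<le> B"
    "\<forall>m w x. (m, w) \<in> Kset \<Omega> s s \<longrightarrow> moll \<Omega> \<epsilon> m x \<in> {0..B}" by (rule moll_bounds)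
  obtain h k where h: "h \<in> borel_measurable M" "\<And>x. h x \<in> {0..B}" and k: "strict_mono (k :: nat \<Rightarrow> nat)"
    and unif: "\<And>e. 0 < e \<Longrightarrow> \<exists>N. \<forall>j\<ge>N. \<forall>x\<in>\<Omega>. \<bar>moll \<Omega> \<epsilon> (m (k j)) x - h x\<bar> < e"
    by (rule moll_compactness[OF mw(1) B(3)]) (rule that)
  define Fh where "Fh = (LINT x|M. Fpot f x (h x))"
  define L where "L = C_f * B powr (q - 1) + K_f"
  have L: "0 < L" using C_f K_f by (simp add: L_def add_nonneg_pos)
  have near: "\<exists>j. (\<forall>x\<in>\<Omega>. \<bar>moll \<Omega> \<epsilon> (m j) x - h x\<bar> \<le> 1 / real (Suc n)) \<and> \<kappa> j \<le> cr - Fh + 1 / real (Suc n)" for n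
  proof -
    define \<delta> where "\<delta> = 1 / real (Suc n)"
    have \<delta>: "0 < \<delta>" by (simp add: \<delta>_def)
    \<comment> \<open>Small enough for the required closeness to h, and for the potential energy to
      change by at most L * e \<le> \<delta> / 2.\<close>
    define e where "e = min \<delta> (\<delta> / (2 * L))"
    have e: "0 < e" using \<delta> L by (simp add: e_def)
    obtain N where N: "\<forall>j\<ge>N. \<forall>x\<in>\<Omega>. \<bar>moll \<Omega> \<epsilon> (m (k j)) x - h x\<bar> < e" using unif[OF e] by blast
    \<comment> \<open>An index of at least 2 n + 1 makes the excess 1 / (j + 1) over the infimum at
      most the other half of \<delta>.\<close>
    define i where "i = max N (2 * n + 1)"
    define j where "j = k i"
    have ji: "2 * n + 1 \<le> j" using seq_suble[OF k, of i] by (simp add: i_def j_def)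
    have close: "\<bar>moll \<Omega> \<epsilon> (m j) x - h x\<bar> \<le> e" if "x \<in> \<Omega>" for x
      using N that by (simp add: i_def j_def less_imp_le)
    have "L * e \<le> L * (\<delta> / (2 * L))" using L by (intro mult_left_mono) (auto simp: e_def)
    also have "\<dots> = \<delta> / 2" using L by simp
    finally have Le: "L * e \<le> \<delta> / 2" .
    have "\<bar>Feps f \<Omega> \<epsilon> (m j) - Fh\<bar> \<le> L * e"
      unfolding Fh_def L_def by (rule Feps_diff_le[OF mw(1) _ h close]) (use B(3) mw(1) in blast)
    moreover have "1 / real (Suc j) \<le> \<delta> / 2"
    proof -
      have "1 / real (Suc j) \<le> 1 / (2 * real (Suc n))" using ji by (intro divide_left_mono) auto
      also have "\<dots> = \<delta> / 2" by (simp add: \<delta>_def mult.commute)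
      finally show ?thesis .
    qed
    ultimately have "\<kappa> j \<le> cr - Fh + \<delta>" using \<kappa>(3)[of j] Le by linarith
    moreover have "e \<le> \<delta>" by (simp add: e_def)
    ultimately show ?thesis using close unfolding \<delta>_def by (meson order_trans)
  qed
  \<comment> \<open>The kinetic energy allowed at stage n: the infimum of the total energy less the
    potential energy belonging to h, with a vanishing slack.\<close>
  define b where "b n = cr - Fh + 1 / real (Suc n)" for n
  have b0: "0 \<le> b n" for n using near[of n] \<kappa>(1) unfolding b_def by (meson order_trans)
  have b1: "b n \<le> b 0" for n by (simp add: b_def field_simps)
  have blim: "b \<longlonglongrightarrow> cr - Fh"
  proof -
    have "(\<lambda>n. cr - Fh + inverse (real (Suc n))) \<longlonglongrightarrow> cr - Fh + 0"
      by (intro tendsto_intros LIMSEQ_inverse_real_of_nat)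
    then show ?thesis by (simp add: b_def[abs_def] inverse_eq_divide)
  qed
  have cF: "0 \<le> cr - Fh" using b0 by (intro LIMSEQ_le_const[OF blim]) auto
  define D\<^sub>G where "D\<^sub>G = (C_q * (b 0 / C_L + 1)) powr s"
  define D\<^sub>w where "D\<^sub>w = b 0 / C_L + (C_q * (b 0 / C_L + 1)) powr q"
  have D0: "0 \<le> D\<^sub>G" "0 \<le> D\<^sub>w" using b0[of 0] C_L by (simp_all add: D\<^sub>G_def D\<^sub>w_def)
  \<comment> \<open>The Lebesgue bounds are computed from \<open>b 0\<close> and do not depend on n,
    so that the sets \<open>S n\<close> decrease and share one bound in L^s. Every condition is
    convex, including the closeness of the mollification to h.\<close>
  define adm where "adm n m w G \<longleftrightarrow> flow_triple \<Omega> m w G \<and> powr_integral M q m \<le> ennreal \<alpha> \<and>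
      powr_integral M s w \<le> ennreal D\<^sub>w \<and> powr_integral M s G \<le> ennreal D\<^sub>G \<and>
      Kin m w \<le> ennreal (b n) \<and> (\<forall>x\<in>\<Omega>. \<bar>moll \<Omega> \<epsilon> m x - h x\<bar> \<le> 1 / real (Suc n))"
    for n and m :: "'a \<Rightarrow> real" and w G :: "'a \<Rightarrow> 'a"
  define S where "S n = {u :: 'a \<Rightarrow> real \<times> 'a \<times> 'a. adm n (\<lambda>x. fst (u x)) (\<lambda>x. fst (snd (u x))) (\<lambda>x. snd (snd (u x)))}" for n
  have adm_meas: "m \<in> borel_measurable M" "w \<in> borel_measurable M" "G \<in> borel_measurable M"
    "integrable M m" "integrable M w" "integrable M G" "AE x in M. 0 \<le> m x" if "adm n m w G" for n m w G
    using that by (auto simp: adm_def flow_triple_def)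
  have S_meas: "u \<in> borel_measurable M" if "u \<in> S n" for u n
  proof -
    have "(\<lambda>x. (fst (u x), fst (snd (u x)), snd (snd (u x)))) \<in> borel_measurable M"
      using adm_meas(1-3)[of n] that unfolding S_def by (intro borel_measurable_Pair) blast+
    then show ?thesis by simp
  qed
  have S_ne: "S n \<noteq> {}" for n
  proof -
    obtain j where j: "\<forall>x\<in>\<Omega>. \<bar>moll \<Omega> \<epsilon> (m j) x - h x\<bar> \<le> 1 / real (Suc n)" "\<kappa> j \<le> b n"
      using near[of n] unfolding b_def by blast
    obtain G where G: "memLp \<Omega> s G" "flow_triple \<Omega> (m j) (w j) G"
      using mw(1)[of j] unfolding Kset_iff_flow_triple[OF open_domain domain_lmeasurable less_imp_le[OF s_gt_1]] by blast
    have "Kin (m j) (w j) \<le> ennreal (b 0)"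
      unfolding \<kappa>(2) using order_trans[OF j(2) b1] by (rule ennreal_leI)
    note eb = energy_bounds[OF mw(1) this b0]
    have "weak_grad \<Omega> (m j) G" using G(2) by (simp add: flow_triple_def)
    then have "adm n (m j) (w j) G"
      using G j mw(2)[of j] eb(3)[of G] eb(4) \<kappa>(2)[of j]
      by (simp add: adm_def D\<^sub>G_def D\<^sub>w_def lp_pow_eq[OF domain_sets] ennreal_leI)
    then have "(\<lambda>x. (m j x, w j x, G x)) \<in> S n" by (simp add: S_def)
    then show ?thesis by blast
  qed
  have S_dec: "S (Suc n) \<subseteq> S n" for n
  proof -
    have *: "1 / real (Suc (Suc n)) \<le> 1 / real (Suc n)" by (simp add: field_simps)
    then have "b (Suc n) \<le> b n" by (simp add: b_def)
    then have "ennreal (b (Suc n)) \<le> ennreal (b n)" by (rule ennreal_leI)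
    then have "adm n m w G" if "adm (Suc n) m w G" for m w G
      using that * unfolding adm_def by (meson order_trans)
    then show ?thesis unfolding S_def by blast
  qed
  have S_mid: "(\<lambda>x. (1/2) *\<^sub>R (u x + v x)) \<in> S n" if uv: "u \<in> S n" "v \<in> S n" for u v n
  proof -
    define m1 w1 G1 where "m1 = (\<lambda>x. fst (u x))" and "w1 = (\<lambda>x. fst (snd (u x)))" and "G1 = (\<lambda>x. snd (snd (u x)))"
    define m2 w2 G2 where "m2 = (\<lambda>x. fst (v x))" and "w2 = (\<lambda>x. fst (snd (v x)))" and "G2 = (\<lambda>x. snd (snd (v x)))"
    have a: "adm n m1 w1 G1" "adm n m2 w2 G2" using uv by (simp_all add: S_def m1_def w1_def G1_def m2_def w2_def G2_def)
    note meas = adm_meas[OF a(1)] adm_meas[OF a(2)]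
    have close: "\<bar>moll \<Omega> \<epsilon> (\<lambda>x. (1/2) *\<^sub>R (m1 x + m2 x)) x - h x\<bar> \<le> 1 / real (Suc n)" if x: "x \<in> \<Omega>" for x
    proof -
      have "\<bar>moll \<Omega> \<epsilon> m1 x - h x\<bar> \<le> 1 / real (Suc n)" "\<bar>moll \<Omega> \<epsilon> m2 x - h x\<bar> \<le> 1 / real (Suc n)"
        using a x unfolding adm_def by blast+
      moreover have "\<bar>(1/2) * (y + z) - t\<bar> \<le> d" if "\<bar>y - t\<bar> \<le> d" "\<bar>z - t\<bar> \<le> d" for y z t d :: real
        using that by (simp add: abs_le_iff field_simps)
      ultimately show ?thesis unfolding moll_midpoint[OF meas(4,11)] by blast
    qed
    have "adm n (\<lambda>x. (1/2) *\<^sub>R (m1 x + m2 x)) (\<lambda>x. (1/2) *\<^sub>R (w1 x + w2 x)) (\<lambda>x. (1/2) *\<^sub>R (G1 x + G2 x))"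
      unfolding adm_def
      using a close unfolding adm_def
      by (intro conjI flow_triple_midpoint[OF bounded_domain domain_sets]
          nn_integral_midpoint_powr_le Kin_midpoint meas less_imp_le[OF q] less_imp_le[OF s_gt_1]) auto
    then show ?thesis
      by (simp add: S_def m1_def w1_def G1_def m2_def w2_def G2_def)
  qed
  define C where "C = 3 powr s * (1 + \<alpha> + D\<^sub>w + D\<^sub>G)"
  have S_bd: "powr_integral M s u \<le> ennreal C" if u: "u \<in> S 0" for u
  proof -
    define m1 w1 G1 where "m1 = (\<lambda>x. fst (u x))" and "w1 = (\<lambda>x. fst (snd (u x)))" and "G1 = (\<lambda>x. snd (snd (u x)))"
    have a: "adm 0 m1 w1 G1" using u by (simp add: S_def m1_def w1_def G1_def)
    note meas = adm_meas(1-3)[OF a]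
    have "powr_integral M s u \<le> (\<integral>\<^sup>+x. ennreal (3 powr s) *
        (1 + ennreal (norm (m1 x) powr q) + ennreal (norm (w1 x) powr s) + ennreal (norm (G1 x) powr s)) \<partial>M)"
    proof (rule nn_integral_mono)
      fix x
      have "norm (u x) \<le> norm (m1 x) + norm (snd (u x))"
        unfolding m1_def by (simp add: norm_Pair_le[of "fst (u x)" "snd (u x)", simplified])
      moreover have "norm (snd (u x)) \<le> norm (w1 x) + norm (G1 x)"
        unfolding w1_def G1_def using norm_Pair_le[of "fst (snd (u x))" "snd (snd (u x))"] by simp
      ultimately have "norm (u x) \<le> norm (m1 x) + norm (w1 x) + norm (G1 x)" by linarith
      then have "norm (u x) powr s \<le> (norm (m1 x) + norm (w1 x) + norm (G1 x)) powr s"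
        using s_gt_1 by (intro powr_mono2) auto
      also have "\<dots> \<le> 3 powr s * (norm (m1 x) powr s + norm (w1 x) powr s + norm (G1 x) powr s)"
        using s_gt_1 by (intro powr_sum3_le) auto
      also have "\<dots> \<le> 3 powr s * (1 + norm (m1 x) powr q + norm (w1 x) powr s + norm (G1 x) powr s)"
      proof (intro mult_left_mono add_right_mono)
        show "norm (m1 x) powr s \<le> 1 + norm (m1 x) powr q"
        proof (cases "norm (m1 x) \<le> 1")
          case True
          then have "norm (m1 x) powr s \<le> 1 powr s" using s_gt_1 by (intro powr_mono2) auto
          then show ?thesis by (simp add: add_increasing2)
        next
          case False
          then have "norm (m1 x) powr s \<le> norm (m1 x) powr q" using s_le_q by (intro powr_mono) auto
          then show ?thesis by simp
        qed
      qed simp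
      finally have "ennreal (norm (u x) powr s) \<le> ennreal (3 powr s * (1 + norm (m1 x) powr q + norm (w1 x) powr s + norm (G1 x) powr s))"
        by (rule ennreal_leI)
      also have "\<dots> = ennreal (3 powr s) *
        (1 + ennreal (norm (m1 x) powr q) + ennreal (norm (w1 x) powr s) + ennreal (norm (G1 x) powr s))"
        by (subst ennreal_mult) (simp_all add: ennreal_plus)
      finally show "ennreal (norm (u x) powr s) \<le> ennreal (3 powr s) *
        (1 + ennreal (norm (m1 x) powr q) + ennreal (norm (w1 x) powr s) + ennreal (norm (G1 x) powr s))" .
    qed
    also have "\<dots> = ennreal (3 powr s) * ((\<integral>\<^sup>+x. 1 \<partial>M) + powr_integral M q m1
        + powr_integral M s w1 + powr_integral M s G1)"
      using meas by (simp add: nn_integral_cmult nn_integral_add)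
    also have "\<dots> \<le> ennreal (3 powr s) * (ennreal 1 + ennreal \<alpha> + ennreal D\<^sub>w + ennreal D\<^sub>G)"
    proof (intro mult_left_mono add_mono)
      show "(\<integral>\<^sup>+x. 1 \<partial>M) \<le> ennreal 1" using measure_M by (simp add: emeasure_eq_measure)
    qed (use a in \<open>auto simp: adm_def\<close>)
    also have "\<dots> = ennreal C"
    proof -
      have "ennreal 1 + ennreal \<alpha> + ennreal D\<^sub>w + ennreal D\<^sub>G = ennreal (1 + \<alpha> + D\<^sub>w + D\<^sub>G)"
        using \<alpha>0 D0 by (simp only: ennreal_plus add_nonneg_nonneg zero_le_one)
      then show ?thesis unfolding C_def using \<alpha>0 D0 by (simp only: ennreal_mult powr_ge_zero add_nonneg_nonneg zero_le_one)
    qed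
    finally show ?thesis .
  qed
  obtain u v where uS: "\<And>n. u n \<in> S n" and uv: "AE x in M. (\<lambda>n. u n x) \<longlonglongrightarrow> v x"
    and vi: "integrable M v" and L1: "(\<lambda>n. \<integral>x. norm (u n x - v x) \<partial>M) \<longlonglongrightarrow> 0"
    by (rule convex_selection[of s S C, OF s_gt_1 S_dec S_ne])
       ((rule S_mid; assumption), (rule S_meas; assumption), (rule S_bd; assumption), rule that)
  define mn wn Gn where "mn n x = fst (u n x)" and "wn n x = fst (snd (u n x))" and "Gn n x = snd (snd (u n x))" for n x
  define m0 w0 G0 where "m0 x = fst (v x)" and "w0 x = fst (snd (v x))" and "G0 x = snd (snd (v x))" for x
  have a: "adm n (mn n) (wn n) (Gn n)" for n
    using uS[of n] by (simp add: S_def mn_def[abs_def] wn_def[abs_def] Gn_def[abs_def])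
  note meas = adm_meas[OF a]
  have fl: "flow_triple \<Omega> (mn n) (wn n) (Gn n)" for n using a[of n] by (simp add: adm_def)
  have conv: "AE x in M. (\<lambda>n. mn n x) \<longlonglongrightarrow> m0 x" "AE x in M. (\<lambda>n. wn n x) \<longlonglongrightarrow> w0 x" "AE x in M. (\<lambda>n. Gn n x) \<longlonglongrightarrow> G0 x"
    unfolding mn_def wn_def Gn_def m0_def w0_def G0_def
    using uv by (auto elim!: eventually_mono intro: tendsto_fst tendsto_snd)
  have int0: "integrable M m0" "integrable M w0" "integrable M G0"
  proof -
    have v1: "v \<in> borel_measurable M" using vi by (rule borel_measurable_integrable)
    have vm: "m0 \<in> borel_measurable M" "w0 \<in> borel_measurable M" "G0 \<in> borel_measurable M"
      unfolding m0_def[abs_def] w0_def[abs_def] G0_def[abs_def]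
      by (intro borel_measurable_continuous_on[OF _ v1] continuous_intros)+
    show "integrable M m0"
      by (rule Bochner_Integration.integrable_bound[OF vi vm(1)]) (unfold m0_def, intro AE_I2 norm_proj1_le)
    show "integrable M w0"
      by (rule Bochner_Integration.integrable_bound[OF vi vm(2)])
         (unfold w0_def, intro AE_I2 order_trans[OF norm_proj1_le norm_proj2_le])
    show "integrable M G0"
      by (rule Bochner_Integration.integrable_bound[OF vi vm(3)])
         (unfold G0_def, intro AE_I2 order_trans[OF norm_proj2_le norm_proj2_le])
  qed
  have ui: "integrable M (\<lambda>x. u n x - v x)" for n
  proof -
    have "integrable M (\<lambda>x. (mn n x, wn n x, Gn n x))"
    proof (rule Bochner_Integration.integrable_bound[of _ "\<lambda>x. norm (mn n x) + (norm (wn n x) + norm (Gn n x))"])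
      show "AE x in M. norm (mn n x, wn n x, Gn n x) \<le> norm (norm (mn n x) + (norm (wn n x) + norm (Gn n x)))"
      proof (rule AE_I2)
        fix x
        have "norm (mn n x, wn n x, Gn n x) \<le> norm (mn n x) + norm (wn n x, Gn n x)" by (rule norm_Pair_le)
        also have "norm (wn n x, Gn n x) \<le> norm (wn n x) + norm (Gn n x)" by (rule norm_Pair_le)
        finally show "norm (mn n x, wn n x, Gn n x) \<le> norm (norm (mn n x) + (norm (wn n x) + norm (Gn n x)))" by simp
      qed
    qed (use meas(1-6)[of n] in auto)
    then show ?thesis using vi by (simp add: mn_def wn_def Gn_def)
  qed
  have lim: "(\<lambda>n. \<integral>x. norm (mn n x - m0 x) \<partial>M) \<longlonglongrightarrow> 0" "(\<lambda>n. \<integral>x. norm (wn n x - w0 x) \<partial>M) \<longlonglongrightarrow> 0"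
    "(\<lambda>n. \<integral>x. norm (Gn n x - G0 x) \<partial>M) \<longlonglongrightarrow> 0"
  proof -
    have le: "norm (mn n x - m0 x) \<le> norm (u n x - v x)" "norm (wn n x - w0 x) \<le> norm (u n x - v x)"
      "norm (Gn n x - G0 x) \<le> norm (u n x - v x)" for n x
      unfolding mn_def wn_def Gn_def m0_def w0_def G0_def fst_diff[symmetric] snd_diff[symmetric]
      by (rule norm_proj1_le order_trans[OF norm_proj1_le norm_proj2_le] order_trans[OF norm_proj2_le norm_proj2_le])+
    show "(\<lambda>n. \<integral>x. norm (mn n x - m0 x) \<partial>M) \<longlonglongrightarrow> 0"
      by (rule tendsto_integral_norm_0_mono[OF L1 le(1) ui]) (simp add: meas int0)
    show "(\<lambda>n. \<integral>x. norm (wn n x - w0 x) \<partial>M) \<longlonglongrightarrow> 0"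
      by (rule tendsto_integral_norm_0_mono[OF L1 le(2) ui]) (simp add: meas int0)
    show "(\<lambda>n. \<integral>x. norm (Gn n x - G0 x) \<partial>M) \<longlonglongrightarrow> 0"
      by (rule tendsto_integral_norm_0_mono[OF L1 le(3) ui]) (simp add: meas int0)
  qed
  have flow0: "flow_triple \<Omega> m0 w0 G0"
    by (rule flow_triple_limit[OF bounded_domain domain_sets fl int0 lim conv(1)])
  have s0: "0 < s" and q0: "0 < q" using s_gt_1 q by simp_all
  have bnd_m: "powr_integral M q m0 \<le> ennreal \<alpha>"
    by (rule nn_integral_powr_le_of_AE_limit[OF meas(1) conv(1) q0]) (use a in \<open>simp add: adm_def\<close>)
  have bnd_w: "powr_integral M s w0 \<le> ennreal D\<^sub>w"
    by (rule nn_integral_powr_le_of_AE_limit[OF meas(2) conv(2) s0]) (use a in \<open>simp add: adm_def\<close>)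
  have bnd_G: "powr_integral M s G0 \<le> ennreal D\<^sub>G"
    by (rule nn_integral_powr_le_of_AE_limit[OF meas(3) conv(3) s0]) (use a in \<open>simp add: adm_def\<close>)
  \<comment> \<open>m0 is a component of the limit v, which inherits the L^s bound of the whole
    triple.\<close>
  have ms: "powr_integral M s m0 \<le> ennreal C"
  proof (rule order_trans[OF nn_integral_mono nn_integral_powr_le_of_AE_limit[OF S_meas[OF uS] uv s0]])
    show "ennreal (norm (m0 x) powr s) \<le> ennreal (norm (v x) powr s)" for x
      unfolding m0_def using s0 by (intro ennreal_leI powr_mono2 norm_proj1_le) auto
    show "powr_integral M s (u n) \<le> ennreal C" for n
      using uS[of n] lift_Suc_antimono_le[of S 0 n] S_dec by (intro S_bd) auto
  qed
  have fin: "t < \<infinity>" if "t \<le> ennreal d" for t d using that by (rule le_less_trans) simp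
  have K0: "(m0, w0) \<in> Kset \<Omega> s s"
    unfolding Kset_iff_flow_triple[OF open_domain domain_lmeasurable less_imp_le[OF s_gt_1]]
    using flow0 int0[THEN borel_measurable_integrable] fin[OF ms] fin[OF bnd_w] fin[OF bnd_G]
    by (auto simp: memLp_iff[OF domain_sets])
  have B0: "(m0, w0) \<in> ?B" using K0 bnd_m by (simp add: Bset_def lp_pow_eq[OF domain_sets])
  have Kin0: "Kin m0 w0 \<le> ennreal (cr - Fh)"
  proof -
    have "Kin m0 w0 \<le> liminf (\<lambda>n. Kin (mn n) (wn n))"
      by (rule Kin_le_liminf[OF meas(1,2,7) conv(1,2)])
    also have "\<dots> \<le> liminf (\<lambda>n. ennreal (b n))"
      using a by (intro Liminf_mono always_eventually allI) (simp add: adm_def)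
    also have "\<dots> = ennreal (cr - Fh)"
      by (intro lim_imp_Liminf tendsto_ennrealI blim) simp
    finally show ?thesis .
  qed
  \<comment> \<open>The slack 1 / (n + 1) vanishes and the mollifications converge along with the
    densities in L^1. So the limit mollifies exactly to h on \<Omega>, and its potential energy is
    \<open>Fh\<close>.\<close>
  have moll0: "\<bar>moll \<Omega> \<epsilon> m0 x - h x\<bar> \<le> 0" if x: "x \<in> \<Omega>" for x
  proof -
    have "(\<lambda>n. B * (\<integral>x. norm (mn n x - m0 x) \<partial>M) + inverse (real (Suc n))) \<longlonglongrightarrow> B * 0 + 0"
      by (intro tendsto_intros lim(1) LIMSEQ_inverse_real_of_nat)
    moreover have "\<bar>moll \<Omega> \<epsilon> m0 x - h x\<bar> \<le> B * (\<integral>x. norm (mn n x - m0 x) \<partial>M) + inverse (real (Suc n))" for n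
    proof -
      have "\<bar>moll \<Omega> \<epsilon> (mn n) x - moll \<Omega> \<epsilon> m0 x\<bar> \<le> B * (\<integral>x. norm (mn n x - m0 x) \<partial>M)"
        using moll_lipschitz_L1[OF eps domain_sets meas(4) int0(1) B(2)[rule_format]] by simp
      moreover have "\<bar>moll \<Omega> \<epsilon> (mn n) x - h x\<bar> \<le> inverse (real (Suc n))"
        using a[of n] x by (simp add: adm_def inverse_eq_divide)
      ultimately show ?thesis by linarith
    qed
    ultimately show ?thesis by (intro LIMSEQ_le_const) auto
  qed
  have "\<bar>Feps f \<Omega> \<epsilon> m0 - Fh\<bar> \<le> L * 0"
    unfolding Fh_def L_def by (rule Feps_diff_le[OF K0 _ h moll0]) (use B(3) K0 in blast)
  then have F0: "Feps f \<Omega> \<epsilon> m0 = Fh" by simp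
  have "?E m0 w0 \<le> c"
  proof -
    have "enn2ereal (Kin m0 w0) \<le> enn2ereal (ennreal (cr - Fh))"
      using Kin0 by (simp add: less_eq_ennreal.rep_eq)
    also have "\<dots> = ereal (cr - Fh)" using cF by simp
    finally have "enn2ereal (Kin m0 w0) + ereal Fh \<le> ereal (cr - Fh) + ereal Fh" by (intro add_mono) simp_all
    then show ?thesis unfolding Eeps_eq[OF K0] F0 cr by simp
  qed
  then show ?thesis using that[OF B0] c_le order_trans by blast
qed

end

section \<open>Strict inequality in the constraint and local minimality\<close>

context potential_game
begin

text \<open>This is where the constants originate. The energy bound of the competitor (1, 0) and the
  lower bound on the potential energy give k \<le> 1 / C_L + 2 K_f + (C_f / q) (\<alpha> + 1). After
  multiplication by C_q / C_L the last summand is below 1, by the smallness of C_f; the + 1 in the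
  base of \<alpha> makes room for it. The summand C_L in K'' produces the C_q that the a priori
  estimate adds.\<close>

lemma lp_pow_strict:
  assumes B: "(m, w) \<in> Bset \<Omega> s s q \<alpha>"
    and le: "Eeps H f \<Omega> s s \<epsilon> m w \<le> ereal (1 / C_L + (C_f / q + K_f))"
    and \<alpha>: "\<alpha> = (C_q / C_L * (C_L + 1 / C_L + 2 * K_f) + 1) powr q"
    and small: "C_f < q * C_L / (C_q * (\<alpha> + 1))"
  shows "lp_pow \<Omega> q m < ennreal \<alpha>"
proof -
  define \<beta> where "\<beta> = C_q / C_L * (C_L + 1 / C_L + 2 * K_f) + 1"
  have \<beta>: "0 < \<beta>" "\<alpha> = \<beta> powr q"
    using C_q C_L K_f by (simp_all add: \<alpha> \<beta>_def add_pos_pos)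
  have \<alpha>0: "0 < \<alpha>" using \<beta> by simp
  have K: "(m, w) \<in> Kset \<Omega> s s" "lp_pow \<Omega> q m \<le> ennreal \<alpha>" using B by (auto simp: Bset_def)
  have F: "- (C_f / q * \<alpha> + K_f) \<le> Feps f \<Omega> \<epsilon> m" using abs_Feps_le[OF K less_imp_le[OF \<alpha>0]] by linarith
  obtain k where k: "0 \<le> k" "Kin m w = ennreal k" "k + Feps f \<Omega> \<epsilon> m \<le> 1 / C_L + (C_f / q + K_f)"
    using le unfolding Eeps_eq[OF K(1)] by (cases "Kin m w") auto
  have k_le: "k \<le> 1 / C_L + 2 * K_f + C_f / q * (\<alpha> + 1)" using k(3) F by (simp add: distrib_left)
  have "C_f * (C_q * (\<alpha> + 1)) < q * C_L"
    using small C_q \<alpha>0 by (subst (asm) pos_less_divide_eq) auto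
  then have "C_q / C_L * (C_f / q * (\<alpha> + 1)) < 1"
    using C_L q by (simp add: field_simps)
  moreover have "C_q / C_L * k \<le> C_q / C_L * (1 / C_L + 2 * K_f + C_f / q * (\<alpha> + 1))"
    using k_le C_q C_L by (intro mult_left_mono) auto
  moreover have "C_q * (k / C_L + 1) = C_q / C_L * k + C_q" by (simp add: algebra_simps)
  moreover have "\<beta> = C_q + C_q / C_L * (1 / C_L + 2 * K_f) + 1"
    using C_L by (simp add: \<beta>_def distrib_left)
  ultimately have "C_q * (k / C_L + 1) < \<beta>" by (simp add: distrib_left)
  then have "(C_q * (k / C_L + 1)) powr q < \<alpha>"
    using \<beta>(2) q C_q k C_L by (simp add: powr_less_mono2)
  then have "ennreal ((C_q * (k / C_L + 1)) powr q) < ennreal \<alpha>" by (intro ennreal_lessI \<alpha>0)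
  moreover have "lp_pow \<Omega> q m \<le> ennreal ((C_q * (k / C_L + 1)) powr q)"
    by (rule energy_bounds(2)[OF K(1) _ k(1)]) (simp add: k(2))
  ultimately show ?thesis by (rule le_less_trans[rotated])
qed

text \<open>A perturbation argument with \<open>abs_add_powr_le\<close>: the weight l is so close to
  1 that l^(1 - q) A stays below \<alpha>, and the radius uses up the gap that remains.\<close>

lemma lp_pow_ball:
  fixes m0 :: "'a \<Rightarrow> real"
  assumes m0: "m0 \<in> borel_measurable M" and less: "lp_pow \<Omega> q m0 < ennreal \<alpha>"
  obtains \<rho> where "0 < \<rho>"
    "\<And>m. m \<in> borel_measurable M \<Longrightarrow> lp_pow \<Omega> q (\<lambda>x. m x - m0 x) < ennreal \<rho> \<Longrightarrow> lp_pow \<Omega> q m \<le> ennreal \<alpha>"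
proof -
  obtain A where A: "lp_pow \<Omega> q m0 = ennreal A" "0 \<le> A" using less by (cases "lp_pow \<Omega> q m0") auto
  then have A\<alpha>: "A < \<alpha>" "0 < \<alpha>" using less by (auto simp: ennreal_less_iff)
  \<comment> \<open>Halfway between A / \<alpha> and 1, so that A / t < \<alpha>; the weight l below
    solves l^(1 - q) = 1 / t.\<close>
  define t where "t = (A / \<alpha> + 1) / 2"
  have At: "A / \<alpha> < 1" using A\<alpha> by simp
  have "0 < (x + 1) / 2 \<and> (x + 1) / 2 < 1 \<and> x < (x + 1) / 2" if "0 \<le> x" "x < 1" for x :: real
    using that by simp
  from this[OF _ At] have t: "0 < t" "t < 1" "A / \<alpha> < t" using A A\<alpha> by (simp_all add: t_def)
  define l where "l = t powr (1 / (q - 1))"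
  have l0: "0 < l" using t by (simp add: l_def)
  have l1: "l < 1" using t q powr_less_mono2[of "1 / (q - 1)" t 1] by (simp add: l_def)
  have lq: "l powr (1 - q) = 1 / t"
  proof -
    have "1 / (q - 1) * (1 - q) = - 1" using q by (simp add: field_simps)
    then show ?thesis using t by (simp add: l_def powr_powr powr_minus_divide)
  qed
  define D where "D = (1 - l) powr (1 - q)"
  have D: "0 < D" using l1 by (simp add: D_def)
  define \<rho> where "\<rho> = (\<alpha> - A / t) / D"
  have "A / t < \<alpha>" using t A\<alpha> by (simp add: field_simps)
  then have \<rho>: "0 < \<rho>" using D by (simp add: \<rho>_def)
  have "lp_pow \<Omega> q m \<le> ennreal \<alpha>" if m: "m \<in> borel_measurable M" and near: "lp_pow \<Omega> q (\<lambda>x. m x - m0 x) < ennreal \<rho>" for m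
  proof -
    have "lp_pow \<Omega> q m \<le> (\<integral>\<^sup>+x. ennreal (1 / t) * ennreal (norm (m0 x) powr q) + ennreal D * ennreal (norm (m x - m0 x) powr q) \<partial>M)"
      unfolding lp_pow_eq[OF domain_sets]
    proof (rule nn_integral_mono)
      fix x
      have "\<bar>m0 x + (m x - m0 x)\<bar> powr q \<le> l powr (1 - q) * \<bar>m0 x\<bar> powr q + (1 - l) powr (1 - q) * \<bar>m x - m0 x\<bar> powr q"
        by (rule abs_add_powr_le[OF l0 l1 less_imp_le[OF q]])
      then have "norm (m x) powr q \<le> 1 / t * norm (m0 x) powr q + D * norm (m x - m0 x) powr q"
        by (simp add: lq D_def)
      then have "ennreal (norm (m x) powr q) \<le> ennreal (1 / t * norm (m0 x) powr q + D * norm (m x - m0 x) powr q)"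
        by (rule ennreal_leI)
      also have "\<dots> = ennreal (1 / t) * ennreal (norm (m0 x) powr q) + ennreal D * ennreal (norm (m x - m0 x) powr q)"
        using t D by (subst ennreal_plus) (simp_all only: ennreal_mult powr_ge_zero less_imp_le mult_nonneg_nonneg zero_le_divide_1_iff)
      finally show "ennreal (norm (m x) powr q) \<le> ennreal (1 / t) * ennreal (norm (m0 x) powr q) + ennreal D * ennreal (norm (m x - m0 x) powr q)" .
    qed
    also have "\<dots> = ennreal (1 / t) * lp_pow \<Omega> q m0 + ennreal D * lp_pow \<Omega> q (\<lambda>x. m x - m0 x)"
      unfolding lp_pow_eq[OF domain_sets] using m m0 by (simp add: nn_integral_add nn_integral_cmult)
    also have "\<dots> \<le> ennreal (1 / t) * ennreal A + ennreal D * ennreal \<rho>"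
      using near A(1) by (intro add_mono mult_left_mono) (simp_all add: less_imp_le)
    also have "\<dots> = ennreal (A / t + D * \<rho>)"
      using A(2) D t \<rho> by (simp add: ennreal_mult[symmetric] ennreal_plus[symmetric] del: ennreal_plus)
    also have "A / t + D * \<rho> = \<alpha>" using D by (simp add: \<rho>_def)
    finally show ?thesis .
  qed
  then show ?thesis using that[OF \<rho>] by blast
qed

lemma local_minimiser:
  assumes \<alpha>: "\<alpha> = (C_q / C_L * (C_L + 1 / C_L + 2 * K_f) + 1) powr q"
    and small: "C_f < q * C_L / (C_q * (\<alpha> + 1))"
  shows "\<exists>m0 w0. (m0, w0) \<in> Bset \<Omega> s s q \<alpha> \<and>
      (\<exists>\<rho>>0. \<forall>m w. lp_pow \<Omega> q (\<lambda>x. m x - m0 x) < ennreal \<rho> \<and> lp_pow \<Omega> s (\<lambda>x. w x - w0 x) < ennreal \<rho> \<longrightarrow>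
          Eeps H f \<Omega> s s \<epsilon> m0 w0 \<le> Eeps H f \<Omega> s s \<epsilon> m w) \<and>
      (\<exists>\<delta>b>0. \<forall>\<delta>. 0 < \<delta> \<and> \<delta> < \<delta>b \<longrightarrow>
          Eeps H f \<Omega> s s \<epsilon> m0 w0 = (INF mw\<in>Bset \<Omega> s s q (\<alpha> - \<delta>). Eeps H f \<Omega> s s \<epsilon> (fst mw) (snd mw)) \<and>
          (INF mw\<in>Bset \<Omega> s s q (\<alpha> - \<delta>). Eeps H f \<Omega> s s \<epsilon> (fst mw) (snd mw))
            = (INF mw\<in>Bset \<Omega> s s q \<alpha>. Eeps H f \<Omega> s s \<epsilon> (fst mw) (snd mw)))"
proof -
  let ?E = "Eeps H f \<Omega> s s \<epsilon>"
  have \<alpha>1: "1 \<le> \<alpha>"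
    unfolding \<alpha> using C_q C_L K_f q by (intro ge_one_powr_ge_zero) auto
  obtain m0 w0 where B0: "(m0, w0) \<in> Bset \<Omega> s s q \<alpha>"
    and min: "\<And>m w. (m, w) \<in> Bset \<Omega> s s q \<alpha> \<Longrightarrow> ?E m0 w0 \<le> ?E m w"
    by (rule minimiser_exists[OF \<alpha>1]) (rule that)
  have "((\<lambda>x. 1), (\<lambda>x. 0)) \<in> Bset \<Omega> s s q \<alpha>"
    using const_in_Kset \<alpha>1 by (simp add: Bset_def lp_pow_const)
  then have "?E m0 w0 \<le> ereal (1 / C_L + (C_f / q + K_f))" using min Eeps_const_le order_trans by blast
  then have strict: "lp_pow \<Omega> q m0 < ennreal \<alpha>" by (rule lp_pow_strict[OF B0 _ \<alpha> small])
  have K0: "(m0, w0) \<in> Kset \<Omega> s s" using B0 by (simp add: Bset_def)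
  obtain \<rho> where \<rho>: "0 < \<rho>"
    "\<And>m. m \<in> borel_measurable M \<Longrightarrow> lp_pow \<Omega> q (\<lambda>x. m x - m0 x) < ennreal \<rho> \<Longrightarrow> lp_pow \<Omega> q m \<le> ennreal \<alpha>"
    by (rule lp_pow_ball[OF Kset_measurable(1)[OF K0] strict]) (rule that)
  \<comment> \<open>Closeness of m in L^q keeps an admissible pair inside \<open>Bset\<close>; for
    pairs that are not admissible the energy is \<infinity>.\<close>
  have local: "?E m0 w0 \<le> ?E m w" if "lp_pow \<Omega> q (\<lambda>x. m x - m0 x) < ennreal \<rho>" for m w
  proof (cases "(m, w) \<in> Kset \<Omega> s s")
    case True
    then have "(m, w) \<in> Bset \<Omega> s s q \<alpha>"
      using \<rho>(2)[OF Kset_measurable(1)[OF True] that] by (simp add: Bset_def)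
    then show ?thesis by (rule min)
  qed (simp add: Eeps_def)
  obtain A where A: "lp_pow \<Omega> q m0 = ennreal A" "0 \<le> A" using strict by (cases "lp_pow \<Omega> q m0") auto
  have A\<alpha>: "A < \<alpha>" using strict A by (simp add: ennreal_less_iff)
  \<comment> \<open>For a level between A and \<alpha> the constraint set shrinks but still contains
    the minimiser. This is why \<alpha> - A serves as the threshold for \<delta>.\<close>
  have inf: "?E m0 w0 = (INF mw\<in>Bset \<Omega> s s q \<alpha>'. ?E (fst mw) (snd mw))" if \<alpha>': "A \<le> \<alpha>'" "\<alpha>' \<le> \<alpha>" for \<alpha>'
  proof (rule antisym)
    have "Bset \<Omega> s s q \<alpha>' \<subseteq> Bset \<Omega> s s q \<alpha>"
      using ennreal_leI[OF \<alpha>'(2)] by (auto simp: Bset_def intro: order_trans)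
    then show "?E m0 w0 \<le> (INF mw\<in>Bset \<Omega> s s q \<alpha>'. ?E (fst mw) (snd mw))"
      using min by (intro INF_greatest) auto
    have "(m0, w0) \<in> Bset \<Omega> s s q \<alpha>'" using K0 A ennreal_leI[OF \<alpha>'(1)] by (simp add: Bset_def)
    from INF_lower[OF this, of "\<lambda>mw. ?E (fst mw) (snd mw)"]
    show "(INF mw\<in>Bset \<Omega> s s q \<alpha>'. ?E (fst mw) (snd mw)) \<le> ?E m0 w0" by simp
  qed
  have gap: "\<forall>\<delta>. 0 < \<delta> \<and> \<delta> < \<alpha> - A \<longrightarrow>
      ?E m0 w0 = (INF mw\<in>Bset \<Omega> s s q (\<alpha> - \<delta>). ?E (fst mw) (snd mw)) \<and>
      (INF mw\<in>Bset \<Omega> s s q (\<alpha> - \<delta>). ?E (fst mw) (snd mw)) = (INF mw\<in>Bset \<Omega> s s q \<alpha>. ?E (fst mw) (snd mw))"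
  proof (intro allI impI)
    fix \<delta> :: real assume \<delta>: "0 < \<delta> \<and> \<delta> < \<alpha> - A"
    have 1: "?E m0 w0 = (INF mw\<in>Bset \<Omega> s s q (\<alpha> - \<delta>). ?E (fst mw) (snd mw))" by (rule inf) (use \<delta> in auto)
    have 2: "?E m0 w0 = (INF mw\<in>Bset \<Omega> s s q \<alpha>. ?E (fst mw) (snd mw))" by (rule inf) (use A\<alpha> in auto)
    show "?E m0 w0 = (INF mw\<in>Bset \<Omega> s s q (\<alpha> - \<delta>). ?E (fst mw) (snd mw)) \<and>
      (INF mw\<in>Bset \<Omega> s s q (\<alpha> - \<delta>). ?E (fst mw) (snd mw)) = (INF mw\<in>Bset \<Omega> s s q \<alpha>. ?E (fst mw) (snd mw))"
      by (intro conjI 1) (rule trans[OF 1[symmetric] 2])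
  qed
  have "0 < \<alpha> - A" using A\<alpha> by simp
  then show ?thesis using B0 \<rho>(1) local gap by blast
qed

end

text \<open>Both sides equal \<gamma> q / ((\<gamma> - 1) q + 1). Hence m, its weak gradient and w
  share one exponent, and a triple can be treated as a single function in L^s.\<close>

lemma exponents_agree:
  fixes \<gamma> q :: real
  assumes "\<gamma> > 1" "q > 1"
  shows "1 / ((\<gamma> - 1) / \<gamma> + 1 / (\<gamma> * q)) = (\<gamma> / (\<gamma> - 1)) * q / (\<gamma> / (\<gamma> - 1) + q - 1)"
proof -
  define d where "d = (\<gamma> - 1) * q + 1"
  have d: "d > 0" using assms by (simp add: d_def add_nonneg_pos)
  have "(\<gamma> - 1) / \<gamma> + 1 / (\<gamma> * q) = d / (\<gamma> * q)" using assms by (simp add: d_def field_simps)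
  moreover have "\<gamma> / (\<gamma> - 1) + q - 1 = d / (\<gamma> - 1)" using assms by (simp add: d_def field_simps)
  ultimately show ?thesis using assms d by simp
qed

theorem theorem3p4:
  fixes \<Omega> :: "'a::euclidean_space set"
    and H :: "'a \<Rightarrow> real" and DH :: "'a \<Rightarrow> 'a"
    and f :: "'a \<Rightarrow> real \<Rightarrow> real"
    and C_H K_H \<gamma> C_f K_f q C_L C_q \<epsilon> :: real
  assumes dom: "bounded_C3_domain \<Omega>" and vol: "measure lebesgue \<Omega> = 1"
    and H_grad: "is_gradient H DH"
    and CH: "C_H > 1" and KH: "K_H > 0" and gam: "\<gamma> > 1"
    and H_growth: "\<And>p. norm p powr \<gamma> / C_H - K_H \<le> H p \<and> H p \<le> C_H * norm p powr \<gamma> + K_H"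
    and H_conv: "\<And>p. DH p \<bullet> p - H p \<ge> norm p powr \<gamma> / C_H - C_H"
    and H_Dbound: "\<And>p. norm (DH p) \<le> C_H * norm p powr (\<gamma> - 1) + K_H"
    and f_lip: "locally_Lipschitz_f f"
    and Cf: "C_f > 0" and Kf: "K_f > 0" and q1: "q > 1"
    and f_bound: "\<And>x m. m \<ge> 0 \<Longrightarrow> - C_f * m powr (q - 1) - K_f \<le> f x m \<and> f x m \<le> C_f * m powr (q - 1) + K_f"
    and CL: "C_L > 0"
    and L_bound: "\<And>v. C_L * norm v powr (\<gamma> / (\<gamma> - 1)) \<le> Lag H v \<and>
                        Lag H v \<le> (norm v powr (\<gamma> / (\<gamma> - 1)) + 1) / C_L"
    and Cq: "C_q > 0"
    and Cq_bound: "\<And>m w. (m, w) \<in> Kset \<Omega> (1 / ((\<gamma> - 1) / \<gamma> + 1 / (\<gamma> * q)))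
                                     ((\<gamma> / (\<gamma> - 1)) * q / (\<gamma> / (\<gamma> - 1) + q - 1)) \<Longrightarrow>
                 Ekin \<Omega> (\<gamma> / (\<gamma> - 1)) m w < \<infinity> \<Longrightarrow>
                 (\<forall>G. weak_grad \<Omega> m G \<and> memLp \<Omega> (1 / ((\<gamma> - 1) / \<gamma> + 1 / (\<gamma> * q))) G \<longrightarrow>
                    Lp_norm \<Omega> (1 / ((\<gamma> - 1) / \<gamma> + 1 / (\<gamma> * q))) m
                    + Lp_norm \<Omega> (1 / ((\<gamma> - 1) / \<gamma> + 1 / (\<gamma> * q))) G
                    \<le> C_q * (enn2real (Ekin \<Omega> (\<gamma> / (\<gamma> - 1)) m w) + 1)) \<and>
                 lp_pow \<Omega> q m \<le> ennreal ((C_q * (enn2real (Ekin \<Omega> (\<gamma> / (\<gamma> - 1)) m w) + 1)) powr q)"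
    and eps: "\<epsilon> > 0"
    and qbar: "q > 1 + (\<gamma> / (\<gamma> - 1)) / DIM('a)"
    and Cf_small: "C_f < q * C_L / (C_q * ((C_q / C_L * (C_L + 1 / C_L + 2 * K_f) + 1) powr q + 1))"
  shows "let g' = \<gamma> / (\<gamma> - 1);
             r = 1 / (1 / g' + 1 / (\<gamma> * q));
             s = g' * q / (g' + q - 1);
             \<alpha> = (C_q / C_L * (C_L + 1 / C_L + 2 * K_f) + 1) powr q;
             E = Eeps H f \<Omega> r s \<epsilon>;
             c = (\<lambda>a. INF mw \<in> Bset \<Omega> r s q a. E (fst mw) (snd mw))
         in \<exists>m0 w0. (m0, w0) \<in> Bset \<Omega> r s q \<alpha> \<and>
              (\<exists>\<rho>>0. \<forall>m w. lp_pow \<Omega> q (\<lambda>x. m x - m0 x) < ennreal \<rho> \<and>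
                            lp_pow \<Omega> s (\<lambda>x. w x - w0 x) < ennreal \<rho> \<longrightarrow> E m0 w0 \<le> E m w) \<and>
              (\<exists>\<delta>b>0. \<forall>\<delta>. 0 < \<delta> \<and> \<delta> < \<delta>b \<longrightarrow> E m0 w0 = c (\<alpha> - \<delta>) \<and> c (\<alpha> - \<delta>) = c \<alpha>)"
proof -
  define g s where "g = \<gamma> / (\<gamma> - 1)" and "s = g * q / (g + q - 1)"
  have r: "1 / ((\<gamma> - 1) / \<gamma> + 1 / (\<gamma> * q)) = s"
    unfolding s_def g_def by (rule exponents_agree[OF gam q1])
  have r': "1 / (1 / g + 1 / (\<gamma> * q)) = s"
    using r by (simp add: g_def)
  \<comment> \<open>The growth of H enters as finiteness of its Legendre transform and the Lipschitz
    condition on f as joint continuity; with r = s the a priori estimate takes the form demanded by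
    the locale.\<close>
  interpret potential_game \<Omega> H f g q s C_f K_f C_L C_q \<epsilon>
  proof
    show "open \<Omega>" "bounded \<Omega>" using dom by (simp_all add: bounded_C3_domain_def)
    show "measure lebesgue \<Omega> = 1" by (rule vol)
    show "bdd_above (range (\<lambda>p. p \<bullet> v - H p))" for v
      by (rule Lag_bdd_above[OF gam, where C=C_H and K=K_H]) (use CH H_growth in auto)
    show "g > 1" using gam by (simp add: g_def)
    show "s = g * q / (g + q - 1)" by (rule s_def)
    show "continuous_on (UNIV \<times> {0..}) (\<lambda>(x, m). f x m)" by (rule continuous_on_of_locally_Lipschitz[OF f_lip])
    show "\<bar>f x m\<bar> \<le> C_f * m powr (q - 1) + K_f" if "m \<ge> 0" for x m
      using f_bound[OF that, of x] by (simp add: abs_le_iff)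
    show "C_L * norm v powr g \<le> Lag H v" for v using L_bound[of v] by (simp add: g_def)
    show "Lag H 0 \<le> 1 / C_L" using L_bound[of 0] by simp
    show "(\<forall>G. weak_grad \<Omega> m G \<and> memLp \<Omega> s G \<longrightarrow>
          Lp_norm \<Omega> s m + Lp_norm \<Omega> s G \<le> C_q * (enn2real (Ekin \<Omega> g m w) + 1)) \<and>
        lp_pow \<Omega> q m \<le> ennreal ((C_q * (enn2real (Ekin \<Omega> g m w) + 1)) powr q)"
      if "(m, w) \<in> Kset \<Omega> s s" "Ekin \<Omega> g m w < \<infinity>" for m w
      using Cq_bound[unfolded r, folded g_def, folded s_def, OF that] .
  qed (use q1 Cf Kf CL Cq eps in auto)
  show ?thesis
    unfolding Let_def g_def[symmetric] r' s_def[symmetric]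
    by (rule local_minimiser[OF refl Cf_small])
qed

end
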